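(* Let $X$ be a Polish metric space, $p\in[1,\infty)$, and let $\mu$ be a countably $1$-rectifiable finite Borel measure on $X$ with finite $p$th moments. Let $\rho$ be the density of the absolutely continuous component of $\mu$ with respect to $\mathcal{H}^1$. Then $$\underline{Q}_{p,1}(\mu)\ \ge\ C_{p,1}\left(\int_X\rho^{\frac{1}{1+p}}\,d\mathcal{H}^1\right)^{\frac{p+1}{p}}.$$ If moreover $\mu$ is $(p,1)$-quantizable, then the quantization coefficient $Q_{p,1}(\mu)=\lim_{N\to\infty}N\,e_{N,p}(\mu)$ exists and coincides with the right-hand side. Consequently (for $\mu$ $(p,1)$-quantizable), if the right-hand side is finite and positive, then for any asymptotically optimal sequence $(S_N)_N$ of quantizers for $\mu$, $$\frac1N\sum_{x\in S_N}\delta_x\ \rightharpoonup\ \frac{\rho^{\frac{1}{1+p}}}{\int_X\rho^{\frac{1}{1+p}}\,d\mathcal{H}^1}\,\mathcal{H}^1\qquad\text{weakly as }N\to\infty.$$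
   Context: A Polish metric space is a complete separable metric space $(X,d)$. $\mathcal{H}^1$ is the $1$-dimensional Hausdorff measure, normalized to coincide with Lebesgue measure on $\mathbb{R}$. A Borel measure $\mu$ on $X$ is countably $1$-rectifiable if $\mu(X\setminus\bigcup_{i=1}^\infty F_i(A_i))=0$ for a countable family of nonempty Borel sets $A_i\subseteq\mathbb{R}$ and Lipschitz maps $F_i\colon A_i\to X$ (absolute continuity with respect to $\mathcal{H}^1$ is not required; $\mathcal{H}^1$ restricted to $\bigcup_iF_i(A_i)$ is $\sigma$-finite, so the Lebesgue decomposition makes sense). Finite $p$th moments: $\int d(x,x_0)^p\,d\mu<\infty$ for some (equivalently all) $x_0\in X$. For a nonempty set $S$, $e_p(\mu;S):=(\int d(x,S)^p\,d\mu(x))^{1/p}$, and $e_{N,p}(\mu):=\inf\{e_p(\mu;S):\emptyset\ne S\subseteq X,\ \#S\le N\}$. $\underline{Q}_{p,s}(\mu):=\liminf_{N\to\infty}N^{1/s}e_{N,p}(\mu)$, $\overline{Q}_{p,s}(\mu):=\limsup_{N\to\infty}N^{1/s}e_{N,p}(\mu)$; $Q_{p,s}(\mu)$ is the common value if they agree. $\mu$ is $(p,s)$-quantizable if $\overline{Q}_{p,s}(\mu_k)\to0$ for every sequence of Borel measures $\mu_k\le\mu$ with $\mu_k(X)\to0$. A sequence $(S_N)_N$ of finite sets with $\#S_N\le N$ is asymptotically optimal (for $\mu$, order $p$, dimension $1$) if $\lim_{N\to\infty}N\,e_p(\mu;S_N)=\underline{Q}_{p,1}(\mu)$. $C_{p,1}:=\lim_{N\to\infty}N\,e_{N,p}(\mathcal{L}^1|_{[0,1]})$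 is the constant of Zador's theorem on $\mathbb{R}$, with $C_{p,1}^p=\frac{1}{2^p(p+1)}$. *)

theory Defs
  imports "HOL-Analysis.Analysis"
begin

text \<open>
  The Polish metric space \<open>X\<close> is a type of class \<^class>\<open>polish_space\<close> (complete, second countable
  metric space), and a Borel measure on \<open>X\<close> is a measure \<open>\<mu>\<close> with \<open>sets \<mu> = sets borel\<close>.
\<close>

section \<open>One-dimensional Hausdorff measure\<close>

text \<open>The library's \<^const>\<open>diameter\<close> is real-valued and meaningless on unbounded sets.\<close>

definition ediam :: "'a::metric_space set \<Rightarrow> ennreal" where
  "ediam U = (SUP x\<in>U. SUP y\<in>U. ennreal (dist x y))"

definition hausdorff1_pre :: "real \<Rightarrow> 'a::metric_space set \<Rightarrow> ennreal" where
  "hausdorff1_pre \<delta> A =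
     (INF U\<in>{U :: nat \<Rightarrow> 'a set. A \<subseteq> (\<Union>i. U i) \<and> (\<forall>i. ediam (U i) \<le> ennreal \<delta>)}. \<Sum>i. ediam (U i))"

definition hausdorff1_outer :: "'a::metric_space set \<Rightarrow> ennreal" where
  "hausdorff1_outer A = (SUP \<delta>\<in>{0<..}. hausdorff1_pre \<delta> A)"

text \<open>
  By the convention of \<^const>\<open>measure_of\<close>, the following would be the zero measure if the outer
  measure were not countably additive on Borel sets; it is, see \<open>emeasure_hausdorff1\<close> below.
\<close>

definition hausdorff1 :: "'a::metric_space measure" where
  "hausdorff1 = measure_of UNIV (sets borel) hausdorff1_outer"

lemma space_hausdorff1 [simp]: "space hausdorff1 = UNIV"
  by (simp add: hausdorff1_def)

lemma sets_hausdorff1 [simp, measurable_cong]: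
  "sets (hausdorff1 :: 'a::metric_space measure) = sets borel"
  unfolding hausdorff1_def using sets.sets_measure_of_eq[of "borel :: 'a measure"] by simp

lemma ediam_empty [simp]: "ediam {} = 0"
  by (simp add: ediam_def bot_ennreal)

lemma ediam_mono: "A \<subseteq> B \<Longrightarrow> ediam A \<le> ediam B"
  unfolding ediam_def by (auto intro!: SUP_subset_mono)

lemma dist_le_ediam: "x \<in> U \<Longrightarrow> y \<in> U \<Longrightarrow> ennreal (dist x y) \<le> ediam U"
  unfolding ediam_def by (meson SUP_upper2 SUP_upper)

lemma hausdorff1_pre_le:
  "A \<subseteq> (\<Union>i. U i) \<Longrightarrow> (\<And>i. ediam (U i) \<le> ennreal \<delta>) \<Longrightarrow> hausdorff1_pre \<delta> A \<le> (\<Sum>i. ediam (U i))"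
  unfolding hausdorff1_pre_def by (rule INF_lower) auto

lemma hausdorff1_pre_antimono: "\<delta> \<le> \<delta>' \<Longrightarrow> hausdorff1_pre \<delta>' A \<le> hausdorff1_pre \<delta> A"
  unfolding hausdorff1_pre_def
  by (rule INF_superset_mono) (auto intro: order_trans ennreal_leI)

lemma outer_measure_space_hausdorff1_pre:
  "outer_measure_space (UNIV :: 'a::metric_space set set) (hausdorff1_pre \<delta>)"
proof -
  define f where "f = (\<lambda>U::'a set. if ediam U \<le> ennreal \<delta> then ediam U else top)"
  interpret sigma_algebra "UNIV :: 'a set" "UNIV :: 'a set set"
    by (simp add: sigma_algebra_iff2)
  have pos: "positive UNIV f"
    by (simp add: positive_def f_def)
  have inc: "increasing UNIV f"
    by (auto simp: increasing_def f_def intro: ediam_mono dest: ediam_mono)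
  have "hausdorff1_pre \<delta> A = outer_measure UNIV f A" for A
  proof (rule antisym)
    show "hausdorff1_pre \<delta> A \<le> outer_measure UNIV f A"
      unfolding outer_measure_def
    proof (rule INF_greatest, clarsimp)
      fix U :: "nat \<Rightarrow> 'a set" assume U: "A \<subseteq> (\<Union>i. U i)"
      show "hausdorff1_pre \<delta> A \<le> (\<Sum>i. f (U i))"
      proof (cases "\<forall>i. ediam (U i) \<le> ennreal \<delta>")
        case True
        then show ?thesis using hausdorff1_pre_le[OF U] by (simp add: f_def)
      next
        case False
        then obtain i where "\<not> ediam (U i) \<le> ennreal \<delta>" by blast
        then have "f (U i) = top" by (simp add: f_def)
        then have "(\<Sum>i. f (U i)) = top" by (metis ennreal_suminf_lessD less_top top.not_eq_extremum order.irrefl)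
        then show ?thesis by simp
      qed
    qed
    show "outer_measure UNIV f A \<le> hausdorff1_pre \<delta> A"
      unfolding hausdorff1_pre_def
    proof (rule INF_greatest, clarsimp)
      fix U :: "nat \<Rightarrow> 'a set" assume U: "A \<subseteq> (\<Union>i. U i)" "\<forall>i. ediam (U i) \<le> ennreal \<delta>"
      have "outer_measure UNIV f A \<le> (\<Sum>i. f (disjointed U i))"
        unfolding outer_measure_def
        using U by (intro INF_lower) (auto simp: disjoint_family_disjointed UN_disjointed_eq)
      also have "\<dots> \<le> (\<Sum>i. f (U i))"
        by (intro suminf_le summableI increasingD[OF inc] disjointed_subset) auto
      finally show "outer_measure UNIV f A \<le> (\<Sum>i. ediam (U i))"
        using U by (simp add: f_def)
    qed
  qed
  then have "hausdorff1_pre \<delta> = outer_measure UNIV f" by auto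
  then show ?thesis using outer_measure_space_outer_measure[OF pos inc] by simp
qed

lemma outer_measure_space_hausdorff1_outer:
  "outer_measure_space (UNIV :: 'a::metric_space set set) hausdorff1_outer"
proof -
  note * = outer_measure_space_hausdorff1_pre[unfolded outer_measure_space_def, where 'a='a]
  have "positive (UNIV :: 'a set set) hausdorff1_outer"
    using * by (simp add: positive_def hausdorff1_outer_def)
  moreover have "increasing (UNIV :: 'a set set) hausdorff1_outer"
    using * unfolding increasing_def hausdorff1_outer_def by (auto intro!: SUP_mono')
  moreover have "countably_subadditive (UNIV :: 'a set set) hausdorff1_outer"
    unfolding countably_subadditive_def
  proof (intro allI impI)
    fix A :: "nat \<Rightarrow> 'a set" assume d: "disjoint_family A"
    show "hausdorff1_outer (\<Union>i. A i) \<le> (\<Sum>i. hausdorff1_outer (A i))"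
      unfolding hausdorff1_outer_def[of "\<Union>i. A i"]
    proof (rule SUP_least)
      fix \<delta> :: real assume "\<delta> \<in> {0<..}"
      have "hausdorff1_pre \<delta> (\<Union>i. A i) \<le> (\<Sum>i. hausdorff1_pre \<delta> (A i))"
        using * d by (auto simp: countably_subadditive_def)
      also have "\<dots> \<le> (\<Sum>i. hausdorff1_outer (A i))"
        unfolding hausdorff1_outer_def using \<open>\<delta> \<in> _\<close> by (intro suminf_le summableI SUP_upper)
      finally show "hausdorff1_pre \<delta> (\<Union>i. A i) \<le> (\<Sum>i. hausdorff1_outer (A i))" .
    qed
  qed
  ultimately show ?thesis by (simp add: outer_measure_space_def)
qed

lemma hausdorff1_outer_mono: "A \<subseteq> B \<Longrightarrow> hausdorff1_outer A \<le> hausdorff1_outer B"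
  using outer_measure_space_hausdorff1_outer by (auto simp: outer_measure_space_def increasing_def)

lemma hausdorff1_outer_empty [simp]: "hausdorff1_outer {} = 0"
  using outer_measure_space_hausdorff1_outer by (auto simp: outer_measure_space_def positive_def)

lemma hausdorff1_outer_Un_le: "hausdorff1_outer (A \<union> B) \<le> hausdorff1_outer A + hausdorff1_outer B"
proof -
  interpret sigma_algebra "UNIV :: 'a set" "UNIV :: 'a set set"
    by (simp add: sigma_algebra_iff2)
  have "subadditive (UNIV :: 'a set set) hausdorff1_outer"
    using outer_measure_space_hausdorff1_outer[where 'a='a] countably_subadditive_subadditive
    by (auto simp: outer_measure_space_def)
  then have "hausdorff1_outer (A \<union> (B - A)) \<le> hausdorff1_outer A + hausdorff1_outer (B - A)"
    unfolding subadditive_def by blast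
  also have "\<dots> \<le> hausdorff1_outer A + hausdorff1_outer B"
    by (intro add_left_mono hausdorff1_outer_mono) auto
  finally show ?thesis by simp
qed

lemma hausdorff1_outer_UN_le:
  fixes A :: "nat \<Rightarrow> 'a::metric_space set"
  shows "hausdorff1_outer (\<Union>i. A i) \<le> (\<Sum>i. hausdorff1_outer (A i))"
proof -
  have "hausdorff1_outer (\<Union>i. disjointed A i) \<le> (\<Sum>i. hausdorff1_outer (disjointed A i))"
    using outer_measure_space_hausdorff1_outer[where 'a='a] disjoint_family_disjointed[of A]
    unfolding outer_measure_space_def countably_subadditive_def by auto
  also have "\<dots> \<le> (\<Sum>i. hausdorff1_outer (A i))"
    by (intro suminf_le summableI hausdorff1_outer_mono disjointed_subset)
  finally show ?thesis by (simp add: UN_disjointed_eq)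
qed

lemma hausdorff1_outer_separated:
  assumes e: "0 < e" and sep: "\<And>x y. x \<in> A \<Longrightarrow> y \<in> B \<Longrightarrow> e \<le> dist x y"
  shows "hausdorff1_outer A + hausdorff1_outer B \<le> hausdorff1_outer (A \<union> B)"
proof -
  have 1: "hausdorff1_pre \<delta> A + hausdorff1_pre \<delta> B \<le> hausdorff1_pre \<delta> (A \<union> B)"
    if \<delta>: "0 < \<delta>" "\<delta> < e" for \<delta>
    unfolding hausdorff1_pre_def[of \<delta> "A \<union> B"]
  proof (rule INF_greatest, clarsimp)
    fix U :: "nat \<Rightarrow> 'a set"
    assume U: "A \<subseteq> (\<Union>i. U i)" "B \<subseteq> (\<Union>i. U i)" "\<forall>i. ediam (U i) \<le> ennreal \<delta>"
    define V where "V i = (if U i \<inter> A = {} then {} else U i)" for i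
    define W where "W i = (if U i \<inter> B = {} then {} else U i)" for i
    have disj: "U i \<inter> A = {} \<or> U i \<inter> B = {}" for i
    proof (rule ccontr)
      assume "\<not> ?thesis"
      then obtain x y where xy: "x \<in> U i" "x \<in> A" "y \<in> U i" "y \<in> B" by blast
      then have "ennreal (dist x y) \<le> ennreal \<delta>"
        using dist_le_ediam U(3) by (meson order_trans)
      then have "dist x y \<le> \<delta>" using \<delta> by (simp add: ennreal_le_iff)
      with sep[OF xy(2,4)] \<delta> show False by simp
    qed
    have "hausdorff1_pre \<delta> A \<le> (\<Sum>i. ediam (V i))"
      using U(1,3) by (intro hausdorff1_pre_le) (fastforce simp: V_def)+
    moreover have "hausdorff1_pre \<delta> B \<le> (\<Sum>i. ediam (W i))"
      using U(2,3) by (intro hausdorff1_pre_le) (fastforce simp: W_def)+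
    ultimately have "hausdorff1_pre \<delta> A + hausdorff1_pre \<delta> B \<le> (\<Sum>i. ediam (V i)) + (\<Sum>i. ediam (W i))"
      by (rule add_mono)
    also have "\<dots> = (\<Sum>i. ediam (V i) + ediam (W i))"
      by (intro suminf_add summableI)
    also have "\<dots> \<le> (\<Sum>i. ediam (U i))"
      using disj by (intro suminf_le summableI) (auto simp: V_def W_def)
    finally show "hausdorff1_pre \<delta> A + hausdorff1_pre \<delta> B \<le> (\<Sum>i. ediam (U i))" .
  qed
  have "hausdorff1_outer A + hausdorff1_outer B =
      (SUP \<delta>\<in>{0<..}. hausdorff1_pre \<delta> A + hausdorff1_pre \<delta> B)"
    unfolding hausdorff1_outer_def
  proof (rule SUP_add_directed_ennreal[symmetric])
    fix i j :: real assume "i \<in> {0<..}" "j \<in> {0<..}"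
    then show "\<exists>k\<in>{0<..}. hausdorff1_pre i A + hausdorff1_pre j B \<le> hausdorff1_pre k A + hausdorff1_pre k B"
      by (intro bexI[of _ "min i j"] add_mono hausdorff1_pre_antimono) auto
  qed
  also have "\<dots> \<le> hausdorff1_outer (A \<union> B)"
  proof (rule SUP_least)
    fix \<delta> :: real assume "\<delta> \<in> {0<..}"
    then have m: "0 < min \<delta> (e/2)" "min \<delta> (e/2) < e" using e by auto
    have "hausdorff1_pre \<delta> A + hausdorff1_pre \<delta> B \<le>
        hausdorff1_pre (min \<delta> (e/2)) A + hausdorff1_pre (min \<delta> (e/2)) B"
      by (intro add_mono hausdorff1_pre_antimono) auto
    also have "\<dots> \<le> hausdorff1_pre (min \<delta> (e/2)) (A \<union> B)" by (rule 1[OF m])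
    also have "\<dots> \<le> hausdorff1_outer (A \<union> B)"
      unfolding hausdorff1_outer_def using m by (intro SUP_upper) auto
    finally show "hausdorff1_pre \<delta> A + hausdorff1_pre \<delta> B \<le> hausdorff1_outer (A \<union> B)" .
  qed
  finally show ?thesis .
qed

lemma hausdorff1_outer_separated_sum:
  fixes R :: "nat \<Rightarrow> 'a::metric_space set"
  assumes sep: "\<And>n. \<exists>e>0. \<forall>i<n. \<forall>x\<in>R i. \<forall>y\<in>R n. e \<le> dist x y"
  shows "(\<Sum>i<n. hausdorff1_outer (R i)) \<le> hausdorff1_outer (\<Union>i<n. R i)"
proof (induction n)
  case (Suc n)
  obtain e where e: "e > 0" "\<forall>i<n. \<forall>x\<in>R i. \<forall>y\<in>R n. e \<le> dist x y" using sep by blast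
  have "(\<Sum>i<Suc n. hausdorff1_outer (R i)) \<le> hausdorff1_outer (\<Union>i<n. R i) + hausdorff1_outer (R n)"
    using Suc by (simp add: add_right_mono)
  also have "\<dots> \<le> hausdorff1_outer ((\<Union>i<n. R i) \<union> R n)"
    using e by (intro hausdorff1_outer_separated[of e]) auto
  also have "(\<Union>i<n. R i) \<union> R n = (\<Union>i<Suc n. R i)"
    by (auto simp: lessThan_Suc)
  finally show ?case .
qed simp

lemma closed_caratheodory_hausdorff1:
  assumes C: "closed C"
  shows "hausdorff1_outer (E \<inter> C) + hausdorff1_outer (E - C) \<le> hausdorff1_outer E"
proof (cases "C = {} \<or> hausdorff1_outer E = top")
  case True then show ?thesis by auto
next
  case False
  then have ne: "C \<noteq> {}" and fin: "hausdorff1_outer E < top" by (auto simp: less_top)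
  let ?H = "hausdorff1_outer"
  define D where "D n = {x\<in>E. 1 / real (Suc n) \<le> infdist x C}" for n
  define R where "R n = {x\<in>E. 1 / real (Suc (Suc n)) \<le> infdist x C \<and> infdist x C < 1 / real (Suc n)}" for n
  have Rsep: "1 / real n - 1 / real (Suc n) \<le> dist x y"
    if *: "Suc (Suc i) \<le> n" "x \<in> R i" "y \<in> R n" for i n x y
  proof -
    have "1 / real n \<le> 1 / real (Suc (Suc i))" using * by (intro divide_left_mono) auto
    moreover have "infdist x C \<le> infdist y C + dist x y" by (rule infdist_triangle)
    ultimately show ?thesis using * by (auto simp: R_def)
  qed
  have pos: "0 < 1 / real n - 1 / real (Suc n)" if "0 < n" for n
    using that by (simp add: field_simps add_pos_pos)
  have half: "(\<Sum>i<n. ?H (R (2 * i + c))) \<le> ?H E" for n c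
  proof -
    have "(\<Sum>i<n. ?H (R (2 * i + c))) \<le> ?H (\<Union>i<n. R (2 * i + c))"
    proof (rule hausdorff1_outer_separated_sum)
      fix n
      show "\<exists>e>0. \<forall>i<n. \<forall>x\<in>R (2 * i + c). \<forall>y\<in>R (2 * n + c). e \<le> dist x y"
      proof (cases "n = 0")
        case True
        then show ?thesis by (auto intro: exI[of _ 1])
      next
        case False
        then show ?thesis
          by (intro exI[of _ "1 / real (2 * n + c) - 1 / real (Suc (2 * n + c))"] conjI pos allI impI ballI Rsep)
             auto
      qed
    qed
    also have "\<dots> \<le> ?H E" by (rule hausdorff1_outer_mono) (auto simp: R_def)
    finally show ?thesis .
  qed
  have "(\<Sum>i. ?H (R i)) \<le> ?H E + ?H E"
  proof (rule suminf_le_const[OF summableI])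
    fix n
    have "(\<Sum>i<n. ?H (R i)) \<le> (\<Sum>i<2 * n. ?H (R i))"
      by (rule sum_mono2) auto
    also have "\<dots> = (\<Sum>i<n. ?H (R (2 * i + 0))) + (\<Sum>i<n. ?H (R (2 * i + 1)))"
      by (induction n) (simp_all add: algebra_simps)
    also have "\<dots> \<le> ?H E + ?H E" by (intro add_mono half)
    finally show "(\<Sum>i<n. ?H (R i)) \<le> ?H E + ?H E" .
  qed
  also have "\<dots> < top" using fin by simp
  finally have sfin: "(\<Sum>i. ?H (R i)) < top" .
  have tail: "?H (E \<inter> C) + ?H (E - C) + (\<Sum>i<n. ?H (R i)) \<le> ?H E + (\<Sum>i. ?H (R i))" for n
  proof -
    have "E - C \<subseteq> D n \<union> (\<Union>k. R (k + n))"
    proof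
      fix x assume x: "x \<in> E - C"
      then have "infdist x C > 0"
        using C ne in_closed_iff_infdist_zero[OF C ne] by (simp add: infdist_nonneg order_less_le)
      then have ex: "\<exists>m. 1 / real (Suc m) \<le> infdist x C"
        using nat_approx_posE by (metis less_imp_le)
      define m where "m = (LEAST m. 1 / real (Suc m) \<le> infdist x C)"
      have m: "1 / real (Suc m) \<le> infdist x C" unfolding m_def using ex by (rule LeastI_ex)
      have m': "infdist x C < 1 / real (Suc k)" if "k < m" for k
        using not_less_Least[OF that[unfolded m_def]] by (simp only: not_le)
      show "x \<in> D n \<union> (\<Union>k. R (k + n))"
      proof (cases "m \<le> n")
        case True
        have "1 / real (Suc n) \<le> 1 / real (Suc m)" using True by (intro divide_left_mono) auto
        then show ?thesis using m x by (auto simp: D_def)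
      next
        case False
        define k where "k = m - Suc n"
        have mk: "m = Suc (k + n)" using False by (simp add: k_def)
        then have "x \<in> R (k + n)" using m m'[of "k + n"] x by (auto simp: R_def)
        then show ?thesis by blast
      qed
    qed
    then have "?H (E - C) \<le> ?H (D n \<union> (\<Union>k. R (k + n)))" by (rule hausdorff1_outer_mono)
    also have "\<dots> \<le> ?H (D n) + (\<Sum>k. ?H (R (k + n)))"
      by (rule order_trans[OF hausdorff1_outer_Un_le add_left_mono[OF hausdorff1_outer_UN_le]])
    finally have "?H (E \<inter> C) + ?H (E - C) + (\<Sum>i<n. ?H (R i))
        \<le> ?H (E \<inter> C) + (?H (D n) + (\<Sum>k. ?H (R (k + n)))) + (\<Sum>i<n. ?H (R i))"
      by (intro add_mono order_refl)
    also have "\<dots> = (?H (E \<inter> C) + ?H (D n)) + (\<Sum>i. ?H (R i))"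
      using suminf_offset[OF summableI, of "\<lambda>i. ?H (R i)" n] by (simp add: algebra_simps)
    also have "?H (E \<inter> C) + ?H (D n) \<le> ?H ((E \<inter> C) \<union> D n)"
    proof (rule hausdorff1_outer_separated[of "1 / real (Suc n)"])
      fix x y assume "x \<in> E \<inter> C" "y \<in> D n"
      then show "1 / real (Suc n) \<le> dist x y"
        using infdist_le[of x C y] by (auto simp: D_def dist_commute)
    qed simp
    also have "\<dots> \<le> ?H E" by (rule hausdorff1_outer_mono) (auto simp: D_def)
    finally show ?thesis by (simp add: add_right_mono)
  qed
  have "(\<lambda>n. ?H (E \<inter> C) + ?H (E - C) + (\<Sum>i<n. ?H (R i)))
      \<longlonglongrightarrow> ?H (E \<inter> C) + ?H (E - C) + (\<Sum>i. ?H (R i))"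
    by (intro tendsto_add tendsto_const summable_LIMSEQ summableI)
  then have "?H (E \<inter> C) + ?H (E - C) + (\<Sum>i. ?H (R i)) \<le> ?H E + (\<Sum>i. ?H (R i))"
    using tail by (intro LIMSEQ_le_const2) auto
  then show ?thesis using sfin by (auto simp: ennreal_add_left_cancel_le add.commute)
qed

proposition emeasure_hausdorff1:
  assumes "A \<in> sets borel"
  shows "emeasure hausdorff1 A = hausdorff1_outer (A :: 'a::metric_space set)"
proof -
  interpret S: sigma_algebra "UNIV :: 'a set" "UNIV :: 'a set set"
    by (simp add: sigma_algebra_iff2)
  let ?L = "lambda_system (UNIV :: 'a set) UNIV hausdorff1_outer"
  have ms: "measure_space UNIV ?L hausdorff1_outer"
    by (rule S.caratheodory_lemma[OF outer_measure_space_hausdorff1_outer])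
  have "C \<in> ?L" if "closed C" for C :: "'a set"
  proof -
    have "hausdorff1_outer (x \<inter> C) + hausdorff1_outer (x - C) = hausdorff1_outer x" for x
    proof (rule antisym[OF closed_caratheodory_hausdorff1[OF that]])
      show "hausdorff1_outer x \<le> hausdorff1_outer (x \<inter> C) + hausdorff1_outer (x - C)"
        using hausdorff1_outer_Un_le[of "x \<inter> C" "x - C"] by (simp add: Un_Diff_Int Un_commute Int_Diff_Un)
    qed
    then show ?thesis by (simp add: S.lambda_system_eq)
  qed
  then have "sigma_sets UNIV (Collect closed) \<subseteq> ?L"
    using ms by (intro sigma_algebra.sigma_sets_subset) (auto simp: measure_space_def)
  then have borel_sub: "sets borel \<subseteq> ?L" by (simp add: borel_eq_closed)
  have "countably_additive (sets borel) (hausdorff1_outer :: 'a set \<Rightarrow> ennreal)"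
    using ms borel_sub unfolding measure_space_def countably_additive_def by blast
  moreover have "positive (sets borel) (hausdorff1_outer :: 'a set \<Rightarrow> ennreal)"
    by (simp add: positive_def)
  ultimately show ?thesis
    using assms sets.sigma_algebra_axioms[of "borel :: 'a measure"]
    unfolding hausdorff1_def by (intro emeasure_measure_of_sigma) auto
qed

section \<open>Rectifiability and the absolutely continuous component\<close>

text \<open>
  The images \<open>F i ` A i\<close> need not be Borel; \<open>AE\<close> says that the complement of their union is contained
  in a Borel \<open>\<mu>\<close>-null set.
\<close>

definition countably_1_rectifiable :: "'a::metric_space measure \<Rightarrow> bool" where
  "countably_1_rectifiable \<mu> \<longleftrightarrow>
     (\<exists>(A :: nat \<Rightarrow> real set) (F :: nat \<Rightarrow> real \<Rightarrow> 'a).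
        (\<forall>i. A i \<noteq> {} \<and> A i \<in> sets borel \<and> (\<exists>L. L-lipschitz_on (A i) (F i))) \<and>
        (AE x in \<mu>. x \<in> (\<Union>i. F i ` A i)))"

text \<open>
  \<open>\<rho>\<close> is a (finite-valued) density of the absolutely continuous component in the Lebesgue
  decomposition \<open>\<mu> = \<rho> \<nu> + \<sigma>\<close> with \<open>\<sigma> \<bottom> \<nu>\<close>. For finite \<open>\<mu>\<close> it is \<open>\<nu>\<close>-almost everywhere unique,
  also if \<open>\<nu>\<close> is not \<open>\<sigma>\<close>-finite.
\<close>

definition ac_density :: "'a measure \<Rightarrow> 'a measure \<Rightarrow> ('a \<Rightarrow> real) \<Rightarrow> bool" where
  "ac_density \<nu> \<mu> \<rho> \<longleftrightarrow>
     \<rho> \<in> borel_measurable \<nu> \<and> (\<forall>x. 0 \<le> \<rho> x) \<and>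
     (\<exists>\<sigma>. sets \<sigma> = sets \<nu> \<and> (\<exists>Z\<in>null_sets \<nu>. emeasure \<sigma> (space \<nu> - Z) = 0) \<and>
        (\<forall>B\<in>sets \<nu>. emeasure \<mu> B = emeasure (density \<nu> (\<lambda>x. ennreal (\<rho> x))) B + emeasure \<sigma> B))"

section \<open>Quantization errors and coefficients\<close>

text \<open>The power \<open>x\<^sup>a\<close> of an extended nonnegative number, for \<open>a > 0\<close>.\<close>

definition epowr :: "ennreal \<Rightarrow> real \<Rightarrow> ennreal" where
  "epowr x a = (if x = top then top else ennreal (enn2real x powr a))"

definition finite_moment :: "real \<Rightarrow> 'a::metric_space measure \<Rightarrow> bool" where
  "finite_moment p \<mu> \<longleftrightarrow> (\<exists>x0. (\<integral>\<^sup>+x. ennreal (dist x x0 powr p) \<partial>\<mu>) < top)"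

definition quant_err :: "real \<Rightarrow> 'a::metric_space measure \<Rightarrow> 'a set \<Rightarrow> ennreal" where
  "quant_err p \<mu> S = epowr (\<integral>\<^sup>+x. ennreal (infdist x S powr p) \<partial>\<mu>) (1 / p)"

definition opt_quant_err :: "nat \<Rightarrow> real \<Rightarrow> 'a::metric_space measure \<Rightarrow> ennreal" where
  "opt_quant_err N p \<mu> = (INF S\<in>{S. S \<noteq> {} \<and> finite S \<and> card S \<le> N}. quant_err p \<mu> S)"

definition lower_quant_coeff :: "real \<Rightarrow> real \<Rightarrow> 'a::metric_space measure \<Rightarrow> ennreal" where
  "lower_quant_coeff p s \<mu> = liminf (\<lambda>N. ennreal (real N powr (1 / s)) * opt_quant_err N p \<mu>)"

definition upper_quant_coeff :: "real \<Rightarrow> real \<Rightarrow> 'a::metric_space measure \<Rightarrow> ennreal" where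
  "upper_quant_coeff p s \<mu> = limsup (\<lambda>N. ennreal (real N powr (1 / s)) * opt_quant_err N p \<mu>)"

text \<open>On measures with the same \<open>\<sigma>\<close>-algebra, \<open>\<le>\<close> is the setwise order.\<close>

definition quantizable :: "real \<Rightarrow> real \<Rightarrow> 'a::metric_space measure \<Rightarrow> bool" where
  "quantizable p s \<mu> \<longleftrightarrow>
     (\<forall>\<mu>' :: nat \<Rightarrow> 'a measure.
        (\<forall>k. sets (\<mu>' k) = sets borel \<and> \<mu>' k \<le> \<mu>) \<and> (\<lambda>k. emeasure (\<mu>' k) UNIV) \<longlonglongrightarrow> 0 \<longrightarrow>
        (\<lambda>k. upper_quant_coeff p s (\<mu>' k)) \<longlonglongrightarrow> 0)"

definition zador_const :: "real \<Rightarrow> ennreal" where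
  "zador_const p = lim (\<lambda>N. ennreal (real N) * opt_quant_err N p (density lborel (indicator {0..1::real})))"

text \<open>The index \<open>0\<close> is disregarded, since no nonempty set has at most \<open>0\<close> elements.\<close>

definition asymptotically_optimal :: "real \<Rightarrow> 'a::metric_space measure \<Rightarrow> (nat \<Rightarrow> 'a set) \<Rightarrow> bool" where
  "asymptotically_optimal p \<mu> S \<longleftrightarrow>
     (\<forall>N\<ge>1. S N \<noteq> {} \<and> finite (S N) \<and> card (S N) \<le> N) \<and>
     (\<lambda>N. ennreal (real N) * quant_err p \<mu> (S N)) \<longlonglongrightarrow> lower_quant_coeff p 1 \<mu>"

section \<open>Weak convergence of point configurations\<close>

definition weakly_converges :: "(nat \<Rightarrow> 'a::metric_space measure) \<Rightarrow> 'a measure \<Rightarrow> bool" where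
  "weakly_converges M L \<longleftrightarrow>
     (\<forall>f :: 'a \<Rightarrow> real. continuous_on UNIV f \<longrightarrow> bounded (range f) \<longrightarrow>
        (\<lambda>N. \<integral>x. f x \<partial>M N) \<longlonglongrightarrow> (\<integral>x. f x \<partial>L))"

text \<open>The push-forward of the counting measure on \<open>S\<close> is the sum of the Dirac measures at points of \<open>S\<close>.\<close>

definition empirical_measure :: "nat \<Rightarrow> 'a::metric_space set \<Rightarrow> 'a measure" where
  "empirical_measure N S = scale_measure (ennreal (1 / real N)) (distr (count_space S) borel (\<lambda>x. x))"

lemma emeasure_empirical_measure:
  assumes "finite S" "B \<in> sets borel"
  shows "emeasure (empirical_measure N S) B = ennreal (real (card (S \<inter> B)) / real N)"
  using assms
  by (simp add: empirical_measure_def emeasure_distr Int_commute ennreal_of_nat_eq_real_of_nat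
      flip: ennreal_mult)

end

theory Submission
  imports Defs "HOL-Probability.Distribution_Functions" "HOL-Real_Asymp.Real_Asymp"
begin

text \<open>
  Write \<open>H\<close> for \<open>hausdorff1\<close>, \<open>g = \<rho> powr (1 / (1 + p))\<close>, \<open>I = \<integral> g dH\<close> and
  \<open>C = 1 / (2 powr p * (p + 1))\<close>, the \<open>p\<close>-th power of Zador's constant. All estimates concern
  \<open>N powr p * \<integral> d(x, S) powr p d\<mu>\<close> for sets \<open>S\<close> of at most \<open>N\<close> points, which has to be compared with
  \<open>C * I powr (p + 1)\<close>.

  Lower bound. A ball of radius \<open>t\<close> has diameter at most \<open>2 t\<close>. Hence, if \<open>\<delta>\<close> is so small that the
  premeasure \<open>hausdorff1_pre \<delta> E\<close> nearly attains \<open>H(E)\<close> and \<open>2 t \<le> \<delta>\<close>, the points of \<open>E\<close> at distance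
  more than \<open>t\<close> from \<open>S\<close> have measure almost \<open>H(E) - 2 t N\<close> (\<open>hausdorff1_far_set_ge\<close>). Integrating
  over \<open>t\<close> by the layer cake formula gives the bound on one piece. For the measure \<open>\<mu>\<close> the same is
  done on finitely many disjoint compact sets on which \<open>g\<close> is at least a constant \<open>y\<close>, with the
  radius \<open>t / y\<close>: for small \<open>t\<close> a point of \<open>S\<close> serves only one of them. The resulting inequality
  \<open>local_lower_bound\<close> is linear in the number of points near the given compact set and has a free
  parameter \<open>\<tau>\<close>, the rescaled radius at which the integration stops. Taking for \<open>\<tau>\<close> the total mass
  yields the lower bound of the theorem (\<open>lower_quant_coeff_ge\<close>).

  Upper bound. Let \<open>K = F(B)\<close> be the injective Lipschitz image of a compact \<open>B \<subseteq> \<real>\<close>. Two points of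
  \<open>K\<close> are no further apart than the \<open>H\<close>-measure of the part of \<open>K\<close> between them plus a multiple of
  the length of the gaps of \<open>B\<close> that are passed (\<open>dist_le_hausdorff1_plus_gaps\<close>). Reparametrizing by
  this quantity turns \<open>F\<close> into a 1-Lipschitz map from a compact \<open>V \<subseteq> \<real>\<close> of Lebesgue measure at most
  \<open>H(K)\<close> onto \<open>K\<close> (\<open>lipschitz_arc_reparametrization\<close>). So a net that is good for Lebesgue measure on
  \<open>V\<close> is carried to a net at least as good for \<open>H\<close> on \<open>K\<close>, and on \<open>V\<close> one takes the points closest
  to the centres of a fine grid (\<open>compact_real_net\<close>, \<open>lipschitz_arc_net\<close>). Up to small \<open>\<mu>\<close>-measure,
  \<open>\<mu>\<close> lives on finitely many such arcs, on each of which either \<open>g\<close> is almost constant, equal to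
  \<open>y\<close>, and a net of mesh \<open>\<delta> / y\<close> is used, or \<open>H\<close> vanishes, and even few points form a fine net
  (\<open>rectifiable_nets\<close>). Quantizability permits to neglect the remainder at the cost of a small
  fraction of the points (\<open>upper_quant_coeff_le_nets_limit\<close>). The value of Zador's constant follows
  from the two bounds on the unit interval.

  Point distribution. For an open set \<open>D\<close> the lower bound is applied on \<open>D\<close> with \<open>\<tau> = t\<close> slightly
  larger than \<open>I\<close> and on the complement with \<open>\<tau> = I\<close>. For an asymptotically optimal sequence the sum
  of the two inequalities bounds the fraction of points in \<open>D\<close> from below by a quantity that tends
  to \<open>(\<integral>\<^bsub>D\<^esub> g dH) / I\<close> as \<open>t\<close> decreases to \<open>I\<close> (\<open>near_optimal_local_count\<close>). Such lower bounds on
  all open sets imply weak convergence (\<open>weakly_converges_if_open_mass\<close>).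
\<close>

section \<open>Hausdorff measure on the line and under Lipschitz maps\<close>

lemma hausdorff1_pre_mono: "A \<subseteq> B \<Longrightarrow> hausdorff1_pre \<delta> A \<le> hausdorff1_pre \<delta> B"
  using outer_measure_space_hausdorff1_pre[of \<delta>, where 'a='a]
  by (auto simp: outer_measure_space_def increasing_def)

lemma hausdorff1_pre_empty [simp]: "hausdorff1_pre \<delta> {} = 0"
  using outer_measure_space_hausdorff1_pre[of \<delta>, where 'a='a]
  by (auto simp: outer_measure_space_def positive_def)

lemma hausdorff1_pre_Un_le: "hausdorff1_pre \<delta> (A \<union> B) \<le> hausdorff1_pre \<delta> A + hausdorff1_pre \<delta> B"
proof -
  interpret sigma_algebra "UNIV :: 'a set" "UNIV :: 'a set set"
    by (simp add: sigma_algebra_iff2)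
  have "subadditive (UNIV :: 'a set set) (hausdorff1_pre \<delta>)"
    using outer_measure_space_hausdorff1_pre[of \<delta>, where 'a='a] countably_subadditive_subadditive
    by (auto simp: outer_measure_space_def)
  then have "hausdorff1_pre \<delta> (A \<union> (B - A)) \<le> hausdorff1_pre \<delta> A + hausdorff1_pre \<delta> (B - A)"
    unfolding subadditive_def by blast
  also have "\<dots> \<le> hausdorff1_pre \<delta> A + hausdorff1_pre \<delta> B"
    by (intro add_left_mono hausdorff1_pre_mono) auto
  finally show ?thesis by simp
qed

lemma hausdorff1_pre_UN_le:
  "finite S \<Longrightarrow> hausdorff1_pre \<delta> (\<Union>s\<in>S. A s) \<le> (\<Sum>s\<in>S. hausdorff1_pre \<delta> (A s))"
proof (induction S rule: finite_induct)
  case (insert s S)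
  then show ?case
    using order_trans[OF hausdorff1_pre_Un_le add_left_mono] by fastforce
qed simp

lemma hausdorff1_pre_le_ediam:
  assumes "ediam A \<le> ennreal \<delta>"
  shows "hausdorff1_pre \<delta> A \<le> ediam A"
proof -
  have "hausdorff1_pre \<delta> A \<le> (\<Sum>i. ediam (if i = (0::nat) then A else {}))"
    using assms by (intro hausdorff1_pre_le) auto
  also have "\<dots> = (\<Sum>i\<in>{0}. ediam (if i = (0::nat) then A else {}))"
    by (intro suminf_finite) auto
  finally show ?thesis by simp
qed

lemma ediam_cball_le: "ediam (cball x r) \<le> ennreal (2 * r)"
proof -
  have "dist y z \<le> 2 * r" if "y \<in> cball x r" "z \<in> cball x r" for y z
    using that dist_triangle3[of y z x] by (auto simp: dist_commute)
  then show ?thesis unfolding ediam_def by (intro SUP_least ennreal_leI) auto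
qed

text \<open>
  A cover of \<open>A\<close> is mapped to a cover of the image whose diameters are larger by a factor of at most
  \<open>L\<close>. The factor is taken positive, so that it can be moved out of the infimum over the covers.
\<close>

lemma hausdorff1_outer_lipschitz_image:
  assumes f: "L-lipschitz_on A f" and L: "0 < L"
  shows "hausdorff1_outer (f ` A) \<le> ennreal L * hausdorff1_outer A"
  unfolding hausdorff1_outer_def[of "f ` A"]
proof (rule SUP_least)
  fix \<delta> :: real assume "\<delta> \<in> {0<..}"
  then have \<delta>: "0 < \<delta> / L" using L by simp
  have "hausdorff1_pre \<delta> (f ` A) / ennreal L \<le> hausdorff1_pre (\<delta> / L) A"
    unfolding hausdorff1_pre_def[of "\<delta> / L"]
  proof (rule INF_greatest, clarify)
    fix U :: "nat \<Rightarrow> 'a set" assume U: "A \<subseteq> (\<Union>i. U i)" "\<forall>i. ediam (U i) \<le> ennreal (\<delta> / L)"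
    have d: "ediam (f ` (U i \<inter> A)) \<le> ennreal L * ediam (U i)" for i
      unfolding ediam_def[of "f ` (U i \<inter> A)"]
    proof (safe intro!: SUP_least)
      fix x y assume xy: "x \<in> U i" "x \<in> A" "y \<in> U i" "y \<in> A"
      have "ennreal (dist (f x) (f y)) \<le> ennreal (L * dist x y)"
        using lipschitz_onD[OF f] xy by (intro ennreal_leI) auto
      also have "\<dots> = ennreal L * ennreal (dist x y)" using L by (simp add: ennreal_mult)
      also have "\<dots> \<le> ennreal L * ediam (U i)" using xy by (intro mult_left_mono dist_le_ediam) auto
      finally show "ennreal (dist (f x) (f y)) \<le> ennreal L * ediam (U i)" .
    qed
    have "ennreal L * ennreal (\<delta> / L) = ennreal \<delta>" using L \<delta> by (simp flip: ennreal_mult)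
    then have d': "ennreal L * ediam (U i) \<le> ennreal \<delta>" for i
      using U(2) by (metis mult_left_mono zero_le)
    have "hausdorff1_pre \<delta> (f ` A) \<le> (\<Sum>i. ediam (f ` (U i \<inter> A)))"
    proof (rule hausdorff1_pre_le)
      show "f ` A \<subseteq> (\<Union>i. f ` (U i \<inter> A))" using U(1) by (simp add: image_UN[symmetric]
        Int_UN_distrib2[symmetric]) (blast intro: imageI)
      show "ediam (f ` (U i \<inter> A)) \<le> ennreal \<delta>" for i by (rule order_trans[OF d d'])
    qed
    also have "\<dots> \<le> (\<Sum>i. ennreal L * ediam (U i))"
      by (intro suminf_le summableI d)
    also have "\<dots> = ennreal L * (\<Sum>i. ediam (U i))" by simp
    finally show "hausdorff1_pre \<delta> (f ` A) / ennreal L \<le> (\<Sum>i. ediam (U i))"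
      using L by (intro divide_le_posI_ennreal) auto
  qed
  also have "\<dots> \<le> hausdorff1_outer A"
    unfolding hausdorff1_outer_def using \<delta> by (intro SUP_upper) auto
  finally have "ennreal L * (hausdorff1_pre \<delta> (f ` A) / ennreal L) \<le> ennreal L * hausdorff1_outer A"
    by (intro mult_left_mono) auto
  then show "hausdorff1_pre \<delta> (f ` A) \<le> ennreal L * hausdorff1_outer A"
    using L by (simp add: ennreal_times_divide mult.commute[of "ennreal L"] mult_divide_eq_ennreal)
qed

lemma hausdorff1_outer_singleton [simp]: "hausdorff1_outer {x} = 0"
proof -
  have "ediam {x} = 0" by (simp add: ediam_def)
  then have "hausdorff1_pre \<delta> {x} \<le> 0" for \<delta>
    using hausdorff1_pre_le_ediam[of "{x}" \<delta>] by simp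
  then have "hausdorff1_outer {x} \<le> 0" unfolding hausdorff1_outer_def by (intro SUP_least) auto
  then show ?thesis by simp
qed

text \<open>
  On the line, diameter and length of the convex hull agree; this is why \<open>H\<close> is Lebesgue measure
  there.
\<close>

lemma real_set_within_interval:
  fixes U :: "real set"
  assumes "ediam U < top"
  obtains a b where "a \<le> b" "U \<subseteq> {a..b}" "ennreal (b - a) \<le> ediam U"
proof (cases "U = {}")
  case True
  then show ?thesis using that[of 0 0] by simp
next
  case False
  define d where "d = enn2real (ediam U)"
  have d: "ediam U = ennreal d" "0 \<le> d" using assms by (auto simp: d_def)
  have le: "x - y \<le> d" if "x \<in> U" "y \<in> U" for x y
    using dist_le_ediam[OF that] d by (auto simp: dist_real_def)
  obtain x0 where x0: "x0 \<in> U" using False by auto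
  have bdd: "bdd_above U" "bdd_below U"
    using le[OF _ x0] le[OF x0] by (auto intro!: bdd_aboveI[of _ "x0
      + d"] bdd_belowI[of _ "x0 - d"] simp: algebra_simps)
  have "Sup U \<le> y + d" if "y \<in> U" for y
    using le[OF _ that] False by (intro cSup_least) (auto simp: algebra_simps)
  then have "Sup U - d \<le> Inf U" using False by (intro cInf_greatest) (auto simp: algebra_simps)
  moreover have "Inf U \<le> Sup U" using cInf_lower[OF x0] cSup_upper[OF x0] bdd by linarith
  ultimately show ?thesis
    using bdd d by (intro that[of "Inf U" "Sup U"]) (auto intro!: cInf_lower cSup_upper ennreal_leI)
qed

lemma lborel_le_hausdorff1_outer:
  fixes A :: "real set"
  assumes A: "A \<in> sets borel"
  shows "emeasure lborel A \<le> hausdorff1_outer A"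
proof -
  have "emeasure lborel A \<le> hausdorff1_pre 1 A"
    unfolding hausdorff1_pre_def
  proof (rule INF_greatest, clarify)
    fix U :: "nat \<Rightarrow> real set" assume U: "A \<subseteq> (\<Union>i. U i)" "\<forall>i. ediam (U i) \<le> ennreal 1"
    have "\<exists>a b. a \<le> b \<and> U i \<subseteq> {a..b} \<and> ennreal (b - a) \<le> ediam (U i)" for i
    proof -
      have "ediam (U i) < top" using U(2) by (metis ennreal_less_top order_le_less_trans)
      then show ?thesis using real_set_within_interval by metis
    qed
    then obtain a b where ab: "\<And>i. a i \<le> b i" "\<And>i. U i \<subseteq> {a i..b i}" "\<And>i. ennreal (b i - a i) \<le> ediam (U i)"
      by metis
    have "emeasure lborel A \<le> emeasure lborel (\<Union>i. {a i..b i})"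
      using U ab(2) by (intro emeasure_mono) fastforce+
    also have "\<dots> \<le> (\<Sum>i. emeasure lborel {a i..b i})"
      by (intro emeasure_subadditive_countably) auto
    also have "\<dots> \<le> (\<Sum>i. ediam (U i))"
      using ab by (intro suminf_le summableI) (auto simp: emeasure_lborel_Icc)
    finally show "emeasure lborel A \<le> (\<Sum>i. ediam (U i))" .
  qed
  also have "\<dots> \<le> hausdorff1_outer A" unfolding hausdorff1_outer_def by (intro SUP_upper) auto
  finally show ?thesis .
qed

lemma ediam_Icc_le: "ediam {a..b::real} \<le> ennreal (b - a)"
  unfolding ediam_def by (intro SUP_least ennreal_leI) (auto simp: dist_real_def)

text \<open>
  Subdivision into \<open>n\<close> intervals of equal length, with \<open>n\<close> so large that the diameters are at most
  \<open>\<delta>\<close>.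
\<close>

lemma hausdorff1_outer_Icc_le:
  assumes "a \<le> b"
  shows "hausdorff1_outer {a..b} \<le> ennreal (b - a)"
  unfolding hausdorff1_outer_def
proof (rule SUP_least)
  fix \<delta> :: real assume "\<delta> \<in> {0<..}"
  then have \<delta>: "0 < \<delta>" by simp
  obtain n :: nat where n: "(b - a) / \<delta> < n" using reals_Archimedean2 by blast
  have n0: "0 < n" using n assms \<delta> by (metis divide_nonneg_pos diff_ge_0_iff_ge gr0I not_le of_nat_0)
  define h where "h = (b - a) / n"
  have h: "0 \<le> h" "h \<le> \<delta>" "n * h = b - a"
    using assms n n0 \<delta> by (auto simp: h_def field_simps)
  define U where "U k = {a + k * h..a + (real k + 1) * h}" for k :: nat
  have dU: "ediam (U k) \<le> ennreal h" for k
    using ediam_Icc_le[of "a + k * h" "a + (real k + 1) * h"] by (simp add: U_def algebra_simps)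
  have "{a..b} \<subseteq> (\<Union>k\<in>{..<n}. U k)"
  proof
    fix x assume x: "x \<in> {a..b}"
    show "x \<in> (\<Union>k\<in>{..<n}. U k)"
    proof (cases "h = 0 \<or> x = b")
      case True
      then show ?thesis using x h n0 by (auto simp: U_def of_nat_diff algebra_simps intro!: bexI[of _ "n
        - 1"])
    next
      case False
      then have hp: "0 < h" and xb: "x < b" using h x by auto
      define k where "k = nat \<lfloor>(x - a) / h\<rfloor>"
      have k: "real k \<le> (x - a) / h" "(x - a) / h < real k + 1"
        using x hp by (auto simp: k_def) 
      have "real k < n" using k(1) hp xb h(3) by (smt (verit) divide_less_eq mult.commute)
      then show ?thesis using k hp by (auto simp: U_def field_simps intro!: bexI[of _ k])
    qed
  qed
  then have "hausdorff1_pre \<delta> {a..b} \<le> hausdorff1_pre \<delta> (\<Union>k\<in>{..<n}. U k)" by (rule hausdorff1_pre_mono)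
  also have "\<dots> \<le> (\<Sum>k<n. hausdorff1_pre \<delta> (U k))" by (rule hausdorff1_pre_UN_le) simp
  also have "\<dots> \<le> (\<Sum>k<n. ennreal h)"
  proof (rule sum_mono)
    fix k
    have "ediam (U k) \<le> ennreal \<delta>" using dU h(2) by (meson ennreal_leI order_trans)
    then show "hausdorff1_pre \<delta> (U k) \<le> ennreal h"
      using hausdorff1_pre_le_ediam dU by (meson order_trans)
  qed
  also have "\<dots> = ennreal (b - a)"
    using h by (subst sum_ennreal) auto
  finally show "hausdorff1_pre \<delta> {a..b} \<le> ennreal (b - a)" .
qed

theorem hausdorff1_eq_lborel: "hausdorff1 = (lborel :: real measure)"
proof (rule lborel_eqI[symmetric])
  fix l u :: real assume "\<And>b. b \<in> Basis \<Longrightarrow> l \<bullet> b \<le> u \<bullet> b"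
  then have lu: "l \<le> u" by simp
  have "hausdorff1_outer (box l u) \<le> hausdorff1_outer {l..u}"
    by (intro hausdorff1_outer_mono) auto
  also have "\<dots> \<le> ennreal (u - l)" using lu by (rule hausdorff1_outer_Icc_le)
  finally have "hausdorff1_outer (box l u) \<le> ennreal (u - l)" .
  moreover have "ennreal (u - l) \<le> hausdorff1_outer (box l u)"
    using lborel_le_hausdorff1_outer[of "box l u"] lu by simp
  ultimately show "emeasure hausdorff1 (box l u) = (\<Prod>b\<in>Basis. (u - l) \<bullet> b)"
    by (simp add: emeasure_hausdorff1)
qed simp

section \<open>The layer cake formula\<close>

lemma nn_integral_powr_Icc:
  assumes a: "-1 < a" and c: "0 \<le> c"
  shows "(\<integral>\<^sup>+t. ennreal (indicator {0..c} t * t powr a) \<partial>lborel) = ennreal (c powr (a + 1) / (a + 1))"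
proof (rule nn_integral_has_integral_lborel)
  have "((\<lambda>t. t powr a) has_integral c powr (a + 1) / (a + 1)) {0..c}"
    by (rule has_integral_powr_from_0[OF a c])
  then show "((\<lambda>t. indicator {0..c} t * t powr a) has_integral c powr (a + 1) / (a + 1)) UNIV"
    by (subst (asm) has_integral_restrict_UNIV[symmetric])
       (auto simp: indicator_def elim: has_integral_eq[rotated])
qed auto

text \<open>
  \<open>c powr p\<close> is the integral of \<open>p * t powr (p - 1)\<close> over \<open>0 < t < c\<close>; the formula then is Fubini's
  theorem. The indicator keeps the integrand nonnegative. The value \<open>p = 1\<close> serves for weak
  convergence.
\<close>

lemma layer_cake_powr:
  fixes f :: "'a \<Rightarrow> real"
  assumes M: "sigma_finite_measure M" and f[measurable]: "f \<in> borel_measurable M"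
    and f0: "\<And>x. 0 \<le> f x" and p: "0 < p"
  shows "(\<integral>\<^sup>+x. ennreal (f x powr p) \<partial>M) =
    (\<integral>\<^sup>+t. ennreal (indicator {0<..} t * (p * t powr (p - 1))) * emeasure M {x\<in>space M. t < f x} \<partial>lborel)"
proof -
  interpret sigma_finite_measure M by fact
  interpret P: pair_sigma_finite M lborel ..
  define k where "k t = indicator {0<..} t * (p * t powr (p - 1))" for t :: real
  have [measurable]: "k \<in> borel_measurable borel" unfolding k_def by measurable
  have k0: "0 \<le> k t" for t using p by (auto simp: k_def indicator_def)
  have pw: "ennreal (c powr p) = (\<integral>\<^sup>+t. ennreal (k t) * indicator {t. t < c} t \<partial>lborel)" if "0 \<le> c" for c
  proof -
    have "ennreal (c powr p) = ennreal p * ennreal (c powr (p - 1 + 1) / (p - 1 + 1))"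
      using p by (simp flip: ennreal_mult)
    also have "\<dots> = ennreal p * (\<integral>\<^sup>+t. ennreal (indicator {0..c} t * t powr (p - 1)) \<partial>lborel)"
      using p that by (subst nn_integral_powr_Icc) auto
    also have "\<dots> = (\<integral>\<^sup>+t. ennreal p * ennreal (indicator {0..c} t * t powr (p - 1)) \<partial>lborel)"
      by (rule nn_integral_cmult[symmetric]) auto
    also have "\<dots> = (\<integral>\<^sup>+t. ennreal (k t) * indicator {t. t < c} t \<partial>lborel)"
    proof (rule nn_integral_cong_AE)
      have "AE t in lborel. t \<noteq> 0 \<and> t \<noteq> c"
        by (intro AE_conjI AE_lborel_singleton)
      then show "AE t in lborel. ennreal p * ennreal (indicator {0..c} t * t powr (p - 1)) =
          ennreal (k t) * indicator {t. t < c} t"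
        by (rule eventually_mono) (use p in \<open>auto simp: k_def indicator_def ennreal_mult\<close>)
    qed
    finally show ?thesis .
  qed
  have "(\<integral>\<^sup>+x. ennreal (f x powr p) \<partial>M) = (\<integral>\<^sup>+x. (\<integral>\<^sup>+t. ennreal (k t) * indicator {t. t < f x} t \<partial>lborel) \<partial>M)"
    using pw[OF f0] by simp
  also have "\<dots> = (\<integral>\<^sup>+t. (\<integral>\<^sup>+x. ennreal (k t) * indicator {t. t < f x} t \<partial>M) \<partial>lborel)"
    by (rule P.Fubini'[symmetric]) measurable
  also have "\<dots> = (\<integral>\<^sup>+t. ennreal (k t) * emeasure M {x\<in>space M. t < f x} \<partial>lborel)"
  proof (rule nn_integral_cong)
    fix t
    have "(\<integral>\<^sup>+x. ennreal (k t) * indicator {t. t < f x} t \<partial>M)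
        = (\<integral>\<^sup>+x. ennreal (k t) * indicator {x\<in>space M. t < f x} x \<partial>M)"
      by (intro nn_integral_cong) (auto simp: indicator_def)
    also have "\<dots> = ennreal (k t) * emeasure M {x\<in>space M. t < f x}"
      by (subst nn_integral_cmult_indicator) auto
    finally show "(\<integral>\<^sup>+x. ennreal (k t) * indicator {t. t < f x} t \<partial>M)
        = ennreal (k t) * emeasure M {x\<in>space M. t < f x}" .
  qed
  finally show ?thesis by (simp add: k_def)
qed

section \<open>Lower bounds for the error on compact pieces\<close>

lemma finite_infdist_attained:
  assumes "finite S" "S \<noteq> {}"
  obtains s where "s \<in> S" "infdist x S = dist x s"
proof -
  have "infdist x S = Min (dist x ` S)"
    using assms by (simp add: infdist_notempty cInf_eq_Min)
  moreover have "Min (dist x ` S) \<in> dist x ` S" using assms by (intro Min_in) auto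
  ultimately show ?thesis using that by auto
qed

lemma borel_measurable_infdist [measurable]: "(\<lambda>x. infdist x S) \<in> borel_measurable borel"
  by (intro borel_measurable_continuous_onI continuous_on_infdist continuous_on_id)

abbreviation moment :: "real \<Rightarrow> 'a::metric_space measure \<Rightarrow> 'a set \<Rightarrow> ennreal" where
  "moment p \<mu> S \<equiv> \<integral>\<^sup>+x. ennreal (infdist x S powr p) \<partial>\<mu>"

abbreviation moment_on :: "real \<Rightarrow> 'a::metric_space measure \<Rightarrow> 'a set \<Rightarrow> 'a set \<Rightarrow> ennreal" where
  "moment_on p \<mu> K S \<equiv> \<integral>\<^sup>+x. ennreal (infdist x S powr p) * indicator K x \<partial>\<mu>"

text \<open>
  The points of \<open>E\<close> within distance \<open>t\<close> of \<open>S\<close> are covered by closed balls of diameter at most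
  \<open>2 t\<close>, so their premeasure at scale \<open>\<delta>\<close> is at most \<open>2 t\<close> times the number of balls that meet \<open>E\<close>.
  The scale \<open>\<delta>\<close> is fixed first, such that the premeasure of \<open>E\<close> exceeds \<open>h\<close>.
\<close>

lemma hausdorff1_far_set_ge:
  assumes h: "ennreal h < hausdorff1_outer E"
  shows "\<forall>\<^sub>F t in at_right 0. \<forall>S. finite S \<longrightarrow> S \<noteq> {} \<longrightarrow>
    ennreal h \<le> hausdorff1_outer (E \<inter> {x. t < infdist x S})
      + ennreal (2 * t * card {s\<in>S. \<exists>x\<in>E. dist x s \<le> t})"
proof -
  obtain \<delta> where \<delta>: "0 < \<delta>" "ennreal h < hausdorff1_pre \<delta> E"
    using h unfolding hausdorff1_outer_def less_SUP_iff by auto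
  have "\<forall>\<^sub>F t in at_right 0. 0 < t \<and> t < \<delta> / 2"
    using \<delta>(1) by (auto simp: eventually_at_right[of 0 1] intro!: exI[of _ "\<delta> / 2"])
  then show ?thesis
  proof (rule eventually_mono, intro allI impI)
    fix t :: real and S :: "'a set" assume t: "0 < t \<and> t < \<delta> / 2" and S: "finite S" "S \<noteq> {}"
    define S' where "S' = {s\<in>S. \<exists>x\<in>E. dist x s \<le> t}"
    have "x \<in> (\<Union>s\<in>S'. cball s t)" if x: "x \<in> E" "infdist x S \<le> t" for x
    proof -
      obtain s where "s \<in> S" "infdist x S = dist x s"
        using finite_infdist_attained[OF S] by metis
      then show ?thesis using x by (auto simp: S'_def dist_commute)
    qed
    then have "E \<subseteq> (E \<inter> {x. t < infdist x S}) \<union> (\<Union>s\<in>S'. cball s t)"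
      by fastforce
    then have "hausdorff1_pre \<delta> E \<le> hausdorff1_pre \<delta> ((E \<inter> {x. t < infdist x S}) \<union> (\<Union>s\<in>S'. cball s t))"
      by (rule hausdorff1_pre_mono)
    also have "\<dots> \<le> hausdorff1_pre \<delta> (E \<inter> {x. t < infdist x S}) + hausdorff1_pre \<delta> (\<Union>s\<in>S'. cball s t)"
      by (rule hausdorff1_pre_Un_le)
    also have "\<dots> \<le> hausdorff1_outer (E \<inter> {x. t < infdist x S}) + (\<Sum>s\<in>S'. ennreal (2 * t))"
    proof (intro add_mono)
      show "hausdorff1_pre \<delta> (E \<inter> {x. t < infdist x S}) \<le> hausdorff1_outer (E \<inter> {x. t < infdist x S})"
        unfolding hausdorff1_outer_def using \<delta> by (intro SUP_upper) auto
      have "hausdorff1_pre \<delta> (\<Union>s\<in>S'. cball s t) \<le> (\<Sum>s\<in>S'. hausdorff1_pre \<delta> (cball s t))"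
        using S by (intro hausdorff1_pre_UN_le) (auto simp: S'_def)
      also have "\<dots> \<le> (\<Sum>s\<in>S'. ennreal (2 * t))"
      proof (rule sum_mono)
        fix s
        have "ediam (cball s t) \<le> ennreal \<delta>"
          using t by (intro order_trans[OF ediam_cball_le] ennreal_leI) auto
        then show "hausdorff1_pre \<delta> (cball s t) \<le> ennreal (2 * t)"
          using hausdorff1_pre_le_ediam ediam_cball_le order_trans by blast
      qed
      finally show "hausdorff1_pre \<delta> (\<Union>s\<in>S'. cball s t) \<le> (\<Sum>s\<in>S'. ennreal (2 * t))" .
    qed
    also have "(\<Sum>s\<in>S'. ennreal (2 * t)) = ennreal (2 * t * card S')"
      using t by (subst sum_ennreal) (auto simp: mult.commute)
    finally show "ennreal h \<le> hausdorff1_outer (E \<inter> {x. t < infdist x S})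
      + ennreal (2 * t * card {s\<in>S. \<exists>x\<in>E. dist x s \<le> t})"
      using \<delta>(2) by (simp add: S'_def)
  qed
qed

lemma measurable_emeasure_superlevel:
  assumes "sigma_finite_measure M" and f[measurable]: "f \<in> borel_measurable M"
  shows "(\<lambda>t. emeasure M {x\<in>space M. t < f x}) \<in> borel_measurable (borel :: real measure)"
proof -
  interpret sigma_finite_measure M by fact
  have "{z\<in>space (borel \<Otimes>\<^sub>M M). fst z < f (snd z)} \<in> sets (borel \<Otimes>\<^sub>M M)" by measurable
  from measurable_emeasure_Pair[OF this] show ?thesis
    by (rule measurable_cong[THEN iffD1, rotated])
       (auto simp: space_pair_measure intro!: arg_cong[where f="emeasure M"])
qed

text \<open>
  The layer cake formula, cut off at the level \<open>u\<close>, combined with \<open>hausdorff1_far_set_ge\<close>. The term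
  subtracted from \<open>h * u powr p\<close> is kept on the right-hand side, since subtraction of extended
  nonnegative numbers is truncated.
\<close>

lemma moment_lower_bound:
  assumes E: "E \<in> sets borel" and fin: "hausdorff1_outer E < top"
    and h: "0 \<le> h" "ennreal h < hausdorff1_outer E" and p: "1 \<le> p"
  shows "\<forall>\<^sub>F u in at_right 0. \<forall>S. finite S \<longrightarrow> S \<noteq> {} \<longrightarrow>
    ennreal (h * u powr p) \<le> moment_on p hausdorff1 E S
      + ennreal (2 * card {s\<in>S. \<exists>x\<in>E. dist x s \<le> u} * (p / (p + 1) * u powr (p + 1)))"
proof -
  define M where "M = density (hausdorff1 :: 'a measure) (indicator E)"
  have sM: "sets M = sets borel" "space M = UNIV" by (auto simp: M_def)
  have EM: "emeasure M A = hausdorff1_outer (E \<inter> A)" if "A \<in> sets borel" for A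
    using that E by (simp add: M_def emeasure_density nn_integral_indicator emeasure_hausdorff1
        flip: indicator_inter_arith)
  interpret M: finite_measure M
    using EM[of UNIV] fin sM by (intro finite_measureI) auto
  obtain b where b: "0 < b" and far: "\<And>t S. 0 < t \<Longrightarrow> t < b \<Longrightarrow> finite S \<Longrightarrow> S \<noteq> {} \<Longrightarrow>
    ennreal h \<le> hausdorff1_outer (E \<inter> {x. t < infdist x S})
      + ennreal (2 * t * card {s\<in>S. \<exists>x\<in>E. dist x s \<le> t})"
    using hausdorff1_far_set_ge[OF h(2)] unfolding eventually_at_right_field by blast
  show ?thesis
    unfolding eventually_at_right_field
  proof (intro exI[of _ b] conjI b allI impI)
    fix u :: real and S :: "'a set" assume u: "0 < u" "u < b" and S: "finite S" "S \<noteq> {}"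
    define n where "n = card {s\<in>S. \<exists>x\<in>E. dist x s \<le> u}"
    define k where "k t = indicator {0..u} t * t powr (p - 1)" for t :: real
    define k' where "k' t = indicator {0..u} t * t powr p" for t :: real
    have km[measurable]: "k \<in> borel_measurable borel" "k' \<in> borel_measurable borel"
      unfolding k_def k'_def by measurable
    have k0: "0 \<le> k t" "0 \<le> k' t" for t by (auto simp: k_def k'_def)
    have fm[measurable]: "(\<lambda>x. infdist x S) \<in> borel_measurable M"
      using sM by (simp cong: measurable_cong_sets)
    have [measurable]: "(\<lambda>t. emeasure M {x\<in>space M. t < infdist x S}) \<in> borel_measurable borel"
      by (rule measurable_emeasure_superlevel) (use fm M.sigma_finite_measure_axioms in auto)
    have ik: "(\<integral>\<^sup>+t. ennreal (k t) \<partial>lborel) = ennreal (u powr p / p)"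
      using nn_integral_powr_Icc[of "p - 1" u] u p by (simp add: k_def)
    have ik': "(\<integral>\<^sup>+t. ennreal (k' t) \<partial>lborel) = ennreal (u powr (p + 1) / (p + 1))"
      using nn_integral_powr_Icc[of p u] u p by (simp add: k'_def)
    have pw: "ennreal (p * h) * ennreal (k t) \<le>
        ennreal (indicator {0<..} t * (p * t powr (p - 1))) * emeasure M {x\<in>space M. t < infdist x S}
        + ennreal (2 * p * n) * ennreal (k' t)" for t
    proof (cases "0 < t \<and> t \<le> u")
      case True
      have "{s\<in>S. \<exists>x\<in>E. dist x s \<le> t} \<subseteq> {s\<in>S. \<exists>x\<in>E. dist x s \<le> u}" using True by force
      then have nn: "card {s\<in>S. \<exists>x\<in>E. dist x s \<le> t} \<le> n"
        unfolding n_def using S by (intro card_mono) auto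
      have "ennreal h \<le> hausdorff1_outer (E \<inter> {x. t < infdist x S}) + ennreal (2 * t * n)"
        using True u nn by (intro order_trans[OF far[OF _ _ S, of t]] add_left_mono ennreal_leI
          mult_left_mono) auto
      also have "hausdorff1_outer (E \<inter> {x. t < infdist x S}) = emeasure M {x\<in>space M. t < infdist x S}"
        by (subst EM) (auto simp: sM(2))
      finally have "ennreal (p * t powr (p - 1)) * ennreal h \<le> ennreal (p * t powr (p - 1)) *
          (emeasure M {x\<in>space M. t < infdist x S} + ennreal (2 * t * n))"
        by (intro mult_left_mono) auto
      also have "\<dots> = ennreal (p * t powr (p - 1)) * emeasure M {x\<in>space M. t < infdist x S}
          + ennreal (p * t powr (p - 1) * (2 * t * n))"
        using True p by (simp add: distrib_left ennreal_mult)
      also have "p * t powr (p - 1) * (2 * t * n) = 2 * p * n * t powr p"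
        using True by (simp add: powr_diff)
      finally show ?thesis
        using True p h by (simp add: k_def k'_def ennreal_mult mult_ac)
    next
      case False
      then have "k t = 0" by (auto simp: k_def indicator_def)
      then show ?thesis by simp
    qed
    have "ennreal (h * u powr p) = ennreal (p * h) * (\<integral>\<^sup>+t. ennreal (k t) \<partial>lborel)"
      using p h by (simp add: ik flip: ennreal_mult)
    also have "\<dots> = (\<integral>\<^sup>+t. ennreal (p * h) * ennreal (k t) \<partial>lborel)"
      by (rule nn_integral_cmult[symmetric]) simp
    also have "\<dots> \<le> (\<integral>\<^sup>+t. ennreal (indicator {0<..} t * (p * t powr (p - 1))) * emeasure M {x\<in>space M. t
      < infdist x S}
        + ennreal (2 * p * n) * ennreal (k' t) \<partial>lborel)"
      by (intro nn_integral_mono pw)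
    also have "\<dots> = (\<integral>\<^sup>+t. ennreal (indicator {0<..} t * (p * t powr (p - 1))) * emeasure M {x\<in>space M. t
      < infdist x S} \<partial>lborel)
        + (\<integral>\<^sup>+t. ennreal (2 * p * n) * ennreal (k' t) \<partial>lborel)"
      by (rule nn_integral_add) measurable
    also have "(\<integral>\<^sup>+t. ennreal (2 * p * n) * ennreal (k' t) \<partial>lborel)
      = ennreal (2 * p * n) * (\<integral>\<^sup>+t. ennreal (k' t) \<partial>lborel)"
      by (rule nn_integral_cmult) simp
    also have "\<dots> = ennreal (2 * n * (p / (p + 1) * u powr (p + 1)))"
      using p by (simp add: ik' mult_ac flip: ennreal_mult)
    also have "(\<integral>\<^sup>+t. ennreal (indicator {0<..} t * (p * t powr (p - 1))) * emeasure M {x\<in>space M. t <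
      infdist x S} \<partial>lborel)
        = (\<integral>\<^sup>+x. ennreal (infdist x S powr p) \<partial>M)"
      using p by (intro layer_cake_powr[symmetric] M.sigma_finite_measure_axioms fm)
        (auto simp: infdist_nonneg)
    also have "\<dots> = moment_on p hausdorff1 E S"
      using E by (subst M_def, subst nn_integral_density) (auto simp: mult.commute)
    finally show "ennreal (h * u powr p) \<le> moment_on p hausdorff1 E S
      + ennreal (2 * card {s\<in>S. \<exists>x\<in>E. dist x s \<le> u} * (p / (p + 1) * u powr (p + 1)))"
      by (simp add: n_def)
  qed
qed

text \<open>
  The previous bound at \<open>u = \<tau> / (2 * y * N)\<close>, multiplied by \<open>y powr (p + 1) * (2 * N) powr p\<close>. With
  this choice the coefficient of the fraction of points does not depend on \<open>y\<close>, which allows the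
  bounds for several sets with different \<open>y\<close> to be added.
\<close>

lemma scaled_moment_lower_bound:
  fixes E :: "'a::metric_space set" and y :: real
  assumes E: "E \<in> sets borel" and fin: "hausdorff1_outer E < top"
    and h: "0 \<le> h" "ennreal h < hausdorff1_outer E" and p: "1 \<le> p"
    and y: "0 < y" and \<tau>: "0 < \<tau>"
  shows "\<forall>\<^sub>F N in sequentially. \<forall>S. finite S \<longrightarrow> S \<noteq> {} \<longrightarrow>
    ennreal (y * h * \<tau> powr p) \<le> ennreal ((2 * real N) powr p) *
        (ennreal (y powr (p + 1)) * moment_on p hausdorff1 E S)
      + ennreal (p / (p + 1) * \<tau> powr (p + 1) *
          (card {s\<in>S. \<exists>x\<in>E. dist x s \<le> \<tau> / (2 * y * N)} / N))"
proof -
  have "filterlim (\<lambda>N. \<tau> / (2 * y * real N)) (at_right 0) sequentially"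
    using y \<tau> by real_asymp
  from eventually_compose_filterlim[OF moment_lower_bound[OF E fin h p] this] eventually_gt_at_top[of 0]
  show ?thesis
  proof (eventually_elim, intro allI impI)
    fix N :: nat and S :: "'a set"
    assume *: "\<forall>S. finite S \<longrightarrow> S \<noteq> {} \<longrightarrow>
        ennreal (h * (\<tau> / (2 * y * real N)) powr p) \<le> moment_on p hausdorff1 E S
      + ennreal (2 * card {s\<in>S. \<exists>x\<in>E. dist x s \<le> \<tau> / (2 * y * real N)} * (p / (p
        + 1) * (\<tau> / (2 * y * real N)) powr (p + 1)))"
      and N: "0 < N" and S: "finite S" "S \<noteq> {}"
    define n where "n = card {s\<in>S. \<exists>x\<in>E. dist x s \<le> \<tau> / (2 * y * real N)}"
    define J where "J = moment_on p hausdorff1 E S"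
    define c where "c = (2 * real N) powr p * y powr (p + 1)"
    have c0: "0 \<le> c" by (simp add: c_def)
    have c1: "c * (\<tau> / (2 * y * real N)) powr p = y * \<tau> powr p"
      using y \<tau> N p by (simp add: c_def powr_divide powr_mult powr_add)
    have c2: "c * (\<tau> / (2 * y * real N)) powr (p + 1) = \<tau> powr (p + 1) / (2 * N)"
      using y \<tau> N p by (simp add: c_def powr_divide powr_mult powr_add)
    have "ennreal c * ennreal (h * (\<tau> / (2 * y * real N)) powr p) \<le>
        ennreal c * (J + ennreal (2 * n * (p / (p + 1) * (\<tau> / (2 * y * real N)) powr (p + 1))))"
      using *[rule_format, OF S] unfolding n_def J_def by (intro mult_left_mono) auto
    also have "\<dots> = ennreal ((2 * real N) powr p) * (ennreal (y powr (p + 1)) * J)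
        + ennreal (c * (2 * n * (p / (p + 1) * (\<tau> / (2 * y * real N)) powr (p + 1))))"
    proof -
      have "ennreal c * J = ennreal ((2 * real N) powr p) * (ennreal (y powr (p + 1)) * J)"
        by (simp add: c_def ennreal_mult mult.assoc)
      then show ?thesis using p c0 by (simp add: distrib_left flip: ennreal_mult)
    qed
    also have "c * (2 * n * (p / (p + 1) * (\<tau> / (2 * y * real N)) powr (p + 1)))
        = 2 * n * (p / (p + 1)) * (c * (\<tau> / (2 * y * real N)) powr (p + 1))"
      by simp
    also have "\<dots> = p / (p + 1) * \<tau> powr (p + 1) * (n / N)"
      unfolding c2 by simp
    also have "ennreal c * ennreal (h * (\<tau> / (2 * y * real N)) powr p) = ennreal (y * h * \<tau> powr p)"
    proof -
      have "c * (h * (\<tau> / (2 * y * real N)) powr p) = h * (c * (\<tau> / (2 * y * real N)) powr p)" by simp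
      also have "\<dots> = y * h * \<tau> powr p" unfolding c1 by simp
      finally have e: "c * (h * (\<tau> / (2 * y * real N)) powr p) = y * h * \<tau> powr p" .
      show ?thesis unfolding e[symmetric] using h c0 by (intro ennreal_mult[symmetric]) auto
    qed
    finally show "ennreal (y * h * \<tau> powr p) \<le> ennreal ((2 * real N) powr p) *
        (ennreal (y powr (p + 1)) * moment_on p hausdorff1 E S)
      + ennreal (p / (p + 1) * \<tau> powr (p + 1) *
          (card {s\<in>S. \<exists>x\<in>E. dist x s \<le> \<tau> / (2 * y * N)} / N))"
      by (simp add: n_def J_def)
  qed
qed


text \<open>
  A simple function below \<open>f\<close> approximates the integral, and each of its level sets is approximated
  from inside by a compact set. The \<open>h y\<close> lie strictly below the measures of the compact sets, as
  the lower bounds for the single sets require.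
\<close>

lemma compact_pieces_approx_integral:
  fixes M :: "'a::polish_space measure" and f :: "'a \<Rightarrow> real"
  assumes M: "sets M = sets borel" and f[measurable]: "f \<in> borel_measurable M" and f0: "\<And>x. 0 \<le> f x"
    and fin: "\<And>y. 0 < y \<Longrightarrow> emeasure M {x. y \<le> f x} < top"
    and D: "D \<in> sets borel" and c: "0 \<le> c" "ennreal c < (\<integral>\<^sup>+x. ennreal (f x) * indicator D x \<partial>M)"
  obtains Y :: "real set" and E h where "finite Y" "\<And>y. y \<in> Y \<Longrightarrow> 0 < y"
    "\<And>y. y \<in> Y \<Longrightarrow> compact (E y)" "\<And>y. y \<in> Y \<Longrightarrow> E y \<subseteq> D"
    "\<And>y x. y \<in> Y \<Longrightarrow> x \<in> E y \<Longrightarrow> y \<le> f x" "disjoint_family_on E Y"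
    "\<And>y. y \<in> Y \<Longrightarrow> 0 \<le> h y" "\<And>y. y \<in> Y \<Longrightarrow> ennreal (h y) < emeasure M (E y)"
    "c \<le> (\<Sum>y\<in>Y. y * h y)"
proof -
  have sp: "space M = UNIV" using sets_eq_imp_space_eq[OF M] by simp
  have [measurable]: "D \<in> sets M" using D M by simp
  obtain s where s: "simple_function M s" "s \<le> (\<lambda>x. ennreal (f x) * indicator D x)"
      "ennreal c < integral\<^sup>S M s"
    using c(2) unfolding nn_integral_def less_SUP_iff by auto
  have s_le: "s x \<le> ennreal (f x) * indicator D x" for x using s(2) by (simp add: le_fun_def)
  have s_fin: "s x < top" for x
  proof -
    have "s x \<le> ennreal (f x) * 1" by (rule order_trans[OF s_le mult_left_mono]) (auto simp: indicator_def)
    then show ?thesis by (simp add: order_le_less_trans)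
  qed
  define P where "P y = {x. s x = ennreal y}" for y
  define Y where "Y = enn2real ` range s \<inter> {y. 0 < y \<and> 0 < emeasure M (P y)}"
  have finr: "finite (range s)" using simple_functionD(1)[OF s(1)] sp by simp
  then have finY: "finite Y" unfolding Y_def by blast
  have Yp: "0 < y" "0 < emeasure M (P y)" if "y \<in> Y" for y using that by (auto simp: Y_def)
  have P_sets[measurable]: "P y \<in> sets M" for y
    using simple_functionD(2)[OF s(1), of "{ennreal y}"] sp by (simp add: P_def vimage_def)
  have PD: "x \<in> D \<and> y \<le> f x" if "x \<in> P y" "0 < y" for x y
  proof -
    have *: "ennreal y \<le> ennreal (f x) * indicator D x" using s_le[of x] that(1) by (simp add: P_def)
    have "x \<in> D"
    proof (rule ccontr)
      assume "x \<notin> D" then show False using * that(2) by simp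
    qed
    then show ?thesis using * that f0[of x] by simp
  qed
  have Pfin: "emeasure M (P y) < top" if "0 < y" for y
  proof (rule order_le_less_trans[OF emeasure_mono fin[OF that]])
    have "{x\<in>space M. y \<le> f x} \<in> sets M" by measurable
    then show "{x. y \<le> f x} \<in> sets M" by (simp add: sp)
  qed (use PD that in auto)
  define a where "a y = measure M (P y)" for y
  have a: "emeasure M (P y) = ennreal (a y)" if "0 < y" for y
    using Pfin[OF that] by (simp add: a_def emeasure_eq_ennreal_measure)
  have "integral\<^sup>S M s = (\<Sum>z\<in>range s. z * emeasure M (s -` {z}))"
    using sp by (simp add: simple_integral_def)
  also have "\<dots> = (\<Sum>z\<in>range s. ennreal (enn2real z) * emeasure M (P (enn2real z)))"
    using s_fin by (intro sum.cong) (auto simp: P_def vimage_def)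
  also have "\<dots> = (\<Sum>y\<in>enn2real ` range s. ennreal y * emeasure M (P y))"
  proof (rule sum.reindex[unfolded comp_def, symmetric])
    show "inj_on enn2real (range s)"
      using s_fin by (metis (mono_tags, lifting) ennreal_enn2real imageE inj_onI)
  qed
  also have "\<dots> = (\<Sum>y\<in>Y. ennreal y * emeasure M (P y))"
    using finr by (intro sum.mono_neutral_right) (auto simp: Y_def less_le enn2real_nonneg)
  also have "\<dots> = (\<Sum>y\<in>Y. ennreal (y * a y))"
    using Yp a by (intro sum.cong) (auto simp: ennreal_mult a_def less_imp_le)
  also have "\<dots> = ennreal (\<Sum>y\<in>Y. y * a y)"
    using Yp by (intro sum_ennreal) (auto simp: a_def less_imp_le)
  finally have "c < (\<Sum>y\<in>Y. y * a y)"
    using s(3) c(1) by (simp add: ennreal_less_iff)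
  \<comment> \<open>Lowering the mass of each level set by \<open>e\<close> still leaves at least \<open>c\<close>.\<close>
  define e where "e = ((\<Sum>y\<in>Y. y * a y) - c) / (1 + \<Sum>Y)"
  have sY: "0 \<le> \<Sum>Y" using Yp by (intro sum_nonneg) (auto simp: less_imp_le)
  have e: "0 < e" using \<open>c < _\<close> sY by (simp add: e_def)
  define h where "h y = max 0 (a y - e)" for y
  have "\<exists>K. compact K \<and> K \<subseteq> P y \<and> ennreal (h y) < emeasure M K" if "y \<in> Y" for y
  proof -
    have ay: "0 < a y" using Yp[OF that] a[of y] by simp
    define My where "My = density M (indicator (P y))"
    have My: "emeasure My B = emeasure M (P y \<inter> B)" if "B \<in> sets M" for B
      using that by (simp add: My_def emeasure_density nn_integral_indicator flip: indicator_inter_arith)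
    have sMy: "sets My = sets borel" by (simp add: My_def M)
    have "emeasure My (P y) = (SUP K\<in>{K. K \<subseteq> P y \<and> compact K}. emeasure My K)"
    proof (rule inner_regular[OF sMy])
      show "emeasure My (space My) \<noteq> \<infinity>"
        using My[of UNIV] Pfin[of y] Yp[OF that] M sp by (simp add: My_def)
    qed (use P_sets M in auto)
    moreover have "ennreal (h y) < emeasure My (P y)"
      using ay e a[of y] Yp[OF that] by (simp add: My h_def ennreal_less_iff)
    ultimately obtain K where K: "K \<subseteq> P y" "compact K" "ennreal (h y) < emeasure My K"
      by (auto simp: less_SUP_iff)
    have "emeasure My K = emeasure M K"
      using K M by (subst My) (auto simp: compact_imp_closed Int_absorb1)
    then show ?thesis using K by auto
  qed
  then obtain E where E: "\<And>y. y \<in> Y \<Longrightarrow> compact (E y)" "\<And>y. y \<in> Y \<Longrightarrow> E y \<subseteq> P y"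
      "\<And>y. y \<in> Y \<Longrightarrow> ennreal (h y) < emeasure M (E y)"
    by metis
  show ?thesis
  proof (rule that[of Y E h])
    show "disjoint_family_on E Y"
      unfolding disjoint_family_on_def
    proof (intro ballI impI)
      fix y z assume "y \<in> Y" "z \<in> Y" "y \<noteq> z"
      then have "P y \<inter> P z = {}" using Yp by (auto simp: P_def less_imp_le)
      then show "E y \<inter> E z = {}" using E(2) \<open>y \<in> Y\<close> \<open>z \<in> Y\<close> by fast
    qed
    have "c = (\<Sum>y\<in>Y. y * a y) - e * (1 + \<Sum>Y)"
      using sY by (simp add: e_def)
    also have "\<dots> \<le> (\<Sum>y\<in>Y. y * a y) - e * \<Sum>Y" using e by simp
    also have "\<dots> = (\<Sum>y\<in>Y. y * (a y - e))"
      by (simp add: sum_subtractf algebra_simps sum_distrib_left)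
    also have "\<dots> \<le> (\<Sum>y\<in>Y. y * h y)"
      using Yp by (intro sum_mono mult_left_mono) (auto simp: h_def less_imp_le)
    finally show "c \<le> (\<Sum>y\<in>Y. y * h y)" .
  qed (use finY Yp E PD in \<open>auto simp: h_def\<close>, (meson PD subsetD)+)
qed

lemma eventually_compact_closed_far:
  fixes A B :: "'a::metric_space set"
  assumes "compact A" "closed B" "A \<inter> B = {}"
  shows "\<forall>\<^sub>F d in at_right 0. \<forall>x\<in>A. \<forall>y\<in>B. 2 * d < dist x y"
proof -
  obtain d where d: "0 < d" "\<And>x y. x \<in> A \<Longrightarrow> y \<in> B \<Longrightarrow> d \<le> dist x y"
  proof (cases "A = {} \<or> B = {}")
    case True
    then show ?thesis using that[of 1] by auto
  next
    case False
    have "continuous_on A (\<lambda>x. infdist x B)" by (intro continuous_intros)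
    then obtain a where a: "a \<in> A" "\<And>x. x \<in> A \<Longrightarrow> infdist a B \<le> infdist x B"
      using continuous_attains_inf[OF assms(1)] False by blast
    have "infdist a B \<noteq> 0"
      using in_closed_iff_infdist_zero[OF assms(2)] a(1) assms(3) False by blast
    then have "0 < infdist a B" using infdist_nonneg[of a B] by linarith
    then show ?thesis using that a(2) infdist_le order_trans by blast
  qed
  show ?thesis
    unfolding eventually_at_right_field
    using d by (intro exI[of _ "d / 2"]) (force intro: order_less_le_trans)
qed

text \<open>
  The lower bound for the error on \<open>K\<close>, with the counted points on the right-hand side: those of \<open>S\<close>
  within distance \<open>r\<close> of \<open>K\<close>. The right-hand side is linear in their number, and \<open>\<tau>\<close> is free.
\<close>

abbreviation lower_estimate :: "real \<Rightarrow> 'a::metric_space measure \<Rightarrow> 'a set \<Rightarrow> real \<Rightarrow> real \<Rightarrow> real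
  \<Rightarrow> nat \<Rightarrow> bool" where
  "lower_estimate p \<mu> K c \<tau> r N \<equiv> \<forall>S. finite S \<longrightarrow> S \<noteq> {} \<longrightarrow>
    ennreal (c * \<tau> powr p) \<le> ennreal ((2 * real N) powr p) * moment_on p \<mu> K S
      + ennreal (p / (p + 1) * \<tau> powr (p + 1) * (card {s\<in>S. \<exists>x\<in>K. dist x s < r} / N))"

text \<open>
  The bounds of \<open>scaled_moment_lower_bound\<close> are summed over the compact pieces \<open>E y\<close> from
  \<open>compact_pieces_approx_integral\<close>. These have positive mutual distance, so for large \<open>N\<close> no point
  of \<open>S\<close> is counted for two of them. The set \<open>K\<close>, their union, is chosen before \<open>\<tau>\<close> and \<open>r\<close>, so that
  a later choice of \<open>r\<close> can separate the counts belonging to two sets \<open>D\<close>. For \<open>c \<le> 0\<close> the claim is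
  trivial; the case is admitted because the integral over \<open>D\<close> may vanish.
\<close>

lemma local_lower_bound:
  fixes \<mu> :: "'a::polish_space measure" and \<rho> :: "'a \<Rightarrow> real"
  assumes p: "1 \<le> p" and \<mu>: "sets \<mu> = sets borel" "finite_measure \<mu>"
    and \<rho>[measurable]: "\<rho> \<in> borel_measurable borel" and \<rho>0: "\<And>x. 0 \<le> \<rho> x"
    and le: "density hausdorff1 (\<lambda>x. ennreal (\<rho> x)) \<le> \<mu>"
    and D: "D \<in> sets borel"
    and c: "c \<le> 0 \<or> ennreal c < (\<integral>\<^sup>+x. ennreal (\<rho> x powr (1 / (1 + p))) * indicator D x \<partial>hausdorff1)"
  obtains K where "compact K" "K \<subseteq> D"
    "\<And>\<tau> r. 0 \<le> \<tau> \<Longrightarrow> 0 < r \<Longrightarrow> \<forall>\<^sub>F N in sequentially. lower_estimate p \<mu> K c \<tau> r N"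
proof (cases "c \<le> 0")
  case True
  have "ennreal (c * \<tau> powr p) = 0" for \<tau> using True by (simp add: ennreal_neg mult_nonpos_nonneg)
  then show ?thesis using that[of "{}"] by simp
next
  case False
  define g where "g x = \<rho> x powr (1 / (1 + p))" for x
  have g[measurable]: "g \<in> borel_measurable borel" unfolding g_def by measurable
  have g0: "0 \<le> g x" for x by (simp add: g_def)
  have g\<rho>: "g x powr (p + 1) = \<rho> x" for x
    using p \<rho>0[of x] by (simp add: g_def powr_powr add.commute)
  interpret finite_measure \<mu> by fact
  have level: "y powr (p + 1) \<le> \<rho> x" if "0 < y" "y \<le> g x" for x y
    using powr_mono2[of "p + 1" y "g x"] that p by (simp add: g\<rho>)
  have fin: "emeasure hausdorff1 {x. y \<le> g x} < top" if y: "0 < y" for y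
  proof -
    have m: "{x. y \<le> g x} \<in> sets borel" by measurable
    have "ennreal (y powr (p + 1)) * emeasure hausdorff1 {x. y \<le> g x}
        = (\<integral>\<^sup>+x. ennreal (y powr (p + 1)) * indicator {x. y \<le> g x} x \<partial>hausdorff1)"
      using m by (intro nn_integral_cmult_indicator[symmetric]) auto
    also have "\<dots> \<le> (\<integral>\<^sup>+x. ennreal (\<rho> x) \<partial>hausdorff1)"
      using level[OF y] by (intro nn_integral_mono) (auto simp: indicator_def intro!: ennreal_leI)
    also have "\<dots> = emeasure (density hausdorff1 (\<lambda>x. ennreal (\<rho> x))) UNIV"
      by (subst emeasure_density) auto
    also have "\<dots> \<le> emeasure \<mu> UNIV"
      using le \<mu> by (subst (asm) le_measure) auto
    also have "\<dots> < top" using emeasure_finite[of UNIV] less_top by blast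
    finally show ?thesis using y by (auto simp: ennreal_mult_less_top)
  qed
  have fin': "emeasure hausdorff1 {x. y \<le> g x} < top" if "0 < y" for y
    by (rule fin[OF that])
  have c': "0 \<le> c" "ennreal c < (\<integral>\<^sup>+x. ennreal (g x) * indicator D x \<partial>hausdorff1)"
    using c False by (auto simp: g_def)
  obtain Y E h where Y: "finite Y" "\<And>y. y \<in> Y \<Longrightarrow> 0 < y"
    and E: "\<And>y. y \<in> Y \<Longrightarrow> compact (E y)" "\<And>y. y \<in> Y \<Longrightarrow> E y \<subseteq> D"
      "\<And>y x. y \<in> Y \<Longrightarrow> x \<in> E y \<Longrightarrow> y \<le> g x" "disjoint_family_on E Y"
    and h: "\<And>y. y \<in> Y \<Longrightarrow> 0 \<le> h y" "\<And>y. y \<in> Y \<Longrightarrow> ennreal (h y) < emeasure hausdorff1 (E y)"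
      "c \<le> (\<Sum>y\<in>Y. y * h y)"
    using compact_pieces_approx_integral[OF sets_hausdorff1 _ g0 fin' D c'] by (auto simp: g)
  have Eb[measurable]: "E y \<in> sets borel" if "y \<in> Y" for y
    using E(1)[OF that] by (simp add: compact_imp_closed)
  have Efin: "hausdorff1_outer (E y) < top" if "y \<in> Y" for y
  proof -
    have "emeasure hausdorff1 (E y) \<le> emeasure hausdorff1 {x. y \<le> g x}"
      using E(3)[OF that] by (intro emeasure_mono) auto
    also have "\<dots> < top" by (rule fin[OF Y(2)[OF that]])
    finally show ?thesis by (simp add: emeasure_hausdorff1 Eb that)
  qed
  define K where "K = (\<Union>y\<in>Y. E y)"
  have Kc: "compact K" unfolding K_def using Y E by (intro compact_UN) auto
  have [measurable]: "K \<in> sets borel" using Kc by (simp add: compact_imp_closed)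
  have mass: "(\<Sum>y\<in>Y. ennreal (y powr (p + 1)) * (\<integral>\<^sup>+x. ennreal (f x) * indicator (E y) x \<partial>hausdorff1))
      \<le> (\<integral>\<^sup>+x. ennreal (f x) * indicator K x \<partial>\<mu>)" if [measurable]: "f \<in> borel_measurable borel" for f
  proof -
    have "(\<Sum>y\<in>Y. ennreal (y powr (p + 1)) * (\<integral>\<^sup>+x. ennreal (f x) * indicator (E y) x \<partial>hausdorff1))
      = (\<Sum>y\<in>Y. (\<integral>\<^sup>+x. ennreal (y powr (p + 1)) * (ennreal (f x) * indicator (E y) x) \<partial>hausdorff1))"
      using Eb by (intro sum.cong nn_integral_cmult[symmetric] refl) auto
    also have "\<dots> = (\<integral>\<^sup>+x. (\<Sum>y\<in>Y. ennreal (y powr (p + 1)) * (ennreal (f x) * indicator (E y) x)) \<partial>hausdorff1)"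
      using Eb by (intro nn_integral_sum[symmetric]) auto
    also have "\<dots> \<le> (\<integral>\<^sup>+x. ennreal (\<rho> x) * (ennreal (f x) * indicator K x) \<partial>hausdorff1)"
    proof (rule nn_integral_mono)
      fix x
      show "(\<Sum>y\<in>Y. ennreal (y powr (p + 1)) * (ennreal (f x) * indicator (E y) x))
          \<le> ennreal (\<rho> x) * (ennreal (f x) * indicator K x)"
      proof (cases "x \<in> K")
        case True
        then obtain y where y: "y \<in> Y" "x \<in> E y" by (auto simp: K_def)
        have "(\<Sum>z\<in>Y. ennreal (z powr (p + 1)) * (ennreal (f x) * indicator (E z) x))
            = (\<Sum>z\<in>{y}. ennreal (z powr (p + 1)) * (ennreal (f x) * indicator (E z) x))"
        proof (rule sum.mono_neutral_right)
          show "\<forall>i\<in>Y - {y}. ennreal (i powr (p + 1)) * (ennreal (f x) * indicator (E i) x) = 0"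
            using y E(4) by (auto simp: disjoint_family_on_def indicator_def)
        qed (use y Y in auto)
        also have "\<dots> \<le> ennreal (\<rho> x) * (ennreal (f x) * indicator K x)"
          using y level[OF Y(2) E(3), OF y(1) y] True by (auto intro!: mult_right_mono ennreal_leI)
        finally show ?thesis .
      next
        case False
        then show ?thesis by (auto simp: K_def indicator_def)
      qed
    qed
    also have "\<dots> = (\<integral>\<^sup>+x. ennreal (f x) * indicator K x \<partial>density hausdorff1 (\<lambda>x. ennreal (\<rho> x)))"
      by (intro nn_integral_density[symmetric]) auto
    also have "\<dots> \<le> (\<integral>\<^sup>+x. ennreal (f x) * indicator K x \<partial>\<mu>)"
      using \<mu> le by (intro nn_integral_mono_measure) auto
    finally show ?thesis .
  qed
  show ?thesis
  proof (rule that[of K])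
    show "K \<subseteq> D" using E(2) by (auto simp: K_def)
    fix \<tau> r :: real assume \<tau>: "0 \<le> \<tau>" and r: "0 < r"
    show "\<forall>\<^sub>F N in sequentially. lower_estimate p \<mu> K c \<tau> r N"
    proof (cases "\<tau> = 0")
      case True then show ?thesis by simp
    next
      case False
      then have \<tau>: "0 < \<tau>" using \<tau> by simp
      have "\<forall>\<^sub>F d in at_right 0. \<forall>y\<in>Y. \<forall>z\<in>Y. y \<noteq> z \<longrightarrow> (\<forall>x\<in>E y. \<forall>x'\<in>E z. 2 * d < dist x x')"
      proof (intro eventually_ball_finite Y ballI)
        fix y z assume "y \<in> Y" "z \<in> Y"
        then show "\<forall>\<^sub>F d in at_right 0. y \<noteq> z \<longrightarrow> (\<forall>x\<in>E y. \<forall>x'\<in>E z. 2 * d < dist x x')"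
          using eventually_compact_closed_far[OF E(1) compact_imp_closed[OF E(1)], of y z] E(4)
          by (cases "y = z") (auto simp: disjoint_family_on_def)
      qed
      then obtain d where d: "0 < d"
        "\<And>y z x x'. y \<in> Y \<Longrightarrow> z \<in> Y \<Longrightarrow> y \<noteq> z \<Longrightarrow> x \<in> E y \<Longrightarrow> x' \<in> E z \<Longrightarrow> 2 * d < dist x x'"
        unfolding eventually_at_right_field using dense by metis
      have small: "\<forall>\<^sub>F N in sequentially. \<forall>y\<in>Y. \<tau> / (2 * y * real N) < min d r"
      proof (intro eventually_ball_finite Y ballI)
        fix y assume "y \<in> Y"
        then have "(\<lambda>N. \<tau> / (2 * y * real N)) \<longlonglongrightarrow> 0" using Y(2)[of y] by real_asymp
        then show "\<forall>\<^sub>F N in sequentially. \<tau> / (2 * y * real N) < min d r"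
          using d r by (intro order_tendstoD(2)[of _ 0]) auto
      qed
      have "\<forall>\<^sub>F N in sequentially. \<forall>y\<in>Y. \<forall>S. finite S \<longrightarrow> S \<noteq> {} \<longrightarrow>
        ennreal (y * h y * \<tau> powr p) \<le> ennreal ((2 * real N) powr p) *
            (ennreal (y powr (p + 1)) * moment_on p hausdorff1 (E y) S)
          + ennreal (p / (p + 1) * \<tau> powr (p + 1) *
              (card {s\<in>S. \<exists>x\<in>E y. dist x s \<le> \<tau> / (2 * y * N)} / N))"
        using h Eb Efin p \<tau> Y
        by (intro eventually_ball_finite scaled_moment_lower_bound ballI) (auto
          simp flip: emeasure_hausdorff1)
      with small eventually_gt_at_top[of 0] show ?thesis
      proof (eventually_elim, intro allI impI)
        fix N :: nat and S :: "'a set"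
        assume small: "\<forall>y\<in>Y. \<tau> / (2 * y * real N) < min d r" and N: "0 < N"
          and bd: "\<forall>y\<in>Y. \<forall>S. finite S \<longrightarrow> S \<noteq> {} \<longrightarrow>
            ennreal (y * h y * \<tau> powr p) \<le> ennreal ((2 * real N) powr p) *
                (ennreal (y powr (p + 1)) * moment_on p hausdorff1 (E y) S)
              + ennreal (p / (p + 1) * \<tau> powr (p + 1) *
                  (card {s\<in>S. \<exists>x\<in>E y. dist x s \<le> \<tau> / (2 * y * N)} / N))"
          and S: "finite S" "S \<noteq> {}"
        define B where "B y = {s\<in>S. \<exists>x\<in>E y. dist x s \<le> \<tau> / (2 * y * N)}" for y
        have Bdisj: "B y \<inter> B z = {}" if "y \<in> Y" "z \<in> Y" "y \<noteq> z" for y z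
        proof (rule ccontr)
          assume "\<not> ?thesis"
          then obtain s x x' where x: "x \<in> E y" "x' \<in> E z" and "dist x s \<le> \<tau> / (2 * y * N)" "dist x' s
            \<le> \<tau> / (2 * z * N)"
            by (auto simp: B_def)
          then show False
            using d(2)[OF that x] small[rule_format, OF that(1)] small[rule_format, OF that(2)]
              dist_triangle2[of x x' s] by fastforce
        qed
        have "(\<Sum>y\<in>Y. card (B y)) = card (\<Union>y\<in>Y. B y)"
          using Y S Bdisj by (intro card_UN_disjoint[symmetric]) (auto simp: B_def)
        also have "\<dots> \<le> card {s\<in>S. \<exists>x\<in>K. dist x s < r}"
          using S small by (intro card_mono) (force simp: B_def K_def)+
        finally have cardB: "(\<Sum>y\<in>Y. card (B y)) \<le> card {s\<in>S. \<exists>x\<in>K. dist x s < r}" .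
        have "ennreal (c * \<tau> powr p) \<le> ennreal (\<Sum>y\<in>Y. y * h y * \<tau> powr p)"
          using h(3) by (auto intro!: ennreal_leI mult_right_mono simp flip: sum_distrib_right)
        also have "\<dots> = (\<Sum>y\<in>Y. ennreal (y * h y * \<tau> powr p))"
          using Y(2) h(1) by (intro sum_ennreal[symmetric]) (auto simp: less_imp_le)
        also have "\<dots> \<le> (\<Sum>y\<in>Y. ennreal ((2 * real N) powr p) *
                (ennreal (y powr (p + 1)) * moment_on p hausdorff1 (E y) S)
              + ennreal (p / (p + 1) * \<tau> powr (p + 1) * (card (B y) / N)))"
          using bd S by (intro sum_mono) (auto simp: B_def)
        also have "\<dots> = ennreal ((2 * real N) powr p) * (\<Sum>y\<in>Y.
                ennreal (y powr (p + 1)) * moment_on p hausdorff1 (E y) S)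
              + (\<Sum>y\<in>Y. ennreal (p / (p + 1) * \<tau> powr (p + 1) * (card (B y) / N)))"
          by (simp add: sum.distrib sum_distrib_left)
        also have "(\<Sum>y\<in>Y. ennreal (p / (p + 1) * \<tau> powr (p + 1) * (card (B y) / N)))
            = ennreal (p / (p + 1) * \<tau> powr (p + 1) * (real (\<Sum>y\<in>Y. card (B y)) / N))"
          using p by (subst sum_ennreal) (auto simp: sum_distrib_left sum_divide_distrib)
        also have "ennreal ((2 * real N) powr p) * (\<Sum>y\<in>Y.
                ennreal (y powr (p + 1)) * moment_on p hausdorff1 (E y) S)
              + ennreal (p / (p + 1) * \<tau> powr (p + 1) * (real (\<Sum>y\<in>Y. card (B y)) / N))
            \<le> ennreal ((2 * real N) powr p) * moment_on p \<mu> K S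
              + ennreal (p / (p + 1) * \<tau> powr (p + 1) * (card {s\<in>S. \<exists>x\<in>K. dist x s < r} / N))"
          using cardB p N
          by (intro add_mono mult_left_mono mass ennreal_leI divide_right_mono of_nat_mono) auto
        finally show "ennreal (c * \<tau> powr p) \<le> ennreal ((2 * real N) powr p) * moment_on p \<mu> K S
          + ennreal (p / (p + 1) * \<tau> powr (p + 1) * (card {s\<in>S. \<exists>x\<in>K. dist x s < r} / N))" .
      qed
    qed
  qed fact
qed

section \<open>Rescaled errors and the lower quantization coefficient\<close>

lemma epowr_le_iff:
  assumes "0 < p" "0 \<le> c"
  shows "epowr x (1 / p) \<le> ennreal c \<longleftrightarrow> x \<le> ennreal (c powr p)"
proof (cases x rule: ennreal_cases)
  case (real r)
  have "r powr (1 / p) \<le> c \<longleftrightarrow> r \<le> c powr p"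
  proof
    assume "r powr (1 / p) \<le> c"
    then have "(r powr (1 / p)) powr p \<le> c powr p" using assms by (intro powr_mono2) auto
    then show "r \<le> c powr p" using real assms by (simp add: powr_powr)
  next
    assume "r \<le> c powr p"
    then have "r powr (1 / p) \<le> (c powr p) powr (1 / p)" using assms real by (intro powr_mono2) auto
    then show "r powr (1 / p) \<le> c" using real assms by (simp add: powr_powr)
  qed
  then show ?thesis using real assms by (simp add: epowr_def)
next
  case top
  then show ?thesis by (simp add: epowr_def top_unique)
qed

lemma le_epowr_iff:
  assumes "0 < p" "0 \<le> c"
  shows "ennreal c \<le> epowr x (1 / p) \<longleftrightarrow> ennreal (c powr p) \<le> x"
proof (cases x rule: ennreal_cases)
  case (real r)
  have "c \<le> r powr (1 / p) \<longleftrightarrow> c powr p \<le> r"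
  proof
    assume "c \<le> r powr (1 / p)"
    then have "c powr p \<le> (r powr (1 / p)) powr p" using assms by (intro powr_mono2) auto
    then show "c powr p \<le> r" using real assms by (simp add: powr_powr)
  next
    assume "c powr p \<le> r"
    then have "(c powr p) powr (1 / p) \<le> r powr (1 / p)" using assms real by (intro powr_mono2) auto
    then show "c \<le> r powr (1 / p)" using real assms by (simp add: powr_powr)
  qed
  then show ?thesis using real assms by (simp add: epowr_def)
next
  case top
  then show ?thesis by (simp add: epowr_def)
qed

lemma epowr_scale:
  assumes "0 < p" "0 < N"
  shows "ennreal N * epowr x (1 / p) = epowr (ennreal (N powr p) * x) (1 / p)"
proof (cases x rule: ennreal_cases)
  case (real r)
  then show ?thesis
    using assms by (simp add: epowr_def ennreal_mult_eq_top_iff powr_mult powr_powr flip: ennreal_mult)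
next
  case top
  then show ?thesis using assms by (simp add: epowr_def ennreal_mult_top)
qed

lemma scaled_quant_err_le_iff:
  assumes "0 < p" "0 \<le> c" "0 < N"
  shows "ennreal N * quant_err p \<mu> S \<le> ennreal c \<longleftrightarrow>
    ennreal (N powr p) * moment p \<mu> S \<le> ennreal (c powr p)"
  using assms by (simp add: quant_err_def epowr_scale epowr_le_iff)

lemma le_scaled_quant_err_iff:
  assumes "0 < p" "0 \<le> c" "0 < N"
  shows "ennreal c \<le> ennreal N * quant_err p \<mu> S \<longleftrightarrow>
    ennreal (c powr p) \<le> ennreal (N powr p) * moment p \<mu> S"
  using assms by (simp add: quant_err_def epowr_scale le_epowr_iff)

lemma le_scaled_opt_quant_err:
  assumes N: "0 < N" and le: "\<And>S. finite S \<Longrightarrow> S \<noteq> {} \<Longrightarrow> card S \<le> N \<Longrightarrow> c \<le> ennreal (real N) * quant_err p \<mu> S"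
  shows "c \<le> ennreal (real N) * opt_quant_err N p \<mu>"
proof -
  have "c / ennreal (real N) \<le> opt_quant_err N p \<mu>"
    unfolding opt_quant_err_def
    using N le by (intro INF_greatest divide_le_posI_ennreal) auto
  then have "ennreal (real N) * (c / ennreal (real N)) \<le> ennreal (real N) * opt_quant_err N p \<mu>"
    by (intro mult_left_mono) auto
  then show ?thesis
    using N by (simp add: ennreal_times_divide mult.commute[of "ennreal (real N)" c] mult_divide_eq_ennreal)
qed

text \<open>
  The \<open>p\<close>-th power of Zador's constant on the line.
\<close>

definition zador_power :: "real \<Rightarrow> real" where
  "zador_power p = 1 / (2 powr p * (p + 1))"

lemma zador_power_pos: "0 < p \<Longrightarrow> 0 < zador_power p"
  by (simp add: zador_power_def)

text \<open>
  Continuity of the power in \<open>I\<close>, including the value \<open>top\<close>.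
\<close>

lemma epowr_mult_le_if_lower:
  assumes a: "0 < a" and k: "0 < k"
    and le: "\<And>c. 0 \<le> c \<Longrightarrow> ennreal c < I \<Longrightarrow> ennreal (k * c powr a) \<le> Q"
  shows "ennreal k * epowr I a \<le> Q"
proof (cases I rule: ennreal_cases)
  case (real i)
  show ?thesis
  proof (cases "i = 0")
    case True
    then show ?thesis using real by (simp add: epowr_def)
  next
    case False
    then have i: "0 < i" using real by simp
    have "((\<lambda>c. ennreal (k * c powr a)) \<longlongrightarrow> ennreal (k * i powr a)) (at_left i)"
      using i by (intro tendsto_intros) auto
    moreover have "\<forall>\<^sub>F c in at_left i. ennreal (k * c powr a) \<le> Q"
      unfolding eventually_at_left_field
      using le i real by (intro exI[of _ 0]) (auto simp: ennreal_less_iff)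
    ultimately have "ennreal (k * i powr a) \<le> Q"
      by (rule tendsto_upperbound) simp
    then show ?thesis using real k by (simp add: epowr_def ennreal_mult)
  qed
next
  case top
  have "filterlim (\<lambda>c. k * c powr a) at_top at_top" using a k by real_asymp
  then have "((\<lambda>c. ennreal (k * c powr a)) \<longlongrightarrow> top) at_top"
    by (rule filterlim_compose[OF ennreal_tendsto_top_eq_at_top[THEN iffD2, OF filterlim_ident]])
  moreover have "\<forall>\<^sub>F c in at_top. ennreal (k * c powr a) \<le> Q"
    using eventually_ge_at_top[of 0] by eventually_elim (rule le, auto simp: top)
  ultimately have "top \<le> Q"
    by (rule tendsto_upperbound) simp
  then show ?thesis by (simp add: top_unique)
qed

text \<open>
  \<open>local_lower_bound\<close> with \<open>\<tau> = c\<close>, the maximizer of \<open>c * \<tau> powr p - p / (p + 1) * \<tau> powr (p + 1)\<close>.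
\<close>

theorem lower_quant_coeff_ge:
  fixes \<mu> :: "'a::polish_space measure" and \<rho> :: "'a \<Rightarrow> real"
  assumes p: "1 \<le> p" and \<mu>: "sets \<mu> = sets borel" "finite_measure \<mu>"
    and \<rho>: "\<rho> \<in> borel_measurable borel" and \<rho>0: "\<And>x. 0 \<le> \<rho> x"
    and le: "density hausdorff1 (\<lambda>x. ennreal (\<rho> x)) \<le> \<mu>"
  shows "ennreal (zador_power p powr (1 / p)) *
      epowr (\<integral>\<^sup>+x. ennreal (\<rho> x powr (1 / (1 + p))) \<partial>hausdorff1) ((p + 1) / p) \<le> lower_quant_coeff p 1 \<mu>"
proof (rule epowr_mult_le_if_lower)
  fix c :: real assume c: "0 \<le> c" "ennreal c < (\<integral>\<^sup>+x. ennreal (\<rho> x powr (1 / (1 + p))) \<partial>hausdorff1)"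
  define q where "q = zador_power p powr (1 / p) * c powr ((p + 1) / p)"
  have q: "q powr p = c powr (p + 1) / (2 powr p * (p + 1))"
    using p c zador_power_pos[of p] by (simp add: q_def powr_mult powr_powr) (simp add: zador_power_def)
  have "c \<le> 0 \<or> ennreal c < (\<integral>\<^sup>+x. ennreal (\<rho> x powr (1 / (1 + p))) * indicator UNIV x \<partial>hausdorff1)"
    using c by simp
  moreover have UB: "UNIV \<in> sets (borel :: 'a measure)" by simp
  ultimately obtain K :: "'a set" where
    lb: "\<And>\<tau> r. 0 \<le> \<tau> \<Longrightarrow> 0 < r \<Longrightarrow> \<forall>\<^sub>F N in sequentially. lower_estimate p \<mu> K c \<tau> r N"
    using local_lower_bound[OF p \<mu> \<rho> \<rho>0 le UB, of c thesis] by blast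
  from lb[OF c(1) zero_less_one] eventually_gt_at_top[of 0]
  have "\<forall>\<^sub>F N in sequentially. ennreal q \<le> ennreal (real N powr (1 / 1)) * opt_quant_err N p \<mu>"
  proof (eventually_elim)
    fix N :: nat
    assume N: "0 < N" and *: "lower_estimate p \<mu> K c c 1 N"
    have "ennreal q \<le> ennreal (real N) * opt_quant_err N p \<mu>"
    proof (rule le_scaled_opt_quant_err[OF N])
      fix S :: "'a set" assume S: "finite S" "S \<noteq> {}" "card S \<le> N"
      define J where "J = moment p \<mu> S"
      have JK: "moment_on p \<mu> K S \<le> J"
        unfolding J_def by (intro nn_integral_mono) (auto simp: indicator_def)
      have cd: "card {s\<in>S. \<exists>x\<in>K. dist x s < 1} / N \<le> 1"
        using S N card_mono[of S "{s\<in>S. \<exists>x\<in>K. dist x s < 1}"] by simp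
      have "ennreal (c * c powr p) \<le> ennreal ((2 * real N) powr p) * J + ennreal (p / (p + 1) * c powr (p
        + 1) * 1)"
        using p cd JK by (intro order_trans[OF *[rule_format, OF S(1,2)]] add_mono mult_left_mono
          ennreal_leI) auto
      then have "ennreal (c * c powr p) - ennreal (p / (p + 1) * c powr (p + 1))
        \<le> ennreal ((2 * real N) powr p) * J"
        by (simp add: ennreal_minus_le_iff add.commute)
      moreover have "ennreal (c * c powr p) - ennreal (p / (p + 1) * c powr (p + 1)) = ennreal (c powr (p
        + 1) / (p + 1))"
      proof -
        have "c * c powr p = c powr (p + 1)" using c by (cases "c = 0") (auto simp: powr_add)
        moreover have "c powr (p + 1) - p / (p + 1) * c powr (p + 1) = c powr (p + 1) / (p + 1)"
          using p by (simp add: field_simps)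
        ultimately show ?thesis using p by (subst ennreal_minus) auto
      qed
      ultimately have "ennreal (1 / 2 powr p) * ennreal (c powr (p + 1) / (p + 1))
        \<le> ennreal (1 / 2 powr p) * (ennreal ((2 * real N) powr p) * J)"
        by (intro mult_left_mono) auto
      also have "\<dots> = ennreal (real N powr p) * J"
        by (simp add: powr_mult mult.assoc[symmetric] flip: ennreal_mult)
      finally have "ennreal (q powr p) \<le> ennreal (real N powr p) * J"
        using p by (simp add: q flip: ennreal_mult)
      then show "ennreal q \<le> ennreal (real N) * quant_err p \<mu> S"
        using p N by (subst le_scaled_quant_err_iff) (auto simp: J_def q_def)
    qed
    then show "ennreal q \<le> ennreal (real N powr (1 / 1)) * opt_quant_err N p \<mu>" by simp
  qed
  then show "ennreal (zador_power p powr (1 / p) * c powr ((p + 1) / p)) \<le> lower_quant_coeff p 1 \<mu>"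
    unfolding lower_quant_coeff_def q_def by (rule Liminf_bounded)
qed (use p zador_power_pos[of p] in auto)

section \<open>Asymptotic distribution of optimal points\<close>

lemma powr_diff_bounds:
  fixes p i t :: real
  assumes "1 \<le> p" "0 < i" "i < t"
  shows "p * i powr (p - 1) * (t - i) \<le> t powr p - i powr p"
    and "t powr p - i powr p \<le> p * t powr (p - 1) * (t - i)"
proof -
  have "\<exists>z>i. z < t \<and> t powr p - i powr p = (t - i) * (p * z powr (p - 1))"
    using assms by (intro MVT2[of i t "\<lambda>x. x powr p" "\<lambda>x. p * x powr (p - 1)"])
      (auto intro!: has_real_derivative_powr)
  then obtain z where z: "i < z" "z < t" "t powr p - i powr p = (t - i) * (p * z powr (p - 1))" by blast
  have "i powr (p - 1) \<le> z powr (p - 1)" "z powr (p - 1) \<le> t powr (p - 1)"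
    using z assms by (auto intro!: powr_mono2)
  then show "p * i powr (p - 1) * (t - i) \<le> t powr p - i powr p"
      "t powr p - i powr p \<le> p * t powr (p - 1) * (t - i)"
    unfolding z(3) using assms by (auto simp: mult_ac intro!: mult_left_mono)
qed

text \<open>
  Let \<open>x\<close> be the fraction of points in \<open>D\<close>. The inequality \<open>local_lower_bound\<close> on \<open>D\<close> with
  \<open>\<tau> = t > i\<close> and on the complement with \<open>\<tau> = i\<close>, added up and compared with near optimality, gives
  in the limit \<open>m * (t powr p - i powr p) \<le> p / (p + 1) * (t powr (p + 1) - i powr (p + 1)) * x\<close>,
  because for \<open>\<tau> = i\<close> on both sides the inequality is sharp. By the mean value theorem this yields
  \<open>x \<ge> m * i powr (p - 1) / t powr p\<close>, which tends to \<open>m / i\<close> as \<open>t\<close> decreases to \<open>i\<close>.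
\<close>

lemma near_optimal_local_count:
  fixes \<mu> :: "'a::polish_space measure" and \<rho> :: "'a \<Rightarrow> real" and S :: "nat \<Rightarrow> 'a set"
  assumes p: "1 \<le> p" and \<mu>: "sets \<mu> = sets borel" "finite_measure \<mu>"
    and \<rho>[measurable]: "\<rho> \<in> borel_measurable borel" and \<rho>0: "\<And>x. 0 \<le> \<rho> x"
    and le: "density hausdorff1 (\<lambda>x. ennreal (\<rho> x)) \<le> \<mu>"
    and i: "(\<integral>\<^sup>+x. ennreal (\<rho> x powr (1 / (1 + p))) \<partial>hausdorff1) = ennreal i" "0 < i"
    and S: "\<And>N. 1 \<le> N \<Longrightarrow> S N \<noteq> {} \<and> finite (S N) \<and> card (S N) \<le> N"
    and opt: "\<And>e. 0 < e \<Longrightarrow> \<forall>\<^sub>F N in sequentially.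
      ennreal (real N powr p) * moment p \<mu> (S N) \<le> ennreal (zador_power p * i powr (p + 1) + e)"
    and D: "open D" and m: "(\<integral>\<^sup>+x. ennreal (\<rho> x powr (1 / (1 + p))) * indicator D x \<partial>hausdorff1) = ennreal m"
    and c: "0 \<le> c" "c < m / i"
  shows "\<forall>\<^sub>F N in sequentially. c \<le> real (card (S N \<inter> D)) / real N"
proof -
  define m2 where "m2 = i - m"
  have m0: "0 < m" using c i by (smt (verit) divide_nonpos_pos)
  have Db[measurable]: "D \<in> sets borel" "- D \<in> sets borel" using D by auto
  have "ennreal i = (\<integral>\<^sup>+x. ennreal (\<rho> x powr (1 / (1 + p))) * indicator D x
      + ennreal (\<rho> x powr (1 / (1 + p))) * indicator (- D) x \<partial>hausdorff1)"
    unfolding i(1)[symmetric] by (intro nn_integral_cong) (auto simp: indicator_def)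
  also have "\<dots> = ennreal m + (\<integral>\<^sup>+x. ennreal (\<rho> x powr (1 / (1 + p))) * indicator (- D) x \<partial>hausdorff1)"
    unfolding m[symmetric] by (rule nn_integral_add) auto
  finally have im: "ennreal i = ennreal m + (\<integral>\<^sup>+x. ennreal (\<rho> x powr (1 / (1
    + p))) * indicator (- D) x \<partial>hausdorff1)" .
  then have m2: "(\<integral>\<^sup>+x. ennreal (\<rho> x powr (1 / (1 + p))) * indicator (- D) x \<partial>hausdorff1) = ennreal m2"
    unfolding m2_def using m0 by (metis ennreal_add_diff_cancel_left ennreal_minus ennreal_neq_top
      less_imp_le)
  have m20: "0 \<le> m2"
  proof -
    have "ennreal m \<le> ennreal i" using im by simp
    then show ?thesis using m0 i by (simp add: m2_def)
  qed
  \<comment> \<open>The margin in the hypothesis on \<open>c\<close> is spent on \<open>t > i\<close> and on the error \<open>e\<close> in the masses and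
    in the optimality.\<close>
  have "((\<lambda>t. m * i powr (p - 1) / t powr p) \<longlongrightarrow> m * i powr (p - 1) / i powr p) (at_right i)"
    using i by (intro tendsto_intros) auto
  moreover have "m * i powr (p - 1) / i powr p = m / i"
    using i by (simp add: powr_diff)
  ultimately have "\<forall>\<^sub>F t in at_right i. c < m * i powr (p - 1) / t powr p"
    using c by (intro order_tendstoD(1)) auto
  then obtain t where t: "i < t" "c < m * i powr (p - 1) / t powr p"
    unfolding eventually_at_right_field using dense by metis
  define d where "d = p / (p + 1) * (t powr (p + 1) - i powr (p + 1))"
  have tp: "i powr (p + 1) < t powr (p + 1)" using t i p by (intro powr_less_mono2) auto
  have d0: "0 < d" using tp p by (simp add: d_def)
  have "d \<le> p / (p + 1) * ((p + 1) * t powr p * (t - i))"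
    unfolding d_def using powr_diff_bounds(2)[of "p + 1" i t] t p i by (intro mult_left_mono) auto
  then have "d \<le> p * t powr p * (t - i)" using p by simp
  then have "c * d \<le> c * (p * t powr p * (t - i))" using c by (intro mult_left_mono)
  also have "\<dots> < m * i powr (p - 1) / t powr p * (p * t powr p * (t - i))"
    using t p i by (intro mult_strict_right_mono) auto
  also have "\<dots> = m * (p * i powr (p - 1) * (t - i))" using t i by simp
  also have "\<dots> \<le> m * (t powr p - i powr p)"
    using powr_diff_bounds(1)[of p i t] m0 t i p by (intro mult_left_mono) auto
  finally have slack: "c * d < m * (t powr p - i powr p)" .
  define A where "A = t powr p + i powr p + 2 powr p"
  have A0: "0 < A" by (simp add: A_def add_nonneg_pos)
  define e where "e = (m * (t powr p - i powr p) - c * d) / A"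
  have e0: "0 < e" using slack A0 by (simp add: e_def)
  have c1: "m - e \<le> 0 \<or> ennreal (m - e) < (\<integral>\<^sup>+x. ennreal (\<rho> x powr (1 / (1
    + p))) * indicator D x \<partial>hausdorff1)"
    using e0 unfolding m by (cases "m - e \<le> 0") (auto intro!: ennreal_lessI)
  have c2: "m2 - e \<le> 0 \<or> ennreal (m2 - e) < (\<integral>\<^sup>+x. ennreal (\<rho> x powr (1 / (1
    + p))) * indicator (- D) x \<partial>hausdorff1)"
    using e0 unfolding m2 by (cases "m2 - e \<le> 0") (auto intro!: ennreal_lessI)
  obtain K1 where K1: "compact K1" "K1 \<subseteq> D" and lb1:
    "\<And>\<tau> r. 0 \<le> \<tau> \<Longrightarrow> 0 < r \<Longrightarrow> \<forall>\<^sub>F N in sequentially. lower_estimate p \<mu> K1 (m - e) \<tau> r N"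
    by (rule local_lower_bound[OF p \<mu> \<rho> \<rho>0 le Db(1) c1]) auto
  obtain K2 where K2: "compact K2" "K2 \<subseteq> - D" and lb2:
    "\<And>\<tau> r. 0 \<le> \<tau> \<Longrightarrow> 0 < r \<Longrightarrow> \<forall>\<^sub>F N in sequentially. lower_estimate p \<mu> K2 (m2 - e) \<tau> r N"
    by (rule local_lower_bound[OF p \<mu> \<rho> \<rho>0 le Db(2) c2]) auto
  have Kb[measurable]: "K1 \<in> sets borel" "K2 \<in> sets borel"
    using K1 K2 by (auto simp: compact_imp_closed)
  have "\<forall>\<^sub>F r in at_right 0. \<forall>x\<in>K1. \<forall>y\<in>- D. 2 * r < dist x y"
    using K1 D by (intro eventually_compact_closed_far) (auto simp: closed_def)
  then obtain r where r: "0 < r" "\<And>x y. x \<in> K1 \<Longrightarrow> y \<in> - D \<Longrightarrow> 2 * r < dist x y"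
    unfolding eventually_at_right_field using dense by metis
  have t0: "0 \<le> t" "0 \<le> i" using t i by auto
  from lb1[OF t0(1) r(1)] lb2[OF t0(2) r(1)] opt[OF e0] eventually_ge_at_top[of 1]
  show ?thesis
  proof eventually_elim
    fix N :: nat
    assume l1: "lower_estimate p \<mu> K1 (m - e) t r N"
      and l2: "lower_estimate p \<mu> K2 (m2 - e) i r N"
      and o: "ennreal (real N powr p) * moment p \<mu> (S N) \<le> ennreal (zador_power p * i powr (p + 1) + e)"
      and N: "1 \<le> N"
    have SN: "finite (S N)" "S N \<noteq> {}" "card (S N) \<le> N" using S[OF N] by auto
    define N1 where "N1 = {s\<in>S N. \<exists>x\<in>K1. dist x s < r}"
    define N2 where "N2 = {s\<in>S N. \<exists>x\<in>K2. dist x s < r}"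
    define x where "x = real (card N1) / N"
    define y where "y = real (card N2) / N"
    have N1D: "N1 \<subseteq> S N \<inter> D"
      using r by (force simp: N1_def)
    have "N1 \<inter> N2 = {}"
    proof (rule ccontr)
      assume "\<not> ?thesis"
      then obtain s a b where s: "a \<in> K1" "dist a s < r" "b \<in> K2" "dist b s < r" by (auto simp: N1_def N2_def)
      then show False using r(2)[of a b] K2 dist_triangle2[of a b s] by fastforce
    qed
    then have "card N1 + card N2 = card (N1 \<union> N2)"
      using SN by (intro card_Un_disjoint[symmetric]) (auto simp: N1_def N2_def)
    also have "\<dots> \<le> card (S N)" using SN by (intro card_mono) (auto simp: N1_def N2_def)
    finally have "real (card N1) + real (card N2) \<le> real N" using SN by linarith
    then have xy: "x + y \<le> 1" using N by (simp add: x_def y_def flip: add_divide_distrib)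
    have xy0: "0 \<le> x" "0 \<le> y" by (auto simp: x_def y_def)
    define J where "J K = moment_on p \<mu> K (S N)" for K
    have "J K1 + J K2 = (\<integral>\<^sup>+x. ennreal (infdist x (S N) powr p) * indicator K1 x
      + ennreal (infdist x (S N) powr p) * indicator K2 x \<partial>\<mu>)"
      unfolding J_def using \<mu> by (intro nn_integral_add[symmetric]) (auto simp: measurable_cong_sets[OF \<mu>(1)])
    also have "\<dots> \<le> moment p \<mu> (S N)"
      using K1(2) K2(2) by (intro nn_integral_mono) (auto simp: indicator_def)
    finally have JJ: "J K1 + J K2 \<le> moment p \<mu> (S N)" .
    have "ennreal ((m - e) * t powr p) + ennreal ((m2 - e) * i powr p) \<le>
       (ennreal ((2 * real N) powr p) * J K1 + ennreal (p / (p + 1) * t powr (p + 1) * x))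
       + (ennreal ((2 * real N) powr p) * J K2 + ennreal (p / (p + 1) * i powr (p + 1) * y))"
      using l1[rule_format, OF SN(1,2)] l2[rule_format, OF SN(1,2)]
      by (intro add_mono) (auto simp: J_def x_def y_def N1_def N2_def)
    also have "\<dots> = ennreal (2 powr p) * (ennreal (real N powr p) * (J K1 + J K2))
        + (ennreal (p / (p + 1) * t powr (p + 1) * x) + ennreal (p / (p + 1) * i powr (p + 1) * y))"
      by (simp add: powr_mult ennreal_mult algebra_simps)
    also have "\<dots> \<le> ennreal (2 powr p) * ennreal (zador_power p * i powr (p + 1) + e)
        + (ennreal (p / (p + 1) * t powr (p + 1) * x) + ennreal (p / (p + 1) * i powr (p + 1) * y))"
      using order_trans[OF mult_left_mono[OF JJ] o] by (intro add_mono mult_left_mono) auto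
    also have "\<dots> = ennreal (2 powr p * (zador_power p * i powr (p + 1) + e)
        + (p / (p + 1) * t powr (p + 1) * x + p / (p + 1) * i powr (p + 1) * y))"
      using p zador_power_pos[of p] e0 xy0 by (simp flip: ennreal_mult ennreal_plus)
    finally have "ennreal ((m - e) * t powr p) + ennreal ((m2 - e) * i powr p) \<le> \<dots>" .
    moreover have "ennreal ((m - e) * t powr p + (m2 - e) * i powr p)
        \<le> ennreal ((m - e) * t powr p) + ennreal ((m2 - e) * i powr p)"
      by (smt (verit) add.commute add_0 ennreal_leI ennreal_neg ennreal_plus add_increasing zero_le
        add_increasing2)
    ultimately have "ennreal ((m - e) * t powr p + (m2 - e) * i powr p) \<le>
        ennreal (2 powr p * (zador_power p * i powr (p + 1) + e)
        + (p / (p + 1) * t powr (p + 1) * x + p / (p + 1) * i powr (p + 1) * y))"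
      by (rule order_trans[rotated])
    then have "(m - e) * t powr p + (m2 - e) * i powr p \<le> 2 powr p * (zador_power p * i powr (p + 1) + e)
        + (p / (p + 1) * t powr (p + 1) * x + p / (p + 1) * i powr (p + 1) * y)"
      using p zador_power_pos[of p] e0 xy0 by (subst (asm) ennreal_le_iff) auto
    also have "2 powr p * (zador_power p * i powr (p + 1) + e) = i powr (p + 1) / (p + 1) + 2 powr p * e"
    proof -
      have "2 powr p * zador_power p = 1 / (p + 1)" by (simp add: zador_power_def)
      then show ?thesis unfolding distrib_left mult.assoc[symmetric] by simp
    qed
    also have "p / (p + 1) * i powr (p + 1) * y \<le> p / (p + 1) * i powr (p + 1) * (1 - x)"
      using xy p by (intro mult_left_mono) auto
    finally have "(m - e) * t powr p + (m2 - e) * i powr p \<le> i powr (p + 1) / (p + 1) + 2 powr p * e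
        + (p / (p + 1) * t powr (p + 1) * x + p / (p + 1) * i powr (p + 1) * (1 - x))" by simp
    moreover have "p / (p + 1) * t powr (p + 1) * x + p / (p + 1) * i powr (p + 1) * (1 - x)
        = d * x + (i powr (p + 1) - i powr (p + 1) / (p + 1))"
      using p by (simp add: d_def field_simps)
    moreover have "i powr (p + 1) = (m + m2) * i powr p"
      using i by (simp add: m2_def powr_add)
    moreover have "e * A = m * (t powr p - i powr p) - c * d"
      using A0 by (simp add: e_def)
    ultimately have "c * d \<le> x * d"
      unfolding A_def left_diff_distrib right_diff_distrib distrib_left distrib_right mult.commute[of x
        d] mult.commute[of "2 powr p" e]
      by linarith
    then have "c \<le> x" using d0 by simp
    also have "\<dots> \<le> real (card (S N \<inter> D)) / real N"
      unfolding x_def using SN N1D by (intro divide_right_mono of_nat_mono card_mono) auto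
    finally show "c \<le> real (card (S N \<inter> D)) / real N" .
  qed
qed


text \<open>
  One half of the portmanteau theorem. For nonnegative \<open>f\<close> the layer cake formula and Fatou's lemma
  bound the integral with respect to \<open>L\<close> by the lower limit of the others; applying this to \<open>B + f\<close>
  and \<open>B - f\<close>, with a bound \<open>B\<close> of \<open>f\<close>, gives convergence, since no mass exceeds \<open>1\<close>.
\<close>

lemma weakly_converges_if_open_mass:
  fixes M :: "nat \<Rightarrow> 'a::metric_space measure"
  assumes M: "\<And>N. sets (M N) = sets borel" "\<And>N. emeasure (M N) UNIV \<le> 1"
    and L: "sets L = sets borel" "emeasure L UNIV = 1"
    and op: "\<And>D c. open D \<Longrightarrow> 0 \<le> c \<Longrightarrow> ennreal c < emeasure L D \<Longrightarrow>
      \<forall>\<^sub>F N in sequentially. ennreal c \<le> emeasure (M N) D"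
  shows "weakly_converges M L"
proof -
  have sp: "space (M N) = UNIV" "space L = UNIV" for N
    using sets_eq_imp_space_eq[OF M(1)] sets_eq_imp_space_eq[OF L(1)] by auto
  have finM: "finite_measure (M N)" for N
    using M(2)[of N] sp by (intro finite_measureI) (auto simp: top_unique)
  interpret L: finite_measure L
    using L sp by (intro finite_measureI) auto
  have liminf_open: "emeasure L D \<le> liminf (\<lambda>N. emeasure (M N) D)" if "open D" for D
    unfolding le_Liminf_iff
  proof (intro allI impI)
    fix y assume "y < emeasure L D"
    then obtain z where z: "y < z" "z < emeasure L D" using dense by blast
    then have "z < top" by (metis order_less_le_trans top_greatest)
    then have zr: "ennreal (enn2real z) = z" by simp
    have "\<forall>\<^sub>F N in sequentially. z \<le> emeasure (M N) D"
      using op[OF that, of "enn2real z"] z(2) unfolding zr by simp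
    then show "\<forall>\<^sub>F N in sequentially. y < emeasure (M N) D"
      by (rule eventually_mono) (rule order_less_le_trans[OF z(1)])
  qed
  have meas: "f \<in> borel_measurable (M N)" "f \<in> borel_measurable L" if "continuous_on UNIV f" for f :: "'a
    \<Rightarrow> real" and N
    using borel_measurable_continuous_onI[OF that] by (auto simp: measurable_cong_sets[OF M(1)]
      measurable_cong_sets[OF L(1)])
  have liminf_nn: "(\<integral>\<^sup>+x. ennreal (f x) \<partial>L) \<le> liminf (\<lambda>N. \<integral>\<^sup>+x. ennreal (f x) \<partial>M N)"
    if f: "continuous_on UNIV f" and f0: "\<And>x. 0 \<le> f x" for f
  proof -
    define k where "k t = ennreal (indicator {0<..} t * (1 * t powr (1 - 1)))" for t :: real
    have [measurable]: "k \<in> borel_measurable borel" unfolding k_def by measurable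
    have op: "open {x. t < f x}" for t
      using open_Collect_less[OF continuous_on_const f] by simp
    have lM: "(\<integral>\<^sup>+x. ennreal (f x) \<partial>M N) = (\<integral>\<^sup>+t. k t * emeasure (M N) {x\<in>space (M N). t < f x} \<partial>lborel)"
      for N
      using layer_cake_powr[OF finite_measure.axioms(1)[OF finM] meas(1)[OF f] f0 zero_less_one]
      unfolding k_def powr_one[OF f0] .
    have lL: "(\<integral>\<^sup>+x. ennreal (f x) \<partial>L) = (\<integral>\<^sup>+t. k t * emeasure L {x\<in>space L. t < f x} \<partial>lborel)"
      using layer_cake_powr[OF L.sigma_finite_measure_axioms meas(2)[OF f] f0 zero_less_one]
      unfolding k_def powr_one[OF f0] .
    have mM: "(\<lambda>t. emeasure (M N) {x\<in>space (M N). t < f x}) \<in> borel_measurable borel" for N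
      by (intro measurable_emeasure_superlevel finite_measure.axioms(1)[OF finM] meas(1)[OF f])
    have "(\<integral>\<^sup>+x. ennreal (f x) \<partial>L) \<le> (\<integral>\<^sup>+t. liminf (\<lambda>N. k t * emeasure (M N) {x\<in>space (M N). t < f x})
      \<partial>lborel)"
      unfolding lL
    proof (rule nn_integral_mono)
      fix t
      have "k t = 0 \<or> k t = 1" by (auto simp: k_def indicator_def)
      then show "k t * emeasure L {x\<in>space L. t < f x}
          \<le> liminf (\<lambda>N. k t * emeasure (M N) {x\<in>space (M N). t < f x})"
        using liminf_open[OF op[of t]] by (auto simp: sp)
    qed
    also have "\<dots> \<le> liminf (\<lambda>N. \<integral>\<^sup>+t. k t * emeasure (M N) {x\<in>space (M N). t < f x} \<partial>lborel)"
      using mM by (intro nn_integral_liminf) auto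
    finally show ?thesis by (simp add: lM)
  qed
  have lower: "\<forall>\<^sub>F N in sequentially. (\<integral>x. f x \<partial>L) - e \<le> (\<integral>x. f x \<partial>M N)"
    if f: "continuous_on UNIV f" "bounded (range f)" and e: "0 < e" for f :: "'a \<Rightarrow> real" and e
  proof -
    obtain B where B: "\<And>x. \<bar>f x\<bar> \<le> B" using f(2) by (auto simp: bounded_iff)
    have B0: "0 \<le> B" using B[of undefined] by linarith
    have fB: "0 \<le> f x + B" for x using B[of x] by linarith
    have cB: "continuous_on UNIV (\<lambda>x. f x + B)" using f by (intro continuous_intros)
    have iM: "integrable (M N) f" for N
      using finite_measure.integrable_const_bound[OF finM, where f=f and B=B] B meas(1)[OF f(1)] by auto
    have iL: "integrable L f"
      using L.integrable_const_bound[where f=f and B=B] B meas(2)[OF f(1)] by auto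
    have sM: "(\<integral>x. f x + B \<partial>M N) = (\<integral>x. f x \<partial>M N) + B * measure (M N) UNIV" for N
    proof -
      interpret finite_measure "M N" by (rule finM)
      show ?thesis using iM[of N] by (simp add: sp mult.commute)
    qed
    have iMB: "integrable (M N) (\<lambda>x. f x + B)" for N
      using iM[of N] finite_measure.integrable_const[OF finM] by (rule Bochner_Integration.integrable_add)
    have nM: "(\<integral>\<^sup>+x. ennreal (f x + B) \<partial>M N) = ennreal ((\<integral>x. f x \<partial>M N) + B * measure (M N) UNIV)" for N
      unfolding sM[symmetric] using fB by (intro nn_integral_eq_integral iMB) auto
    have nL: "(\<integral>\<^sup>+x. ennreal (f x + B) \<partial>L) = ennreal ((\<integral>x. f x \<partial>L) + B)"
      using fB iL L by (subst nn_integral_eq_integral) (auto simp: sp measure_def)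
    have mass: "B * measure (M N) UNIV \<le> B" for N
      using mult_left_mono[OF _ B0, of "measure (M N) UNIV" 1] enn2real_mono[OF M(2)[of N]]
        by (simp add: measure_def)
    define a where "a = (\<integral>x. f x \<partial>L) + B"
    have "0 \<le> (\<integral>x. f x + B \<partial>M N)" for N using fB by (intro integral_nonneg_AE) auto
    then have pos: "0 \<le> (\<integral>x. f x \<partial>M N) + B * measure (M N) UNIV" for N unfolding sM .
    show ?thesis
    proof (cases "a - e \<le> 0")
      case True
      have "(\<integral>x. f x \<partial>L) - e \<le> (\<integral>x. f x \<partial>M N)" for N
        using True pos[of N] mass[of N] unfolding a_def by linarith
      then show ?thesis by simp
    next
      case False
      then have "ennreal (a - e) < ennreal a" using e by (intro ennreal_lessI) auto
      also have "\<dots> \<le> liminf (\<lambda>N. \<integral>\<^sup>+x. ennreal (f x + B) \<partial>M N)"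
        using liminf_nn[OF cB fB] unfolding nL a_def .
      finally have "ennreal (a - e) < liminf (\<lambda>N. \<integral>\<^sup>+x. ennreal (f x + B) \<partial>M N)" .
      then have "\<forall>\<^sub>F N in sequentially. ennreal (a - e) < (\<integral>\<^sup>+x. ennreal (f x + B) \<partial>M N)"
        by (rule less_LiminfD)
      then show ?thesis
      proof eventually_elim
        fix N assume "ennreal (a - e) < (\<integral>\<^sup>+x. ennreal (f x + B) \<partial>M N)"
        then have "a - e < (\<integral>x. f x \<partial>M N) + B * measure (M N) UNIV"
          unfolding nM using False by (subst (asm) ennreal_less_iff) auto
        then show "(\<integral>x. f x \<partial>L) - e \<le> (\<integral>x. f x \<partial>M N)"
          using mass[of N] by (simp add: a_def)
      qed
    qed
  qed
  show ?thesis
    unfolding weakly_converges_def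
  proof (intro allI impI tendstoI)
    fix f :: "'a \<Rightarrow> real" and e :: real
    assume f: "continuous_on UNIV f" "bounded (range f)" and e: "0 < e"
    have b: "bounded (range (\<lambda>x. - f x))" using f(2) by (auto simp: bounded_iff)
    have c: "continuous_on UNIV (\<lambda>x. - f x)" using f(1) by (rule continuous_on_minus)
    have e2: "0 < e / 2" using e by simp
    have "\<forall>\<^sub>F N in sequentially. (\<integral>x. - f x \<partial>L) - e / 2 \<le> (\<integral>x. - f x \<partial>M N)"
      by (rule lower[OF c b e2])
    moreover have "\<forall>\<^sub>F N in sequentially. (\<integral>x. f x \<partial>L) - e / 2 \<le> (\<integral>x. f x \<partial>M N)"
      by (rule lower[OF f e2])
    ultimately show "\<forall>\<^sub>F N in sequentially. dist (\<integral>x. f x \<partial>M N) (\<integral>x. f x \<partial>L) < e"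
    proof eventually_elim
      case (elim N)
      then have "\<bar>(\<integral>x. f x \<partial>M N) - (\<integral>x. f x \<partial>L)\<bar> \<le> e / 2"
        unfolding Bochner_Integration.integral_minus abs_le_iff by linarith
      then show ?case using e by (simp add: dist_real_def)
    qed
  qed
qed

lemma sets_empirical_measure [simp]: "sets (empirical_measure N S) = sets borel"
  by (simp add: empirical_measure_def)

theorem near_optimal_weakly_converges:
  fixes \<mu> :: "'a::polish_space measure" and \<rho> :: "'a \<Rightarrow> real" and S :: "nat \<Rightarrow> 'a set"
  assumes p: "1 \<le> p" and \<mu>: "sets \<mu> = sets borel" "finite_measure \<mu>"
    and \<rho>[measurable]: "\<rho> \<in> borel_measurable borel" and \<rho>0: "\<And>x. 0 \<le> \<rho> x"
    and le: "density hausdorff1 (\<lambda>x. ennreal (\<rho> x)) \<le> \<mu>"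
    and i: "(\<integral>\<^sup>+x. ennreal (\<rho> x powr (1 / (1 + p))) \<partial>hausdorff1) = ennreal i" "0 < i"
    and S: "\<And>N. 1 \<le> N \<Longrightarrow> S N \<noteq> {} \<and> finite (S N) \<and> card (S N) \<le> N"
    and opt: "\<And>e. 0 < e \<Longrightarrow> \<forall>\<^sub>F N in sequentially.
      ennreal (real N powr p) * moment p \<mu> (S N) \<le> ennreal (zador_power p * i powr (p + 1) + e)"
  shows "weakly_converges (\<lambda>N. empirical_measure N (S N))
      (density hausdorff1 (\<lambda>x. ennreal (\<rho> x powr (1 / (1 + p))) / ennreal i))"
proof (rule weakly_converges_if_open_mass)
  let ?g = "\<lambda>x. ennreal (\<rho> x powr (1 / (1 + p)))"
  let ?L = "density hausdorff1 (\<lambda>x. ?g x / ennreal i)"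
  have LD: "emeasure ?L D = (\<integral>\<^sup>+x. ?g x * indicator D x \<partial>hausdorff1) / ennreal i" if [measurable]: "D
    \<in> sets borel" for D
  proof -
    have "emeasure ?L D = (\<integral>\<^sup>+x. ?g x * indicator D x / ennreal i \<partial>hausdorff1)"
      by (subst emeasure_density) (auto intro!: nn_integral_cong simp: indicator_def)
    then show ?thesis by (simp add: nn_integral_divide)
  qed
  show "emeasure ?L UNIV = 1"
    using i by (subst LD) (auto simp: divide_ennreal)
  show "emeasure (empirical_measure N (S N)) UNIV \<le> 1" for N
  proof (cases "N = 0")
    case True
    then show ?thesis by (simp add: empirical_measure_def)
  next
    case False
    then have "S N \<noteq> {} \<and> finite (S N) \<and> card (S N) \<le> N" using S[of N] by simp
    moreover from this have "ennreal (real (card (S N)) / real N) \<le> ennreal 1"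
      using False by (intro ennreal_leI) auto
    ultimately show ?thesis by (subst emeasure_empirical_measure) auto
  qed
  fix D :: "'a set" and c :: real
  assume D: "open D" and c: "0 \<le> c" "ennreal c < emeasure ?L D"
  define m where "m = enn2real (\<integral>\<^sup>+x. ?g x * indicator D x \<partial>hausdorff1)"
  have "(\<integral>\<^sup>+x. ?g x * indicator D x \<partial>hausdorff1) \<le> (\<integral>\<^sup>+x. ?g x \<partial>hausdorff1)"
    by (intro nn_integral_mono) (auto simp: indicator_def)
  also have "\<dots> < top" using i by simp
  finally have m: "(\<integral>\<^sup>+x. ?g x * indicator D x \<partial>hausdorff1) = ennreal m" by (simp add: m_def)
  have m0: "0 \<le> m" by (simp add: m_def)
  have "ennreal c < ennreal (m / i)"
  proof -
    have "emeasure ?L D = ennreal (m / i)"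
      using LD[of D] D i m0 by (simp only: m borel_open divide_ennreal)
    then show ?thesis using c(2) by (simp only:)
  qed
  then have "c < m / i" using c by (simp add: ennreal_less_iff)
  then have "\<forall>\<^sub>F N in sequentially. c \<le> real (card (S N \<inter> D)) / real N"
    by (intro near_optimal_local_count[OF p \<mu> \<rho> \<rho>0 le i _ _ D m c(1)] S opt)
  from this eventually_ge_at_top[of 1]
  show "\<forall>\<^sub>F N in sequentially. ennreal c \<le> emeasure (empirical_measure N (S N)) D"
  proof eventually_elim
    case (elim N)
    then show ?case
      using S[of N] D by (subst emeasure_empirical_measure) (auto intro!: ennreal_leI)
  qed
qed simp_all

section \<open>Arc-length parametrization of Lipschitz images\<close>

text \<open>
  McShane's extension.
\<close>

lemma lipschitz_real_extension:
  fixes f :: "'a::metric_space \<Rightarrow> real"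
  assumes f: "L-lipschitz_on B f"
  obtains g where "L-lipschitz_on UNIV g" "\<And>x. x \<in> B \<Longrightarrow> g x = f x"
proof (cases "B = {}")
  case True
  then show ?thesis using that[of "\<lambda>_. 0"] lipschitz_on_nonneg[OF f] by (auto simp: lipschitz_on_def)
next
  case False
  note L = lipschitz_on_nonneg[OF f]
  define g where "g x = (INF y\<in>B. f y + L * dist x y)" for x
  have fd: "f z \<le> f y + L * dist z y" if "z \<in> B" "y \<in> B" for y z
    using lipschitz_onD[OF f that] by (auto simp: dist_real_def)
  obtain y0 where y0: "y0 \<in> B" using False by blast
  have bdd: "bdd_below ((\<lambda>y. f y + L * dist x y) ` B)" for x
  proof (rule bdd_belowI2)
    fix y assume y: "y \<in> B"
    have "L * dist y0 y \<le> L * (dist x y0 + dist x y)"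
      using L dist_triangle3[of y0 y x] by (intro mult_left_mono) auto
    then show "f y0 - L * dist x y0 \<le> f y + L * dist x y"
      using fd[OF y0 y] by (simp add: distrib_left)
  qed
  have g_le: "g x \<le> f y + L * dist x y" if "y \<in> B" for x y
    unfolding g_def using that bdd by (intro cINF_lower)
  have one: "g x \<le> g x' + L * dist x x'" for x x'
  proof -
    have "g x - L * dist x x' \<le> f y + L * dist x' y" if "y \<in> B" for y
    proof -
      have "L * dist x y \<le> L * (dist x x' + dist x' y)"
        using L dist_triangle[of x y x'] by (intro mult_left_mono) auto
      then show ?thesis using g_le[OF that, of x] by (simp add: distrib_left)
    qed
    then have "g x - L * dist x x' \<le> g x'"
      unfolding g_def[of x'] using False by (intro cINF_greatest)
    then show ?thesis by simp
  qed
  show ?thesis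
  proof (rule that[of g])
    show "L-lipschitz_on UNIV g"
    proof (rule lipschitz_onI)
      fix x y
      show "dist (g x) (g y) \<le> L * dist x y"
        using one[of x y] one[of y x] by (auto simp: dist_real_def dist_commute)
    qed fact
    fix x assume x: "x \<in> B"
    have "g x \<le> f x" using g_le[OF x, of x] by simp
    moreover have "f x \<le> g x" unfolding g_def using False fd[OF x] by (intro cINF_greatest) auto
    ultimately show "g x = f x" by simp
  qed
qed

text \<open>
  The distance to \<open>F a\<close>, as a function of the parameter, extends to an \<open>L\<close>-Lipschitz function on all
  of \<open>{a..b}\<close>, which takes every value between \<open>0\<close> and \<open>dist (F a) (F b)\<close>. The values taken on \<open>B\<close>
  form the image of a part of \<open>F ` B\<close> under a 1-Lipschitz map, and those taken on the gaps have
  measure at most \<open>L\<close> times the length of the gaps.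
\<close>

lemma dist_le_hausdorff1_plus_gaps:
  fixes F :: "real \<Rightarrow> 'a::metric_space"
  assumes F: "L-lipschitz_on B F" and L: "0 < L" and B: "B \<in> sets borel"
    and ab: "a \<in> B" "b \<in> B" "a \<le> b"
  shows "ennreal (dist (F a) (F b)) \<le>
    hausdorff1_outer (F ` (B \<inter> {a..b})) + ennreal L * emeasure lborel ({a..b} - B)"
proof -
  define f where "f y = dist (F y) (F a)" for y
  have "L-lipschitz_on B f"
  proof (rule lipschitz_onI)
    fix x y assume xy: "x \<in> B" "y \<in> B"
    have "dist (f x) (f y) \<le> dist (F x) (F y)"
      unfolding f_def dist_real_def by (metis abs_dist_diff_le dist_commute)
    also have "\<dots> \<le> L * dist x y" by (rule lipschitz_onD[OF F xy])
    finally show "dist (f x) (f y) \<le> L * dist x y" .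
  qed (use L in simp)
  then obtain g where g: "L-lipschitz_on UNIV g" "\<And>x. x \<in> B \<Longrightarrow> g x = f x"
    using lipschitz_real_extension by blast
  have cg: "continuous_on {a..b} g"
    using lipschitz_on_continuous_on[OF g(1)] continuous_on_subset by blast
  have "{0..dist (F a) (F b)} \<subseteq> g ` {a..b}"
  proof
    fix y assume y: "y \<in> {0..dist (F a) (F b)}"
    have "g a \<le> y" "y \<le> g b" using y g(2) ab by (auto simp: f_def dist_commute)
    then obtain x where "a \<le> x" "x \<le> b" "g x = y"
      using IVT'[of g a y b] ab cg by blast
    then show "y \<in> g ` {a..b}" by auto
  qed
  also have "\<dots> \<subseteq> (\<lambda>z. dist z (F a)) ` F ` (B \<inter> {a..b}) \<union> g ` ({a..b} - B)"
    using g(2) by (force simp: f_def)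
  finally have "hausdorff1_outer {0..dist (F a) (F b)}
      \<le> hausdorff1_outer ((\<lambda>z. dist z (F a)) ` F ` (B \<inter> {a..b}) \<union> g ` ({a..b} - B))"
    by (rule hausdorff1_outer_mono)
  also have "\<dots> \<le> hausdorff1_outer ((\<lambda>z. dist z (F a)) ` F ` (B \<inter> {a..b}))
    + hausdorff1_outer (g ` ({a..b} - B))"
    by (rule hausdorff1_outer_Un_le)
  also have "\<dots> \<le> ennreal 1 * hausdorff1_outer (F ` (B \<inter> {a..b})) + ennreal L * hausdorff1_outer ({a..b} - B)"
  proof (intro add_mono hausdorff1_outer_lipschitz_image)
    show "1-lipschitz_on (F ` (B \<inter> {a..b})) (\<lambda>z. dist z (F a))"
    proof (rule lipschitz_onI)
      show "dist (dist z (F a)) (dist w (F a)) \<le> 1 * dist z w" for z w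
        unfolding dist_real_def by (metis abs_dist_diff_le dist_commute mult_1)
    qed simp
    show "L-lipschitz_on ({a..b} - B) g" using g(1) by (rule lipschitz_on_subset) auto
  qed (use L in auto)
  also have "hausdorff1_outer ({a..b} - B) = emeasure lborel ({a..b} - B)"
    using B emeasure_hausdorff1[of "{a..b} - B"] by (simp add: hausdorff1_eq_lborel)
  finally have "hausdorff1_outer {0..dist (F a) (F b)} \<le>
      hausdorff1_outer (F ` (B \<inter> {a..b})) + ennreal L * emeasure lborel ({a..b} - B)" by simp
  moreover have "hausdorff1_outer {0..dist (F a) (F b)} = ennreal (dist (F a) (F b))"
    using emeasure_hausdorff1[of "{0..dist (F a) (F b)}"] by (simp add: hausdorff1_eq_lborel)
  ultimately show ?thesis by simp
qed

lemma ex_sum_measure: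
  assumes "sets N = sets M"
  obtains T where "sets T = sets M" "\<And>A. A \<in> sets M \<Longrightarrow> emeasure T A = emeasure M A + emeasure N A"
proof
  let ?f = "\<lambda>A. emeasure M A + emeasure N A"
  let ?T = "measure_of (space M) (sets M) ?f"
  show "sets ?T = sets M" by simp
  fix A assume A: "A \<in> sets M"
  show "emeasure ?T A = ?f A"
  proof (rule emeasure_measure_of_sigma[OF sets.sigma_algebra_axioms _ _ A])
    show "countably_additive (sets M) ?f"
      unfolding countably_additive_def
    proof (intro allI impI)
      fix A :: "nat \<Rightarrow> 'a set" assume A: "range A \<subseteq> sets M" "disjoint_family A" "(\<Union>i. A i) \<in> sets M"
      then show "(\<Sum>i. ?f (A i)) = ?f (\<Union>i. A i)"
        using assms by (simp add: suminf_add[symmetric] summableI suminf_emeasure)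
    qed
  qed (simp add: positive_def)
qed

text \<open>
  The probability integral transform: a continuous distribution function pushes its measure forward
  to the uniform one.
\<close>

lemma cdf_distr_eq_lborel:
  assumes T: "finite_borel_measure T" and atom: "\<And>x. measure T {x} = 0"
  shows "distr T borel (cdf T) = density lborel (indicator {0..measure T UNIV})"
proof (rule cdf_unique')
  interpret finite_borel_measure T by fact
  let ?\<Phi> = "cdf T" and ?m = "measure T UNIV"
  have cont: "continuous_on A ?\<Phi>" for A
    using isCont_cdf atom by (simp add: continuous_at_imp_continuous_on)
  have \<Phi>[measurable]: "?\<Phi> \<in> borel_measurable borel"
    by (intro borel_measurable_continuous_onI cont)
  have \<Phi>T: "?\<Phi> \<in> borel_measurable T"
    using \<Phi> unfolding measurable_cong_sets[OF M_is_borel refl] .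
  interpret D: finite_measure "distr T borel ?\<Phi>" by (rule finite_measure_distr[OF \<Phi>T])
  interpret E: finite_measure "density lborel (indicator {0..?m} :: real \<Rightarrow> ennreal)"
    by (intro finite_measureI) (simp add: emeasure_density)
  show "finite_borel_measure (distr T borel ?\<Phi>)" by unfold_locales simp
  show "finite_borel_measure (density lborel (indicator {0..?m} :: real \<Rightarrow> ennreal))" by unfold_locales simp
  have attained: "\<exists>x. ?\<Phi> x = c" if c: "0 < c" "c < ?m" for c
  proof -
    have "\<forall>\<^sub>F x in at_bot. ?\<Phi> x < c" "\<forall>\<^sub>F x in at_top. c < ?\<Phi> x"
      using order_tendstoD(2)[OF cdf_lim_at_bot c(1)] order_tendstoD(1)[OF cdf_lim_at_top, of c] c(2)
      by (auto simp: borel_UNIV)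
    then obtain x y where xy: "?\<Phi> x < c" "c < ?\<Phi> y"
      using eventually_happens by (metis trivial_limit_at_bot_linorder trivial_limit_at_top_linorder)
    then have "x \<le> y" using cdf_nondecreasing[of y x] by linarith
    then show ?thesis using IVT'[of ?\<Phi> x c y] xy cont by auto
  qed
  show "cdf (distr T borel ?\<Phi>) = cdf (density lborel (indicator {0..?m}))"
  proof
    fix c
    have l: "cdf (distr T borel ?\<Phi>) c = measure T {x. ?\<Phi> x \<le> c}"
      unfolding cdf_def2[of "distr T borel ?\<Phi>"] using \<Phi>T
      by (subst measure_distr) (auto simp: borel_UNIV vimage_def)
    have r: "cdf (density lborel (indicator {0..?m})) c = measure lborel ({0..?m} \<inter> {..c})"
      by (simp add: cdf_def measure_def emeasure_density flip: indicator_inter_arith)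
    have ms: "{x. ?\<Phi> x \<le> c} \<in> sets T" using M_is_borel by simp
    consider "c < 0" | "0 \<le> c" "c < ?m" | "0 \<le> c" "?m \<le> c" by linarith
    then show "cdf (distr T borel ?\<Phi>) c = cdf (density lborel (indicator {0..?m})) c"
    proof cases
      case 1
      have "\<not> ?\<Phi> x \<le> c" for x using cdf_nonneg[of x] 1 by linarith
      moreover have "{0..?m} \<inter> {..c} = {}" using 1 by auto
      ultimately show ?thesis unfolding l r by simp
    next
      case 2
      have "measure T {x. ?\<Phi> x \<le> c} \<le> c"
      proof (rule dense_ge_bounded[OF 2(2)])
        fix d assume d: "c < d" "d < ?m"
        then obtain x where x: "?\<Phi> x = d" using attained[of d] 2 by auto
        have "{x. ?\<Phi> x \<le> c} \<subseteq> {..x}"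
        proof
          fix y assume "y \<in> {x. ?\<Phi> x \<le> c}"
          then show "y \<in> {..x}" using cdf_nondecreasing[of x y] x d by (cases "x \<le> y") auto
        qed
        then have "measure T {x. ?\<Phi> x \<le> c} \<le> measure T {..x}" by (intro finite_measure_mono) auto
        then show "measure T {x. ?\<Phi> x \<le> c} \<le> d" using x by (simp add: cdf_def)
      qed
      moreover have "c \<le> measure T {x. ?\<Phi> x \<le> c}"
      proof (cases "c = 0")
        case False
        then obtain x where x: "?\<Phi> x = c" using attained[of c] 2 by auto
        have "{..x} \<subseteq> {x. ?\<Phi> x \<le> c}" using cdf_nondecreasing x by auto
        then have "measure T {..x} \<le> measure T {x. ?\<Phi> x \<le> c}" using ms by (intro finite_measure_mono)
        then show ?thesis using x by (simp add: cdf_def)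
      qed simp
      moreover have "{0..?m} \<inter> {..c} = {0..c}" using 2 by auto
      ultimately show ?thesis unfolding l r using 2 by simp
    next
      case 3
      have "?\<Phi> x \<le> c" for x using cdf_bounded[of x] 3 by (simp add: borel_UNIV)
      then have "{x. ?\<Phi> x \<le> c} = UNIV" by auto
      moreover have "{0..?m} \<inter> {..c} = {0..?m}" using 3 by auto
      ultimately show ?thesis unfolding l r by simp
    qed
  qed
qed

text \<open>
  Let \<open>T\<close> be the sum of the push-forward of \<open>H\<close> on \<open>K = F ` B\<close> under the inverse of \<open>F\<close> and of a
  multiple of Lebesgue measure on the gaps of \<open>B\<close>, and let \<open>\<Phi>\<close> be its distribution function. By
  \<open>dist_le_hausdorff1_plus_gaps\<close> the map \<open>G\<close> with \<open>G (\<Phi> x) = F x\<close> is 1-Lipschitz on \<open>V = \<Phi> ` B\<close>. As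
  \<open>\<Phi>\<close> pushes \<open>T\<close> forward to Lebesgue measure and increases strictly on the gaps, the measure of \<open>V\<close>
  is that of \<open>B\<close> under \<open>T\<close>, which is \<open>H(K)\<close>.
\<close>

theorem lipschitz_arc_reparametrization:
  fixes F :: "real \<Rightarrow> 'a::metric_space"
  assumes B: "compact B" and F: "L-lipschitz_on B F" and inj: "inj_on F B"
    and fin: "hausdorff1_outer (F ` B) < top"
  obtains V :: "real set" and G where "compact V" "1-lipschitz_on V G" "G ` V = F ` B"
    "emeasure lborel V \<le> hausdorff1_outer (F ` B)"
proof -
  \<comment> \<open>A positive constant makes \<open>\<Phi>\<close> strictly increasing on the gaps.\<close>
  define L' where "L' = L + 1"
  have L': "0 < L'" using lipschitz_on_nonneg[OF F] by (simp add: L'_def)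
  have F': "L'-lipschitz_on B F" using F by (rule lipschitz_on_le) (simp add: L'_def)
  have contF: "continuous_on B F" by (rule lipschitz_on_continuous_on[OF F])
  define K where "K = F ` B"
  have K: "compact K" unfolding K_def by (intro compact_continuous_image contF B)
  have Kb[measurable]: "K \<in> sets borel" and Bb[measurable]: "B \<in> sets borel"
    using K B by (auto simp: compact_imp_closed)
  define s where "s z = (if z \<in> K then the_inv_into B F z else 0)" for z
  have sF: "s (F x) = x" if "x \<in> B" for x
    using that inj by (simp add: s_def K_def the_inv_into_f_f)
  have "continuous_on K (the_inv_into B F)"
    unfolding K_def by (intro continuous_on_inv contF B) (simp add: the_inv_into_f_f inj)
  then have "the_inv_into B F \<in> borel_measurable (restrict_space borel K)"
    by (rule borel_measurable_continuous_on_restrict)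
  then have s[measurable]: "s \<in> borel_measurable borel"
    unfolding s_def by (subst (asm) measurable_restrict_space_iff[where c=0]) auto
  have Ks: "K \<inter> s -` A = F ` (B \<inter> A)" for A
    using sF by (auto simp: K_def)
  obtain \<alpha> \<beta> where J: "B \<subseteq> {\<alpha>..\<beta>}"
    using compact_imp_bounded[OF B] bounded_subset_cbox_symmetric[of B] by (metis cbox_interval)
  define m where "m = distr (density (hausdorff1 :: 'a measure) (indicator K)) borel s"
  define n where "n = density lborel (\<lambda>x. ennreal L' * indicator ({\<alpha>..\<beta>} - B) x)"
  have m: "emeasure m A = hausdorff1_outer (F ` (B \<inter> A))" if [measurable]: "A \<in> sets borel" for A
  proof -
    have "s -` A \<in> sets borel" using measurable_sets_borel[OF s that] .
    then have "emeasure m A = emeasure hausdorff1 (K \<inter> s -` A)"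
      unfolding m_def by (subst emeasure_distr) (auto simp: emeasure_density nn_integral_indicator
        simp flip: indicator_inter_arith)
    also have "\<dots> = hausdorff1_outer (K \<inter> s -` A)"
      using \<open>s -` A \<in> sets borel\<close> by (intro emeasure_hausdorff1) auto
    finally show ?thesis by (simp add: Ks)
  qed
  have n: "emeasure n A = ennreal L' * emeasure lborel (({\<alpha>..\<beta>} - B) \<inter> A)" if [measurable]: "A \<in> sets
    borel" for A
    unfolding n_def by (subst emeasure_density)
      (auto simp: nn_integral_cmult_indicator mult.assoc simp flip: indicator_inter_arith)
  have smn: "sets n = sets m" "sets m = sets borel" by (auto simp: n_def m_def)
  obtain T where T: "sets T = sets m" "\<And>A. A \<in> sets m \<Longrightarrow> emeasure T A = emeasure m A + emeasure n A"
    using ex_sum_measure[OF smn(1)] by blast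
  have sT: "sets T = sets borel" using T smn by simp
  have spT: "space T = UNIV" using sets_eq_imp_space_eq[OF sT] by simp
  have TA: "emeasure T A = hausdorff1_outer (F ` (B \<inter> A)) + ennreal L' * emeasure lborel (({\<alpha>..\<beta>} - B) \<inter> A)"
    if "A \<in> sets borel" for A
    using T(2)[of A] smn that m n by simp
  have "emeasure lborel (({\<alpha>..\<beta>} - B) \<inter> UNIV) \<le> emeasure lborel {\<alpha>..\<beta>}" by (intro emeasure_mono) auto
  also have "\<dots> < top" by (simp add: emeasure_lborel_Icc_eq)
  finally have "emeasure T UNIV < top"
    using fin by (subst TA) (auto simp: ennreal_mult_less_top)
  then have finT: "finite_measure T" by (intro finite_measureI) (auto simp: spT)
  interpret T: finite_borel_measure T
    using finT sT by (simp add: finite_borel_measure_def finite_borel_measure_axioms_def)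
  have atom: "measure T {x} = 0" for x
  proof -
    have "hausdorff1_outer (F ` (B \<inter> {x})) \<le> hausdorff1_outer {F x}"
      by (intro hausdorff1_outer_mono) auto
    moreover have "emeasure lborel (({\<alpha>..\<beta>} - B) \<inter> {x}) \<le> emeasure lborel {x}"
      by (intro emeasure_mono) auto
    ultimately have "emeasure T {x} = 0" by (simp add: TA)
    then show ?thesis by (simp add: measure_def)
  qed
  define \<Phi> where "\<Phi> = cdf T"
  have cont: "continuous_on A \<Phi>" for A
    unfolding \<Phi>_def using T.isCont_cdf atom by (simp add: continuous_at_imp_continuous_on)
  have \<Phi>_diff: "\<Phi> y - \<Phi> x = measure T {x<..y}" if "x < y" for x y
    unfolding \<Phi>_def using T.cdf_diff_eq[OF that] .
  have dist_le: "dist (F a) (F b) \<le> \<Phi> b - \<Phi> a" if ab: "a \<in> B" "b \<in> B" "a \<le> b" for a b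
  proof (cases "a = b")
    case False
    then have "a < b" using ab by simp
    have "{a..b} - B \<subseteq> {\<alpha>..\<beta>}" using ab J by (meson Diff_subset atLeastatMost_subset_iff subset_trans
      subsetD atLeastAtMost_iff)
    then have ab_J: "({\<alpha>..\<beta>} - B) \<inter> {a..b} = {a..b} - B" by auto
    have "ennreal (dist (F a) (F b)) \<le> hausdorff1_outer (F ` (B \<inter> {a..b}))
      + ennreal L' * emeasure lborel ({a..b} - B)"
      by (rule dist_le_hausdorff1_plus_gaps[OF F' L' Bb ab])
    also have "\<dots> = emeasure T {a..b}" by (simp add: TA ab_J)
    also have "\<dots> = ennreal (measure T {a..b})" by (simp add: T.emeasure_eq_measure)
    finally have "dist (F a) (F b) \<le> measure T {a..b}" by (simp add: ennreal_le_iff)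
    also have "{a..b} = {a} \<union> {a<..b}" using ab by auto
    also have "measure T \<dots> = measure T {a} + measure T {a<..b}"
      using sT by (intro T.finite_measure_Union) auto
    finally show ?thesis using atom[of a] \<Phi>_diff[OF \<open>a < b\<close>] by simp
  qed simp
  have dist_le': "dist (F a) (F b) \<le> \<bar>\<Phi> a - \<Phi> b\<bar>" if "a \<in> B" "b \<in> B" for a b
    using dist_le[of a b] dist_le[of b a] that by (cases "a \<le> b") (auto simp: dist_commute)
  have inj\<Phi>: "inj_on \<Phi> B"
  proof (rule inj_onI)
    fix a b assume "a \<in> B" "b \<in> B" "\<Phi> a = \<Phi> b"
    then have "F a = F b" using dist_le'[of a b] by simp
    then show "a = b" using inj \<open>a \<in> B\<close> \<open>b \<in> B\<close> by (simp add: inj_on_def)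
  qed
  define V where "V = \<Phi> ` B"
  define G where "G v = F (the_inv_into B \<Phi> v)" for v
  have G\<Phi>: "G (\<Phi> x) = F x" if "x \<in> B" for x
    using that inj\<Phi> by (simp add: G_def the_inv_into_f_f)
  have V: "compact V" unfolding V_def by (intro compact_continuous_image cont B)
  then have Vb[measurable]: "V \<in> sets borel" by (simp add: compact_imp_closed)
  have \<Phi>m[measurable]: "\<Phi> \<in> borel_measurable borel"
    by (intro borel_measurable_continuous_onI cont)
  have \<Phi>V: "\<Phi> -` V \<in> sets borel" using measurable_sets_borel[OF \<Phi>m Vb] .
  have no_gap: "({\<alpha>..\<beta>} - B) \<inter> \<Phi> -` V = {}"
  proof (rule ccontr)
    assume "\<not> ?thesis"
    then obtain y b where y: "\<alpha> \<le> y" "y \<le> \<beta>" "y \<notin> B" and b: "b \<in> B" "\<Phi> y = \<Phi> b" by (auto simp: V_def)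
    define lo hi where "lo = min y b" and "hi = max y b"
    have "y \<noteq> b" using y b by auto
    then have lohi: "lo < hi" by (auto simp: lo_def hi_def min_def max_def)
    have "\<Phi> hi - \<Phi> lo = 0" using b by (auto simp: lo_def hi_def max_def min_def)
    then have "measure T {lo<..hi} = 0" using \<Phi>_diff[OF lohi] by simp
    then have "emeasure T {lo<..hi} = 0" by (simp add: T.emeasure_eq_measure)
    then have z: "emeasure lborel (({\<alpha>..\<beta>} - B) \<inter> {lo<..hi}) = 0"
      using L' by (simp add: TA)
    define U where "U = {lo<..<hi} - B"
    have U: "open U" unfolding U_def using B by (intro open_Diff) (auto simp: compact_imp_closed)
    have "U \<subseteq> ({\<alpha>..\<beta>} - B) \<inter> {lo<..hi}"
      using y J b by (force simp: U_def lo_def hi_def)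
    then have "emeasure lborel U \<le> emeasure lborel (({\<alpha>..\<beta>} - B) \<inter> {lo<..hi})"
      by (intro emeasure_mono) auto
    then have "U \<in> null_sets lborel" using z U by (intro null_setsI) auto
    then have "U = {}" using U open_not_negligible negligible_iff_null_sets
      by (metis null_sets_completionI)
    moreover have "y islimpt {lo<..<hi}"
      using lohi by (cases "y < b") (auto simp: lo_def hi_def islimpt_greaterThanLessThan1
        islimpt_greaterThanLessThan2)
    then have "\<exists>x\<in>{lo<..<hi}. x \<in> - B"
      using y B compact_imp_closed[OF B] by (metis ComplI islimpt_def open_Compl)
    ultimately show False by (auto simp: U_def)
  qed
  have \<Phi>T: "\<Phi> \<in> borel_measurable T"
    using \<Phi>m unfolding measurable_cong_sets[OF sT refl] .
  have Vsub: "V \<subseteq> {0..measure T UNIV}"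
    using T.cdf_nonneg T.cdf_bounded by (auto simp: V_def \<Phi>_def spT)
  have "emeasure lborel V = emeasure (density lborel (indicator {0..measure T UNIV})) V"
    using Vsub by (simp add: emeasure_density Int_absorb1 flip: indicator_inter_arith)
  also have "\<dots> = emeasure (distr T borel \<Phi>) V"
    unfolding \<Phi>_def using cdf_distr_eq_lborel[OF T.finite_borel_measure_axioms atom] by simp
  also have "\<dots> = emeasure T (\<Phi> -` V)"
    using \<Phi>T by (subst emeasure_distr) (auto simp: spT)
  also have "\<dots> = hausdorff1_outer (F ` (B \<inter> \<Phi> -` V))"
    using \<Phi>V by (simp add: TA no_gap)
  also have "\<dots> \<le> hausdorff1_outer (F ` B)" by (intro hausdorff1_outer_mono) auto
  finally have Vle: "emeasure lborel V \<le> hausdorff1_outer (F ` B)" .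
  show ?thesis
  proof (rule that[OF V _ _ Vle])
    show "1-lipschitz_on V G"
      by (rule lipschitz_onI) (use dist_le' G\<Phi> in \<open>auto simp: V_def dist_real_def\<close>)
    show "G ` V = F ` B" using G\<Phi> by (auto simp: V_def image_iff)
  qed
qed

section \<open>Nets in compact subsets of the line and on Lipschitz arcs\<close>

lemma cell_moment_le:
  fixes w :: real
  assumes "a \<le> w" "w \<le> b" "w - a \<le> l" "b - w \<le> l" and p: "0 < p"
  shows "(\<integral>\<^sup>+v. ennreal (\<bar>v - w\<bar> powr p) * indicator {a..b} v \<partial>lborel) \<le> ennreal (2 * l powr (p + 1) / (p
    + 1))"
proof -
  define k where "k t = ennreal (indicator {0..l} t * t powr p)" for t :: real
  have [measurable]: "k \<in> borel_measurable borel" unfolding k_def by measurable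
  have k: "integral\<^sup>N lborel k = ennreal (l powr (p + 1) / (p + 1))"
    unfolding k_def using assms by (intro nn_integral_powr_Icc) auto
  have k1: "(\<integral>\<^sup>+v. k (- w + 1 * v) \<partial>lborel) = integral\<^sup>N lborel k"
    using nn_integral_real_affine[of k 1 "- w"] by simp
  have k2: "(\<integral>\<^sup>+v. k (w + (- 1) * v) \<partial>lborel) = integral\<^sup>N lborel k"
    using nn_integral_real_affine[of k "- 1" w] by simp
  have "(\<integral>\<^sup>+v. ennreal (\<bar>v - w\<bar> powr p) * indicator {a..b} v \<partial>lborel)
      \<le> (\<integral>\<^sup>+v. k (- w + 1 * v) + k (w + (- 1) * v) \<partial>lborel)"
    using assms by (intro nn_integral_mono) (auto simp: k_def indicator_def abs_if)
  also have "\<dots> = integral\<^sup>N lborel k + integral\<^sup>N lborel k"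
    unfolding k1[symmetric] by (subst nn_integral_add) (simp_all add: k1[simplified] k2[simplified])
  also have "\<dots> = ennreal (2 * l powr (p + 1) / (p + 1))"
    using p by (simp add: k flip: ennreal_plus)
  finally show ?thesis .
qed

definition cell :: "real \<Rightarrow> int \<Rightarrow> real set" where
  "cell \<delta> k = {real_of_int k * \<delta>..<(real_of_int k + 1) * \<delta>}"

lemma in_cell_iff: "0 < \<delta> \<Longrightarrow> v \<in> cell \<delta> k \<longleftrightarrow> \<lfloor>v / \<delta>\<rfloor> = k"
  by (auto simp: cell_def floor_eq_iff field_simps)

text \<open>
  A packing bound, used for whole grid cells in the compact set's neighbourhood and for the central
  parts of the cells whose centre is far from the compact set.
\<close>

lemma card_cells_le:
  assumes Z: "finite Z" and \<delta>: "0 < \<delta>" and l: "0 \<le> l"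
    and A: "\<And>k. k \<in> Z \<Longrightarrow> A k \<in> sets borel" "\<And>k. k \<in> Z \<Longrightarrow> A k \<subseteq> cell \<delta> k"
      "\<And>k. k \<in> Z \<Longrightarrow> emeasure lborel (A k) = ennreal l" "\<And>k. k \<in> Z \<Longrightarrow> A k \<subseteq> U"
    and U: "U \<in> sets borel" "emeasure lborel U \<le> ennreal u" "0 \<le> u"
  shows "real (card Z) * l \<le> u"
proof -
  have "disjoint_family_on A Z"
    unfolding disjoint_family_on_def
  proof (intro ballI impI)
    fix j k assume "j \<in> Z" "k \<in> Z" "j \<noteq> k"
    then show "A j \<inter> A k = {}"
      using A(2)[of j] A(2)[of k] in_cell_iff[OF \<delta>, of _ j] in_cell_iff[OF \<delta>, of _ k] by fast
  qed
  then have "(\<Sum>k\<in>Z. emeasure lborel (A k)) = emeasure lborel (\<Union>k\<in>Z. A k)"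
    using A Z by (intro sum_emeasure) auto
  also have "\<dots> \<le> emeasure lborel U" using U(1) by (intro emeasure_mono UN_least A(4)) auto
  also have "\<dots> \<le> ennreal u" by fact
  finally have "ennreal (real (card Z) * l) \<le> ennreal u"
    using A(3) l by (simp add: ennreal_of_nat_eq_real_of_nat flip: ennreal_mult)
  then show ?thesis using U by simp
qed

text \<open>
  The benchmark is the equidistant net of spacing \<open>\<delta>\<close> in an interval of length \<open>a\<close>: it has \<open>a / \<delta>\<close>
  points, and its error with respect to Lebesgue measure is \<open>a * zador_power p * \<delta> powr p\<close>.
\<close>

abbreviation exists_arc_net :: "real \<Rightarrow> 'a::metric_space measure \<Rightarrow> 'a set \<Rightarrow> real \<Rightarrow> real \<Rightarrow> bool" where
  "exists_arc_net p M K a \<delta> \<equiv> \<exists>S. finite S \<and> S \<subseteq> K \<and> real (card S) \<le> a / \<delta> \<and>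
    (\<forall>x\<in>K. \<exists>s\<in>S. dist x s \<le> \<delta>) \<and> moment_on p M K S \<le> ennreal (a * zador_power p * \<delta> powr p)"

text \<open>
  In each cell of a grid of mesh \<open>\<delta>\<close> that meets \<open>V\<close>, choose a point of \<open>V\<close>, within \<open>\<eta> * \<delta>\<close> of the
  centre if possible. For small \<open>\<delta>\<close> all these cells lie in an open set \<open>U\<close> that is hardly larger
  than \<open>V\<close>, which bounds their number. A cell without a point of \<open>V\<close> near its centre has a central
  interval of length \<open>2 * \<eta> * \<delta>\<close> in \<open>U - V\<close>, so there are few such cells and they may be treated
  crudely.
\<close>

theorem compact_real_net:
  fixes V :: "real set"
  assumes V: "compact V" and p: "1 \<le> p" and e: "0 < e"
  shows "\<forall>\<^sub>F \<delta> in at_right 0. exists_arc_net p lborel V (measure lborel V + e) \<delta>"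
proof -
  define z where "z = zador_power p"
  have z: "0 < z" using zador_power_pos[of p] p by (simp add: z_def)
  define M where "M = measure lborel V"
  have M0: "0 \<le> M" by (simp add: M_def)
  have Vb[measurable]: "V \<in> sets borel" using V by (simp add: compact_imp_closed)
  have VM: "emeasure lborel V = ennreal M"
    using emeasure_compact_finite[OF V] by (simp add: M_def emeasure_eq_ennreal_measure less_top)
  \<comment> \<open>In units of \<open>\<delta> powr p\<close>, the cells with a point of \<open>V\<close> near the centre cost at most \<open>\<phi> \<eta>\<close>, the
    others at most the slack \<open>e / 2 * z\<close> by the choice of \<open>r\<close>.\<close>
  define \<phi> where "\<phi> \<eta> = (M + \<eta>) * (2 * (1 / 2 + \<eta>) powr (p + 1) / (p + 1))" for \<eta>
  have "(\<phi> \<longlongrightarrow> (M + 0) * (2 * (1 / 2 + 0) powr (p + 1) / (p + 1))) (at_right 0)"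
    unfolding \<phi>_def using p by (intro tendsto_intros) auto
  also have "(M + 0) * (2 * (1 / 2 + 0) powr (p + 1) / (p + 1)) = M * z"
    by (simp add: z_def zador_power_def powr_divide powr_add)
  finally have "(\<phi> \<longlongrightarrow> M * z) (at_right 0)" .
  then have "\<forall>\<^sub>F \<eta> in at_right 0. \<phi> \<eta> < (M + e / 2) * z"
    using e z by (intro order_tendstoD(2)) auto
  moreover have "\<forall>\<^sub>F \<eta> in at_right 0. 0 < \<eta> \<and> \<eta> < min (1 / 2) e"
    using e by (auto simp: eventually_at_right_field intro!: exI[of _ "min (1 / 2) e"])
  ultimately have "\<forall>\<^sub>F \<eta> in at_right 0. \<phi> \<eta> < (M + e / 2) * z \<and> 0 < \<eta> \<and> \<eta> < min (1 / 2) e"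
    by eventually_elim auto
  then obtain \<eta> where \<eta>: "\<phi> \<eta> < (M + e / 2) * z" "0 < \<eta>" "\<eta> < 1 / 2" "\<eta> < e"
    using eventually_happens'[OF trivial_limit_at_right_real] by force
  define r where "r = min \<eta> (\<eta> * (z * (p + 1) * e / 2))"
  have r: "0 < r" "r \<le> \<eta>" "r \<le> \<eta> * (z * (p + 1) * e / 2)"
    using \<eta> z p e by (auto simp: r_def)
  obtain U where U: "open U" "V \<subseteq> U" "emeasure lborel (U - V) < ennreal r"
    using outer_regular_lborel[OF Vb r(1)] by blast
  have Ub[measurable]: "U \<in> sets borel" using U by simp
  have "emeasure lborel U = emeasure lborel V + emeasure lborel (U - V)"
    using U by (subst plus_emeasure) (auto simp: Un_absorb1)
  also have "\<dots> \<le> ennreal M + ennreal r" using U VM by (intro add_mono) auto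
  finally have UM: "emeasure lborel U \<le> ennreal (M + r)" using M0 r by simp
  have "\<forall>\<^sub>F \<delta> in at_right 0. \<forall>x\<in>V. \<forall>y\<in>- U. 2 * \<delta> < dist x y"
    using V U by (intro eventually_compact_closed_far) (auto simp: closed_def)
  then show ?thesis
    using eventually_at_right_less[of 0]
  proof eventually_elim
    fix \<delta> :: real assume far: "\<forall>x\<in>V. \<forall>y\<in>- U. 2 * \<delta> < dist x y" and \<delta>: "0 < \<delta>"
    define Z where "Z = (\<lambda>v. \<lfloor>v / \<delta>\<rfloor>) ` V"
    obtain b where b: "\<And>v. v \<in> V \<Longrightarrow> \<bar>v\<bar> \<le> b"
      using compact_imp_bounded[OF V] by (auto simp: bounded_iff)
    have "Z \<subseteq> {\<lfloor>- b / \<delta>\<rfloor>..\<lfloor>b / \<delta>\<rfloor>}"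
    proof
      fix k assume "k \<in> Z"
      then obtain v where v: "v \<in> V" "k = \<lfloor>v / \<delta>\<rfloor>" by (auto simp: Z_def)
      have "- b / \<delta> \<le> v / \<delta>" "v / \<delta> \<le> b / \<delta>" using b[OF v(1)] \<delta> divide_right_mono[of "- b" v \<delta>]
        divide_right_mono[of v b \<delta>] by auto
      then show "k \<in> {\<lfloor>- b / \<delta>\<rfloor>..\<lfloor>b / \<delta>\<rfloor>}" unfolding v(2) by (auto intro: floor_mono)
    qed
    then have Z: "finite Z" by (rule finite_subset) simp
    define c where "c k = (real_of_int k + 1 / 2) * \<delta>" for k
    define good where "good k \<longleftrightarrow> (\<exists>v\<in>V \<inter> cell \<delta> k. \<bar>v - c k\<bar> \<le> \<eta> * \<delta>)" for k
    have "\<exists>w. w \<in> V \<inter> cell \<delta> k \<and> (good k \<longrightarrow> \<bar>w - c k\<bar> \<le> \<eta> * \<delta>)" if "k \<in> Z" for k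
    proof (cases "good k")
      case True then show ?thesis by (auto simp: good_def)
    next
      case False
      then show ?thesis using that in_cell_iff[OF \<delta>] by (auto simp: Z_def)
    qed
    then obtain w where w: "\<And>k. k \<in> Z \<Longrightarrow> w k \<in> V" "\<And>k. k \<in> Z \<Longrightarrow> w k \<in> cell \<delta> k"
      "\<And>k. k \<in> Z \<Longrightarrow> good k \<Longrightarrow> \<bar>w k - c k\<bar> \<le> \<eta> * \<delta>"
      by (metis IntD1 IntD2)
    define W where "W = w ` Z"
    have cellU: "cell \<delta> k \<subseteq> U" if "k \<in> Z" for k
    proof
      fix y assume y: "y \<in> cell \<delta> k"
      have "dist (w k) y \<le> 2 * \<delta>"
        using w(2)[OF that] y \<delta> by (auto simp: cell_def dist_real_def algebra_simps)
      then show "y \<in> U" using far w(1)[OF that] by force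
    qed
    have cZ: "real (card Z) * \<delta> \<le> M + r"
      by (rule card_cells_le[OF Z \<delta>, where A="cell \<delta>" and U=U])
         (use \<delta> cellU UM M0 r in \<open>auto simp: cell_def algebra_simps\<close>)
    define Bad where "Bad = {k\<in>Z. \<not> good k}"
    have cBad: "real (card Bad) * (2 * \<eta> * \<delta>) \<le> r"
    proof (rule card_cells_le[OF _ \<delta>, where A="\<lambda>k. {c k - \<eta> * \<delta><..<c k + \<eta> * \<delta>}" and U="U - V"])
      fix k assume k: "k \<in> Bad"
      have "\<eta> * \<delta> < 1 / 2 * \<delta>" using \<eta> \<delta> by (intro mult_strict_right_mono) auto
      then show sub: "{c k - \<eta> * \<delta><..<c k + \<eta> * \<delta>} \<subseteq> cell \<delta> k"
        by (auto simp: cell_def c_def algebra_simps)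
      show "{c k - \<eta> * \<delta><..<c k + \<eta> * \<delta>} \<subseteq> U - V"
      proof
        fix v assume v: "v \<in> {c k - \<eta> * \<delta><..<c k + \<eta> * \<delta>}"
        then have "\<bar>v - c k\<bar> \<le> \<eta> * \<delta>" by auto
        then have "v \<notin> V" using k sub v by (auto simp: Bad_def good_def)
        then show "v \<in> U - V" using cellU[of k] k sub v by (auto simp: Bad_def)
      qed
    qed (use Z \<eta> \<delta> U r in \<open>auto simp: Bad_def\<close>)
    define l where "l k = (if good k then (1 / 2 + \<eta>) * \<delta> else \<delta>)" for k
    have dWle: "infdist v W \<le> \<bar>v - w \<lfloor>v / \<delta>\<rfloor>\<bar>" if "v \<in> V" for v
      using that by (intro infdist_le[of "w \<lfloor>v / \<delta>\<rfloor>" W v, unfolded dist_real_def]) (auto simp: W_def Z_def)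
    have "moment_on p lborel V W
        \<le> (\<integral>\<^sup>+v. (\<Sum>k\<in>Z. ennreal (\<bar>v - w k\<bar> powr p) * indicator {real_of_int k * \<delta>..(real_of_int k
          + 1) * \<delta>} v) \<partial>lborel)"
    proof (rule nn_integral_mono)
      fix v
      show "ennreal (infdist v W powr p) * indicator V v \<le>
        (\<Sum>k\<in>Z. ennreal (\<bar>v - w k\<bar> powr p) * indicator {real_of_int k * \<delta>..(real_of_int k + 1) * \<delta>} v)"
      proof (cases "v \<in> V")
        case True
        define k where "k = \<lfloor>v / \<delta>\<rfloor>"
        have k: "k \<in> Z" "v \<in> cell \<delta> k" using True in_cell_iff[OF \<delta>] by (auto simp: k_def Z_def)
        have "ennreal (infdist v W powr p) \<le> ennreal (\<bar>v - w k\<bar> powr p) * indicator {real_of_int k *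
          \<delta>..(real_of_int k + 1) * \<delta>} v"
          using k dWle[OF True] p by (auto simp: cell_def k_def intro!: ennreal_leI powr_mono2 infdist_nonneg)
        also have "\<dots> \<le> (\<Sum>k\<in>Z. ennreal (\<bar>v - w k\<bar> powr p) * indicator {real_of_int k * \<delta>..(real_of_int k
          + 1) * \<delta>} v)"
          using Z k by (intro member_le_sum) auto
        finally show ?thesis using True by simp
      qed simp
    qed
    also have "\<dots> = (\<Sum>k\<in>Z. (\<integral>\<^sup>+v. ennreal (\<bar>v - w k\<bar> powr p) * indicator {real_of_int k * \<delta>..(real_of_int
      k + 1) * \<delta>} v \<partial>lborel))"
      by (rule nn_integral_sum) simp
    also have "\<dots> \<le> (\<Sum>k\<in>Z. ennreal (2 * l k powr (p + 1) / (p + 1)))"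
    proof (intro sum_mono cell_moment_le)
      fix k assume k: "k \<in> Z"
      show "real_of_int k * \<delta> \<le> w k" "w k \<le> (real_of_int k + 1) * \<delta>"
        using w(2)[OF k] by (auto simp: cell_def)
      show "w k - real_of_int k * \<delta> \<le> l k" "(real_of_int k + 1) * \<delta> - w k \<le> l k"
        using w(2,3)[OF k] by (auto simp: cell_def l_def c_def abs_le_iff algebra_simps)
    qed (use p in auto)
    also have "\<dots> = ennreal (\<Sum>k\<in>Z. 2 * l k powr (p + 1) / (p + 1))"
      using p by (intro sum_ennreal) auto
    also have "\<dots> \<le> ennreal ((M + e) * z * \<delta> powr p)"
    proof (rule ennreal_leI)
      have dp: "\<delta> powr (p + 1) = \<delta> * \<delta> powr p" using \<delta> by (simp add: powr_add)
      have "(\<Sum>k\<in>Z. 2 * l k powr (p + 1) / (p + 1)) \<le>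
          (\<Sum>k\<in>Z. 2 * ((1 / 2 + \<eta>) * \<delta>) powr (p + 1) / (p + 1)
            + (if k \<in> Bad then 2 * \<delta> powr (p + 1) / (p + 1) else 0))"
        using p by (intro sum_mono) (auto simp: l_def Bad_def)
      also have "\<dots> = real (card Z) * (2 * ((1 / 2 + \<eta>) * \<delta>) powr (p + 1) / (p + 1))
          + real (card Bad) * (2 * \<delta> powr (p + 1) / (p + 1))"
      proof -
        have "Z \<inter> {k. k \<in> Bad} = Bad" by (auto simp: Bad_def)
        then show ?thesis using Z by (simp add: sum.distrib sum.If_cases)
      qed
      also have "((1 / 2 + \<eta>) * \<delta>) powr (p + 1) = (1 / 2 + \<eta>) powr (p + 1) * (\<delta> * \<delta> powr p)"
        using \<eta> \<delta> by (simp add: powr_mult dp)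
      also have "real (card Z) * (2 * ((1 / 2 + \<eta>) powr (p + 1) * (\<delta> * \<delta> powr p)) / (p + 1))
          = (real (card Z) * \<delta>) * (2 * (1 / 2 + \<eta>) powr (p + 1) / (p + 1)) * \<delta> powr p"
        by simp
      also have "\<dots> \<le> (M + \<eta>) * (2 * (1 / 2 + \<eta>) powr (p + 1) / (p + 1)) * \<delta> powr p"
        using cZ r p by (intro mult_right_mono) auto
      also have "\<dots> \<le> (M + e / 2) * z * \<delta> powr p"
        using \<eta>(1) by (intro mult_right_mono) (auto simp: \<phi>_def)
      also have "real (card Bad) * (2 * \<delta> powr (p + 1) / (p + 1))
          = (real (card Bad) * (2 * \<eta> * \<delta>)) * (1 / (\<eta> * (p + 1))) * \<delta> powr p"
        using \<eta> by (simp add: dp)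
      also have "\<dots> \<le> (\<eta> * (z * (p + 1) * e / 2)) * (1 / (\<eta> * (p + 1))) * \<delta> powr p"
        using \<eta> p by (intro mult_right_mono order_trans[OF cBad r(3)]) auto
      also have "(\<eta> * (z * (p + 1) * e / 2)) * (1 / (\<eta> * (p + 1))) = e / 2 * z"
        using \<eta> p by (simp add: divide_simps)
      also have "(M + e / 2) * z * \<delta> powr p + e / 2 * z * \<delta> powr p = (M + e) * z * \<delta> powr p"
        by (simp add: algebra_simps)
      finally show "(\<Sum>k\<in>Z. 2 * l k powr (p + 1) / (p + 1)) \<le> (M + e) * z * \<delta> powr p" by simp
    qed
    finally have "moment_on p lborel V W \<le> ennreal ((M + e) * z * \<delta> powr p)" .
    moreover have "real (card W) \<le> (M + e) / \<delta>"
    proof -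
      have "real (card W) \<le> real (card Z)" unfolding W_def using Z by (intro of_nat_mono card_image_le)
      also have "\<dots> \<le> (M + r) / \<delta>" using cZ \<delta> by (simp add: field_simps)
      also have "\<dots> \<le> (M + e) / \<delta>" using r \<eta> \<delta> by (intro divide_right_mono) auto
      finally show ?thesis .
    qed
    moreover have "\<forall>v\<in>V. \<exists>w\<in>W. dist v w \<le> \<delta>"
    proof
      fix v assume v: "v \<in> V"
      define k where "k = \<lfloor>v / \<delta>\<rfloor>"
      have k: "k \<in> Z" "v \<in> cell \<delta> k" using v in_cell_iff[OF \<delta>] by (auto simp: k_def Z_def)
      then have "dist v (w k) \<le> \<delta>"
        using w(2)[OF k(1)] by (auto simp: cell_def dist_real_def algebra_simps)
      then show "\<exists>w\<in>W. dist v w \<le> \<delta>" using k by (auto simp: W_def)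
    qed
    ultimately show "exists_arc_net p lborel V (measure lborel V + e) \<delta>"
      using w(1) Z by (intro exI[of _ W]) (auto simp: W_def M_def z_def)
  qed
qed

text \<open>
  The image under \<open>G\<close> of a net in \<open>V\<close>, where \<open>G\<close> and \<open>V\<close> are the reparametrization. Since \<open>G\<close> is
  1-Lipschitz, distances decrease, and \<open>H\<close> on the arc is at most the push-forward of Lebesgue
  measure on \<open>V\<close>.
\<close>

theorem lipschitz_arc_net:
  fixes F :: "real \<Rightarrow> 'a::metric_space"
  assumes B: "compact B" and F: "L-lipschitz_on B F" and inj: "inj_on F B"
    and h: "hausdorff1_outer (F ` B) = ennreal h" "0 \<le> h" and p: "1 \<le> p" and e: "0 < e"
  shows "\<forall>\<^sub>F \<delta> in at_right 0. exists_arc_net p hausdorff1 (F ` B) (h + e) \<delta>"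
proof -
  define K where "K = F ` B"
  have "compact K" unfolding K_def
    by (intro compact_continuous_image lipschitz_on_continuous_on[OF F] B)
  then have Kb[measurable]: "K \<in> sets borel" by (simp add: compact_imp_closed)
  obtain V :: "real set" and G where V: "compact V" "1-lipschitz_on V G" "G ` V = K" "emeasure lborel V
    \<le> ennreal h"
    using lipschitz_arc_reparametrization[OF B F inj] h by (auto simp: K_def)
  have Vb[measurable]: "V \<in> sets borel" using V(1) by (simp add: compact_imp_closed)
  have Vh: "measure lborel V \<le> h" using V(4) h(2) by (simp add: measure_def enn2real_leI)
  define G' where "G' v = (if v \<in> V then G v else G undefined)" for v
  have "G \<in> borel_measurable (restrict_space borel V)"
    by (intro borel_measurable_continuous_on_restrict lipschitz_on_continuous_on[OF V(2)])
  then have G'[measurable]: "G' \<in> borel_measurable borel"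
    unfolding G'_def by (subst (asm) measurable_restrict_space_iff[where c="G undefined"]) auto
  define D where "D = distr (density lborel (indicator V)) borel G'"
  have D: "density hausdorff1 (indicator K) \<le> D"
  proof (subst le_measure)
    show "sets (density hausdorff1 (indicator K)) = sets D" by (simp add: D_def)
    show "\<forall>A\<in>sets (density hausdorff1 (indicator K)). emeasure (density hausdorff1 (indicator K)) A
      \<le> emeasure D A"
    proof
      fix A :: "'a set" assume "A \<in> sets (density hausdorff1 (indicator K))"
      then have A[measurable]: "A \<in> sets borel" by simp
      have G'A[measurable]: "G' -` A \<in> sets borel" using measurable_sets_borel[OF G' A] .
      have KA: "K \<inter> A = G ` (V \<inter> G' -` A)" using V(3) by (auto simp: G'_def)
      have "emeasure (density hausdorff1 (indicator K)) A = hausdorff1_outer (K \<inter> A)"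
        by (simp add: emeasure_density emeasure_hausdorff1 flip: indicator_inter_arith)
      also have "\<dots> \<le> ennreal 1 * hausdorff1_outer (V \<inter> G' -` A)"
        unfolding KA by (intro hausdorff1_outer_lipschitz_image lipschitz_on_subset[OF V(2)]) auto
      also have "\<dots> = emeasure lborel (V \<inter> G' -` A)"
        using emeasure_hausdorff1[of "V \<inter> G' -` A"] by (simp add: hausdorff1_eq_lborel)
      also have "\<dots> = emeasure D A"
        unfolding D_def by (subst emeasure_distr) (auto simp: emeasure_density
          simp flip: indicator_inter_arith)
      finally show "emeasure (density hausdorff1 (indicator K)) A \<le> emeasure D A" .
    qed
  qed
  from compact_real_net[OF V(1) p e] eventually_at_right_less[of 0]
  have "\<forall>\<^sub>F \<delta> in at_right 0. exists_arc_net p hausdorff1 K (h + e) \<delta>"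
  proof eventually_elim
    fix \<delta> :: real assume "exists_arc_net p lborel V (measure lborel V + e) \<delta>" and \<delta>: "0 < \<delta>"
    then obtain W where W: "finite W" "W \<subseteq> V" "real (card W) \<le> (measure lborel V + e) / \<delta>"
      "\<forall>v\<in>V. \<exists>w\<in>W. dist v w \<le> \<delta>"
      "moment_on p lborel V W
      \<le> ennreal ((measure lborel V + e) * zador_power p * \<delta> powr p)" by blast
    define S where "S = G ` W"
    have dS: "infdist (G v) S \<le> infdist v W" if v: "v \<in> V" for v
    proof -
      have "W \<noteq> {}" using W(4) v by blast
      then obtain w where w: "w \<in> W" "infdist v W = dist v w"
        using finite_infdist_attained[OF W(1)] by metis
      have "infdist (G v) S \<le> dist (G v) (G w)" using w by (intro infdist_le) (simp add: S_def)
      also have "\<dots> \<le> 1 * dist v w" using v w W(2) by (intro lipschitz_onD[OF V(2)]) auto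
      finally show ?thesis using w by simp
    qed
    have "real (card S) \<le> (h + e) / \<delta>"
    proof -
      have "real (card S) \<le> real (card W)" unfolding S_def using W by (intro of_nat_mono card_image_le)
      also have "\<dots> \<le> (measure lborel V + e) / \<delta>" by fact
      also have "\<dots> \<le> (h + e) / \<delta>" using Vh \<delta> by (intro divide_right_mono) auto
      finally show ?thesis .
    qed
    moreover have "\<forall>x\<in>K. \<exists>s\<in>S. dist x s \<le> \<delta>"
    proof
      fix x assume "x \<in> K"
      then obtain v where v: "v \<in> V" "x = G v" using V(3) by auto
      then obtain w where w: "w \<in> W" "dist v w \<le> \<delta>" using W(4) by auto
      have "dist x (G w) \<le> 1 * dist v w" unfolding v(2) using v w W(2) by (intro lipschitz_onD[OF V(2)]) auto
      then have "dist x (G w) \<le> \<delta>" using w by simp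
      then show "\<exists>s\<in>S. dist x s \<le> \<delta>" using w by (auto simp: S_def)
    qed
    moreover have "moment_on p hausdorff1 K S
      \<le> ennreal ((h + e) * zador_power p * \<delta> powr p)"
    proof -
      have "moment_on p hausdorff1 K S
          = (\<integral>\<^sup>+x. ennreal (infdist x S powr p) \<partial>density hausdorff1 (indicator K))"
        by (subst nn_integral_density) (auto simp: mult.commute)
      also have "\<dots> \<le> (\<integral>\<^sup>+x. ennreal (infdist x S powr p) \<partial>D)"
        using D by (intro nn_integral_mono_measure) (auto simp: D_def)
      also have "\<dots> = (\<integral>\<^sup>+v. ennreal (infdist (G' v) S powr p) * indicator V v \<partial>lborel)"
        unfolding D_def by (subst nn_integral_distr) (auto simp: nn_integral_density mult.commute)
      also have "\<dots> \<le> moment_on p lborel V W"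
        using dS p by (intro nn_integral_mono)
          (auto simp: G'_def indicator_def intro!: ennreal_leI powr_mono2 infdist_nonneg)
      also have "\<dots> \<le> ennreal ((measure lborel V + e) * zador_power p * \<delta> powr p)" by fact
      also have "\<dots> \<le> ennreal ((h + e) * zador_power p * \<delta> powr p)"
        using Vh zador_power_pos[of p] p by (intro ennreal_leI mult_right_mono) auto
      finally show ?thesis .
    qed
    ultimately show "exists_arc_net p hausdorff1 K (h + e) \<delta>"
      using W V(3) by (intro exI[of _ S]) (auto simp: S_def)
  qed
  then show ?thesis by (simp add: K_def)
qed

section \<open>Decomposition of a rectifiable measure\<close>

text \<open>
  The smallest parameter \<open>s z\<close> at which \<open>F\<close> takes the value \<open>z\<close> is a Borel function of \<open>z\<close>, since
  its sublevel sets are images of compact sets. A compact subset \<open>B\<close> of the set \<open>D\<close> of smallest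
  parameters of points of \<open>P\<close>, chosen by inner regularity of the push-forward of \<open>\<mu>\<close> under \<open>s\<close>, has
  the required properties: \<open>s\<close> inverts \<open>F\<close> on it.
\<close>

lemma injective_compact_piece:
  fixes F :: "real \<Rightarrow> 'a::metric_space" and \<mu> :: "'a measure"
  assumes A: "compact A" and F: "continuous_on A F" and P[measurable]: "P \<in> sets borel" and PF: "P \<subseteq> F ` A"
    and \<mu>: "sets \<mu> = sets borel" "finite_measure \<mu>" and e: "0 < e"
  obtains B where "compact B" "B \<subseteq> A" "inj_on F B" "F ` B \<subseteq> P" "measure \<mu> (P - F ` B) < e"
proof -
  interpret finite_measure \<mu> by fact
  have sp: "space \<mu> = UNIV" using sets_eq_imp_space_eq[OF \<mu>(1)] by simp
  define K where "K = F ` A"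
  have Kcl: "compact (F ` (A \<inter> {..t}))" for t
    using A F by (intro compact_continuous_image compact_Int_closed) (auto intro: continuous_on_subset)
  have "compact K" unfolding K_def by (intro compact_continuous_image F A)
  then have Kb[measurable]: "K \<in> sets borel" by (simp add: compact_imp_closed)
  have Ab[measurable]: "A \<in> sets borel" using A by (simp add: compact_imp_closed)
  define s where "s z = (if z \<in> K then Inf (A \<inter> F -` {z}) else 0)" for z
  have bdd: "bdd_below (A \<inter> F -` {z})" for z
    using compact_imp_bounded[OF A] by (meson bounded_imp_bdd_below bounded_subset inf_le1)
  have s_in: "s z \<in> A \<and> F (s z) = z" if "z \<in> K" for z
  proof -
    have "A \<inter> F -` {z} \<noteq> {}" using that by (auto simp: K_def)
    moreover have "closed (A \<inter> F -` {z})"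
      using F compact_imp_closed[OF A] by (intro continuous_closed_preimage) auto
    ultimately have "Inf (A \<inter> F -` {z}) \<in> A \<inter> F -` {z}" using bdd by (intro closed_contains_Inf)
    then show ?thesis using that by (auto simp: s_def)
  qed
  have s_le: "s (F x) \<le> x" if "x \<in> A" for x
    using that bdd[of "F x"] by (auto simp: s_def K_def intro!: cInf_lower)
  have s[measurable]: "s \<in> borel_measurable borel"
    unfolding borel_measurable_iff_le
  proof
    fix t
    have "{z \<in> space borel. s z \<le> t} = F ` (A \<inter> {..t}) \<union> (if 0 \<le> t then - K else {})"
    proof (intro set_eqI iffI)
      fix z assume z: "z \<in> {z \<in> space borel. s z \<le> t}"
      show "z \<in> F ` (A \<inter> {..t}) \<union> (if 0 \<le> t then - K else {})"
      proof (cases "z \<in> K")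
        case True
        then have "z = F (s z)" "s z \<in> A \<inter> {..t}" using z s_in[of z] by auto
        then show ?thesis by blast
      next
        case False
        then show ?thesis using z by (auto simp: s_def)
      qed
    next
      fix z assume z: "z \<in> F ` (A \<inter> {..t}) \<union> (if 0 \<le> t then - K else {})"
      then show "z \<in> {z \<in> space borel. s z \<le> t}"
        using s_le by (force simp: s_def split: if_splits)
    qed
    moreover have "F ` (A \<inter> {..t}) \<in> sets borel" using Kcl[of t] by (simp add: compact_imp_closed)
    ultimately show "{z \<in> space borel. s z \<le> t} \<in> sets borel" by simp
  qed
  define F' where "F' x = (if x \<in> A then F x else F undefined)" for x
  have "F \<in> borel_measurable (restrict_space borel A)"
    by (rule borel_measurable_continuous_on_restrict[OF F])
  then have F'[measurable]: "F' \<in> borel_measurable borel"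
    unfolding F'_def by (subst (asm) measurable_restrict_space_iff[where c="F undefined"]) auto
  define D where "D = {x\<in>A. F x \<in> P \<and> s (F x) = x}"
  have "D = A \<inter> {x\<in>space borel. F' x \<in> P \<and> s (F' x) = x}" by (auto simp: D_def F'_def)
  moreover have "{x\<in>space borel. F' x \<in> P \<and> s (F' x) = x} \<in> sets borel" by measurable
  ultimately have Db: "D \<in> sets borel" by auto
  define N where "N = distr (density \<mu> (indicator P)) borel s"
  have s\<mu>: "s \<in> measurable (density \<mu> (indicator P)) borel"
    using s by (simp add: measurable_cong_sets[OF \<mu>(1) refl])
  have N: "emeasure N C = emeasure \<mu> (P \<inter> s -` C)" if C: "C \<in> sets borel" for C
  proof -
    have "s -` C \<in> sets \<mu>" using measurable_sets_borel[OF s C] \<mu>(1) by simp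
    then show ?thesis
      unfolding N_def using C P \<mu>(1) s\<mu>
      by (subst emeasure_distr) (auto simp: sp emeasure_density simp flip: indicator_inter_arith)
  qed
  have inner: "emeasure N D = (SUP C\<in>{C. C \<subseteq> D \<and> compact C}. emeasure N C)"
  proof (rule inner_regular[OF _ _ Db])
    show "sets N = sets borel" by (simp add: N_def)
    show "emeasure N (space N) \<noteq> \<infinity>" using N[of UNIV] by (simp add: N_def)
  qed
  have "\<exists>B\<in>{C. C \<subseteq> D \<and> compact C}. emeasure N D < emeasure N B + ennreal e"
  proof (rule SUP_approx_ennreal[OF e _ inner])
    show "{C. C \<subseteq> D \<and> compact C} \<noteq> {}" by blast
    show "emeasure N D \<noteq> \<infinity>" using N[OF Db] by simp
  qed
  then obtain B where B: "B \<subseteq> D" "compact B" "emeasure N D < emeasure N B + ennreal e" by blast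
  have PD: "P \<inter> s -` D = P"
    using s_in PF by (auto simp: D_def K_def)
  have Bb: "B \<in> sets borel" using B by (simp add: compact_imp_closed)
  have FB: "P \<inter> s -` B \<subseteq> F ` B" using s_in PF by (force simp: K_def)
  have "compact (F ` B)"
    using B D_def by (intro compact_continuous_image continuous_on_subset[OF F]) auto
  then have FBb: "F ` B \<in> sets \<mu>" using \<mu> by (simp add: compact_imp_closed)
  have FBP: "F ` B \<subseteq> P" using B by (auto simp: D_def)
  have "emeasure \<mu> P < emeasure \<mu> (P \<inter> s -` B) + ennreal e"
    using B(3) N[OF Db] N[OF Bb] PD by simp
  also have "\<dots> \<le> emeasure \<mu> (F ` B) + ennreal e"
    using FB FBb by (intro add_right_mono emeasure_mono)
  finally have "measure \<mu> P < measure \<mu> (F ` B) + e"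
    using e by (simp add: emeasure_eq_measure ennreal_less_iff flip: ennreal_plus)
  moreover have "measure \<mu> (P - F ` B) = measure \<mu> P - measure \<mu> (F ` B)"
    using FBb FBP \<mu> by (intro finite_measure_Diff) auto
  ultimately have "measure \<mu> (P - F ` B) < e" by simp
  moreover have "inj_on F B"
    using B(1) by (intro inj_on_inverseI[of B s]) (auto simp: D_def)
  ultimately show ?thesis using B FBP D_def by (intro that[of B]) auto
qed

text \<open>
  Completeness of the space permits to extend the maps to the closures of their domains, which are
  then cut into bounded parts. Images of compact sets are compact, hence Borel.
\<close>

lemma rectifiable_compact_images:
  fixes \<mu> :: "'a::polish_space measure"
  assumes "countably_1_rectifiable \<mu>"
  obtains A :: "nat \<Rightarrow> real set" and F L where "\<And>k. compact (A k)" "\<And>k. (L k)-lipschitz_on (A k) (F k)"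
    "AE x in \<mu>. x \<in> (\<Union>k. F k ` A k)"
proof -
  obtain A0 :: "nat \<Rightarrow> real set" and F0 :: "nat \<Rightarrow> real \<Rightarrow> 'a"
    where A0: "\<And>i. \<exists>L. L-lipschitz_on (A0 i) (F0 i)" "AE x in \<mu>. x \<in> (\<Union>i. F0 i ` A0 i)"
    using assms unfolding countably_1_rectifiable_def by blast
  obtain L0 where L0: "\<And>i. (L0 i)-lipschitz_on (A0 i) (F0 i)" using A0(1) by metis
  then have "\<forall>i. \<exists>g. (L0 i)-lipschitz_on (closure (A0 i)) g \<and> (\<forall>x\<in>A0 i. g x = F0 i x)"
    using lipschitz_extend_closure by blast
  then obtain F1 where F1: "\<And>i. (L0 i)-lipschitz_on (closure (A0 i)) (F1 i)"
    "\<And>i x. x \<in> A0 i \<Longrightarrow> F1 i x = F0 i x"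
    by metis
  define A where "A k = (case prod_decode k of (i, n) \<Rightarrow> closure (A0 i) \<inter> {- real n..real n})" for k
  define F where "F k = F1 (fst (prod_decode k))" for k
  define L where "L k = L0 (fst (prod_decode k))" for k
  show ?thesis
  proof (rule that[of A L F])
    show "compact (A k)" for k
      by (cases "prod_decode k") (simp add: A_def closed_Int_compact)
    show "(L k)-lipschitz_on (A k) (F k)" for k
    proof (cases "prod_decode k")
      case (Pair i n)
      then have "A k \<subseteq> closure (A0 i)" by (simp add: A_def)
      with F1(1)[of i] show ?thesis using Pair by (simp add: L_def F_def) (rule lipschitz_on_subset)
    qed
    show "AE x in \<mu>. x \<in> (\<Union>k. F k ` A k)"
      using A0(2)
    proof eventually_elim
      fix x assume "x \<in> (\<Union>i. F0 i ` A0 i)"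
      then obtain i t where t: "t \<in> A0 i" "x = F0 i t" by auto
      obtain n :: nat where n: "\<bar>t\<bar> \<le> n" using real_arch_simple by blast
      have "t \<in> A (prod_encode (i, n))" using t n closure_subset[of "A0 i"] by (auto simp: A_def)
      moreover have "x = F (prod_encode (i, n)) t" using t F1(2) by (simp add: F_def)
      ultimately show "x \<in> (\<Union>k. F k ` A k)" by blast
    qed
  qed
qed

abbreviation exists_net :: "real \<Rightarrow> 'a::metric_space measure \<Rightarrow> 'a set \<Rightarrow> real \<Rightarrow> real \<Rightarrow> real \<Rightarrow> bool" where
  "exists_net p \<mu> K a b \<delta> \<equiv> \<exists>S. finite S \<and> S \<noteq> {} \<and> real (card S) \<le> a / \<delta> \<and>
    moment_on p \<mu> K S \<le> ennreal (b * \<delta> powr p)"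

text \<open>
  Nets of mesh proportional to \<open>\<delta>\<close> with their cost: as \<open>\<delta>\<close> tends to \<open>0\<close>, \<open>a / \<delta>\<close> points yield the
  \<open>p\<close>-th moment \<open>b * \<delta> powr p\<close> on \<open>K\<close>. Then \<open>N\<close> points yield \<open>b * a powr p / N powr p\<close>; the
  parameters \<open>a\<close> and \<open>b\<close> are additive in \<open>K\<close>, unlike this product.
\<close>

definition nets :: "real \<Rightarrow> 'a::metric_space measure \<Rightarrow> 'a set \<Rightarrow> real \<Rightarrow> real \<Rightarrow> bool" where
  "nets p \<mu> K a b \<longleftrightarrow> (\<forall>\<^sub>F \<delta> in at_right 0. exists_net p \<mu> K a b \<delta>)"

lemma nets_mono:
  assumes "nets p \<mu> K a b" "a \<le> a'" "b \<le> b'"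
  shows "nets p \<mu> K a' b'"
  using assms(1)[unfolded nets_def] eventually_at_right_less[of 0] unfolding nets_def
proof eventually_elim
  fix \<delta> :: real assume *: "exists_net p \<mu> K a b \<delta>" and \<delta>: "0 < \<delta>"
  then obtain S where S: "finite S" "S \<noteq> {}" "real (card S) \<le> a / \<delta>"
    "moment_on p \<mu> K S \<le> ennreal (b * \<delta> powr p)" by blast
  have "a / \<delta> \<le> a' / \<delta>" using assms \<delta> by (intro divide_right_mono) auto
  moreover have "ennreal (b * \<delta> powr p) \<le> ennreal (b' * \<delta> powr p)"
    using assms by (intro ennreal_leI mult_right_mono) auto
  ultimately show "exists_net p \<mu> K a' b' \<delta>"
    using S(1,2) order_trans[OF S(3)] order_trans[OF S(4)] by blast
qed

lemma nets_UN:
  fixes \<mu> :: "'a::metric_space measure"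
  assumes J: "finite J" "J \<noteq> {}" and \<mu>: "sets \<mu> = sets borel" and K: "\<And>j. j \<in> J \<Longrightarrow> K j \<in> sets borel"
    and n: "\<And>j. j \<in> J \<Longrightarrow> nets p \<mu> (K j) (a j) (b j)" and b: "\<And>j. j \<in> J \<Longrightarrow> 0 \<le> b j" and p: "0 \<le> p"
  shows "nets p \<mu> (\<Union>j\<in>J. K j) (\<Sum>j\<in>J. a j) (\<Sum>j\<in>J. b j)"
proof -
  have "\<forall>\<^sub>F \<delta> in at_right 0. \<forall>j\<in>J. \<exists>S. finite S \<and> S \<noteq> {} \<and> real (card S) \<le> a j / \<delta> \<and>
     moment_on p \<mu> (K j) S \<le> ennreal (b j * \<delta> powr p)"
  proof (intro eventually_ball_finite[OF J(1)] ballI)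
    fix j assume "j \<in> J"
    from n[OF this] show "\<forall>\<^sub>F \<delta> in at_right 0. \<exists>S. finite S \<and> S \<noteq> {} \<and> real (card S) \<le> a j / \<delta> \<and>
     moment_on p \<mu> (K j) S \<le> ennreal (b j * \<delta> powr p)"
      unfolding nets_def .
  qed
  then show ?thesis
    unfolding nets_def
  proof eventually_elim
    fix \<delta> :: real
    assume "\<forall>j\<in>J. \<exists>S. finite S \<and> S \<noteq> {} \<and> real (card S) \<le> a j / \<delta> \<and>
     moment_on p \<mu> (K j) S \<le> ennreal (b j * \<delta> powr p)"
    from this[unfolded bchoice_iff]
    obtain S where "\<forall>j\<in>J. finite (S j) \<and> S j \<noteq> {} \<and> real (card (S j)) \<le> a j / \<delta> \<and>
     moment_on p \<mu> (K j) (S j) \<le> ennreal (b j * \<delta> powr p)" by blast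
    then have S: "\<And>j. j \<in> J \<Longrightarrow> finite (S j)" "\<And>j. j \<in> J \<Longrightarrow> S j \<noteq> {}"
      "\<And>j. j \<in> J \<Longrightarrow> real (card (S j)) \<le> a j / \<delta>"
      "\<And>j. j \<in> J \<Longrightarrow> moment_on p \<mu> (K j) (S j) \<le> ennreal (b j * \<delta> powr p)"
      by blast+
    define U where "U = (\<Union>j\<in>J. S j)"
    have "real (card U) \<le> (\<Sum>j\<in>J. real (card (S j)))"
      unfolding U_def using card_UN_le[OF J(1), of S] by (simp flip: of_nat_sum)
    also have "\<dots> \<le> (\<Sum>j\<in>J. a j / \<delta>)" by (intro sum_mono S)
    finally have c: "real (card U) \<le> (\<Sum>j\<in>J. a j) / \<delta>" by (simp add: sum_divide_distrib)
    have m: "(\<lambda>x. ennreal (infdist x S powr p) * indicator (K j) x) \<in> borel_measurable \<mu>" if "j \<in> J" for S j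
      using K[OF that] unfolding measurable_cong_sets[OF \<mu> refl] by measurable
    have "moment_on p \<mu> (\<Union>j\<in>J. K j) U
      \<le> (\<integral>\<^sup>+x. (\<Sum>j\<in>J. ennreal (infdist x (S j) powr p) * indicator (K j) x) \<partial>\<mu>)"
    proof (rule nn_integral_mono)
      fix x
      show "ennreal (infdist x U powr p) * indicator (\<Union>j\<in>J. K j) x \<le>
          (\<Sum>j\<in>J. ennreal (infdist x (S j) powr p) * indicator (K j) x)"
      proof (cases "x \<in> (\<Union>j\<in>J. K j)")
        case True
        then obtain j where j: "j \<in> J" "x \<in> K j" by auto
        have "infdist x U \<le> infdist x (S j)"
          using j S by (intro infdist_mono) (auto simp: U_def)
        then have "ennreal (infdist x U powr p) \<le> ennreal (infdist x (S j) powr p) * indicator (K j) x"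
          using j p by (auto intro!: ennreal_leI powr_mono2 infdist_nonneg)
        also have "\<dots> \<le> (\<Sum>j\<in>J. ennreal (infdist x (S j) powr p) * indicator (K j) x)"
          using j J by (intro member_le_sum) auto
        finally show ?thesis using True by simp
      qed simp
    qed
    also have "\<dots> = (\<Sum>j\<in>J. moment_on p \<mu> (K j) (S j))"
      by (intro nn_integral_sum m)
    also have "\<dots> \<le> (\<Sum>j\<in>J. ennreal (b j * \<delta> powr p))" by (intro sum_mono S)
    also have "\<dots> = ennreal ((\<Sum>j\<in>J. b j) * \<delta> powr p)"
      using b by (subst sum_ennreal) (auto simp: sum_distrib_right)
    finally show "exists_net p \<mu> (\<Union>j\<in>J. K j) (\<Sum>j\<in>J. a j) ((\<Sum>j\<in>J. b j)) \<delta>"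
      using c S J by (intro exI[of _ U]) (auto simp: U_def)
  qed
qed

text \<open>
  Because of \<open>infdist x {} = 0\<close>, adding points to the empty set may increase the distance; so nets
  have to be nonempty. For empty \<open>K\<close> any single point will do.
\<close>

lemma net_nonempty:
  assumes "finite S" "real (card S) \<le> a / \<delta>" "0 < \<delta>" "\<delta> \<le> a" "S = {} \<Longrightarrow> K = {}"
    and "moment_on p \<mu> K S \<le> c"
  shows "\<exists>S. finite S \<and> S \<noteq> {} \<and> real (card S) \<le> a / \<delta> \<and>
     moment_on p \<mu> K S \<le> c"
proof (cases "S = {}")
  case True
  have "real (card {undefined :: 'a}) \<le> a / \<delta>" using assms by (simp add: field_simps)
  then show ?thesis using True assms by (intro exI[of _ "{undefined}"]) auto
next
  case False
  then show ?thesis using assms by blast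
qed

text \<open>
  A net of mesh \<open>\<delta> / y\<close>, with \<open>y\<close> about \<open>g\<close> on the arc: then the number of points and the error are
  both proportional to \<open>y * h\<close>, the integral of \<open>g\<close>.
\<close>

lemma nets_positive_density:
  fixes F :: "real \<Rightarrow> 'a::metric_space"
  assumes B: "compact B" "L-lipschitz_on B F" "inj_on F B"
    and h: "hausdorff1_outer (F ` B) = ennreal h" "0 \<le> h" and p: "1 \<le> p" and e: "0 < e"
    and y: "0 < y" and Y: "0 \<le> Y"
    and \<mu>: "\<And>f. f \<in> borel_measurable borel \<Longrightarrow> (\<integral>\<^sup>+x. f x * indicator (F ` B) x \<partial>\<mu>)
      \<le> ennreal (Y * y powr (p + 1)) * (\<integral>\<^sup>+x. f x * indicator (F ` B) x \<partial>hausdorff1)"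
  shows "nets p \<mu> (F ` B) (y * h + e) (Y * zador_power p * (y * h + e))"
proof -
  have ey: "0 < e / y" using e y by simp
  have fl: "filterlim (\<lambda>\<delta>. \<delta> / y) (at_right 0) (at_right 0)" using y by real_asymp
  have small: "\<forall>\<^sub>F \<delta> in at_right 0. \<delta> \<le> y * h + e"
    using y h e by (auto simp: eventually_at_right_field intro!: exI[of _ "y * h + e"] add_nonneg_pos)
  show ?thesis
    unfolding nets_def
    using eventually_compose_filterlim[OF lipschitz_arc_net[OF B h p ey] fl] eventually_at_right_less[of
      0] small
  proof eventually_elim
    fix \<delta> :: real
    assume "exists_arc_net p hausdorff1 (F ` B) (h + e / y) (\<delta> / y)" and \<delta>: "0 < \<delta>" "\<delta> \<le> y * h + e"
    then obtain S where S: "finite S" "real (card S) \<le> (h + e / y) / (\<delta> / y)"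
      "\<forall>x\<in>F ` B. \<exists>s\<in>S. dist x s \<le> \<delta> / y"
      "moment_on p hausdorff1 (F ` B) S
        \<le> ennreal ((h + e / y) * zador_power p * (\<delta> / y) powr p)" by blast
    have "moment_on p \<mu> (F ` B) S
      \<le> ennreal (Y * y powr (p + 1)) * moment_on p hausdorff1 (F ` B) S"
      by (rule \<mu>) measurable
    also have "\<dots> \<le> ennreal (Y * y powr (p + 1)) * ennreal ((h + e / y) * zador_power p * (\<delta> / y) powr p)"
      by (intro mult_left_mono S) auto
    also have "\<dots> = ennreal (Y * y powr (p + 1) * ((h + e / y) * zador_power p * (\<delta> / y) powr p))"
      using Y y by (intro ennreal_mult'[symmetric]) auto
    also have "Y * y powr (p + 1) * ((h + e / y) * zador_power p * (\<delta> / y) powr p)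
        = Y * zador_power p * (y * (h + e / y)) * (y powr p * (\<delta> / y) powr p)"
      using y by (simp add: powr_add)
    also have "y * (h + e / y) = y * h + e" using y by (simp add: distrib_left)
    also have "y powr p * (\<delta> / y) powr p = \<delta> powr p" using y \<delta> by (simp add: powr_divide)
    finally have "moment_on p \<mu> (F ` B) S
        \<le> ennreal (Y * zador_power p * (y * h + e) * \<delta> powr p)" .
    moreover have "(h + e / y) / (\<delta> / y) = (y * h + e) / \<delta>"
    proof -
      have "(h + e / y) * y = y * h + e" using y by (simp add: distrib_right)
      then show ?thesis by (simp only: divide_divide_eq_right)
    qed
    ultimately show "exists_net p \<mu> (F ` B) (y * h + e) (Y * zador_power p * (y * h + e)) \<delta>"
      using S \<delta> by (intro net_nonempty[where S=S]) auto
  qed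
qed

text \<open>
  On an arc of \<open>H\<close>-measure zero, \<open>e * \<theta> / (\<theta> * \<delta>)\<close> points suffice for a net of mesh \<open>\<theta> * \<delta>\<close>; so the
  error is small by the choice of \<open>\<theta>\<close>, while the number of points is at most \<open>e / \<delta>\<close>.
\<close>

lemma nets_null:
  fixes F :: "real \<Rightarrow> 'a::metric_space"
  assumes B: "compact B" "L-lipschitz_on B F" "inj_on F B" and h: "hausdorff1_outer (F ` B) = 0"
    and p: "1 \<le> p" and e: "0 < e" and \<mu>: "sets \<mu> = sets borel" "finite_measure \<mu>"
  shows "nets p \<mu> (F ` B) e e"
proof -
  interpret finite_measure \<mu> by fact
  define m where "m = measure \<mu> UNIV + 1"
  have m: "0 < m" "measure \<mu> UNIV \<le> m" by (auto simp: m_def add_nonneg_pos)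
  \<comment> \<open>With this \<open>\<theta>\<close>, mass at most \<open>m\<close> at distance at most \<open>\<theta> * \<delta>\<close> costs at most \<open>e * \<delta> powr p\<close>.\<close>
  define \<theta> where "\<theta> = (e / m) powr (1 / p)"
  have \<theta>: "0 < \<theta>" "\<theta> powr p = e / m" using e m p by (auto simp: \<theta>_def powr_powr)
  have e\<theta>: "0 < e * \<theta>" using e \<theta> by simp
  have fl: "filterlim (\<lambda>\<delta>. \<theta> * \<delta>) (at_right 0) (at_right 0)" using \<theta>(1) by real_asymp
  have small: "\<forall>\<^sub>F \<delta> in at_right 0. \<delta> \<le> e"
    using e by (auto simp: eventually_at_right_field intro!: exI[of _ e])
  have h': "hausdorff1_outer (F ` B) = ennreal 0" using h by simp
  have "compact (F ` B)"
    by (intro compact_continuous_image lipschitz_on_continuous_on[OF B(2)] B(1))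
  then have FB: "F ` B \<in> sets \<mu>" using \<mu> by (simp add: compact_imp_closed)
  show ?thesis
    unfolding nets_def
    using eventually_compose_filterlim[OF lipschitz_arc_net[OF B h' order_refl p e\<theta>] fl]
      eventually_at_right_less[of 0] small
  proof eventually_elim
    fix \<delta> :: real
    assume "exists_arc_net p hausdorff1 (F ` B) (0 + e * \<theta>) (\<theta> * \<delta>)" and \<delta>: "0 < \<delta>" "\<delta> \<le> e"
    then obtain S where S: "finite S" "real (card S) \<le> (0 + e * \<theta>) / (\<theta> * \<delta>)"
      "\<forall>x\<in>F ` B. \<exists>s\<in>S. dist x s \<le> \<theta> * \<delta>" by blast
    have "moment_on p \<mu> (F ` B) S
        \<le> (\<integral>\<^sup>+x. ennreal ((\<theta> * \<delta>) powr p) * indicator (F ` B) x \<partial>\<mu>)"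
    proof (intro nn_integral_mono)
      fix x
      show "ennreal (infdist x S powr p) * indicator (F ` B) x
        \<le> ennreal ((\<theta> * \<delta>) powr p) * indicator (F ` B) x"
      proof (cases "x \<in> F ` B")
        case True
        then obtain s where "s \<in> S" "dist x s \<le> \<theta> * \<delta>" using S by blast
        then have "infdist x S \<le> \<theta> * \<delta>" using infdist_le2 by blast
        then show ?thesis using True p by (auto intro!: ennreal_leI powr_mono2 infdist_nonneg)
      qed simp
    qed
    also have "\<dots> = ennreal ((\<theta> * \<delta>) powr p) * emeasure \<mu> (F ` B)"
      by (rule nn_integral_cmult_indicator[OF FB])
    also have "\<dots> \<le> ennreal ((\<theta> * \<delta>) powr p) * ennreal m"
    proof (intro mult_left_mono)
      have "measure \<mu> (F ` B) \<le> measure \<mu> UNIV" using \<mu> by (intro finite_measure_mono) auto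
      then show "emeasure \<mu> (F ` B) \<le> ennreal m" using m by (simp add: emeasure_eq_measure ennreal_leI)
    qed auto
    also have "\<dots> = ennreal ((\<theta> * \<delta>) powr p * m)" using m by (simp add: ennreal_mult)
    also have "(\<theta> * \<delta>) powr p * m = e * \<delta> powr p" using \<theta> \<delta> m by (simp add: powr_mult)
    finally have "moment_on p \<mu> (F ` B) S \<le> ennreal (e * \<delta> powr p)" .
    then show "exists_net p \<mu> (F ` B) e e \<delta>"
      using S \<delta> \<theta> by (intro net_nonempty[where S=S]) auto
  qed
qed

text \<open>
  The null set \<open>Z\<close> of \<open>H\<close> carries the singular component, so that only the density is left outside
  of it.
\<close>

lemma ac_densityD:
  fixes \<mu> :: "'a::metric_space measure"
  assumes \<mu>: "sets \<mu> = sets borel" and ac: "ac_density hausdorff1 \<mu> \<rho>"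
  shows "\<rho> \<in> borel_measurable borel" "\<And>x. 0 \<le> \<rho> x" "density hausdorff1 (\<lambda>x. ennreal (\<rho> x)) \<le> \<mu>"
    "\<exists>Z\<in>sets borel. hausdorff1_outer Z = 0 \<and> (\<forall>A\<in>sets borel. A \<inter> Z = {} \<longrightarrow>
      emeasure \<mu> A = emeasure (density hausdorff1 (\<lambda>x. ennreal (\<rho> x))) A)"
proof -
  show "\<rho> \<in> borel_measurable borel" "\<And>x. 0 \<le> \<rho> x"
    using ac by (auto simp: ac_density_def measurable_cong_sets[OF sets_hausdorff1 refl])
  obtain \<sigma> Z where \<sigma>: "sets \<sigma> = sets (hausdorff1 :: 'a measure)" and Z: "Z \<in> null_sets hausdorff1"
    "emeasure \<sigma> (- Z) = 0"
    and eq: "\<And>B. B \<in> sets borel \<Longrightarrow> emeasure \<mu> B = emeasure (density hausdorff1 (\<lambda>x. ennreal (\<rho> x))) B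
      + emeasure \<sigma> B"
    using ac by (auto simp: ac_density_def Compl_eq_Diff_UNIV)
  show "density hausdorff1 (\<lambda>x. ennreal (\<rho> x)) \<le> \<mu>"
    using \<mu> eq by (subst le_measure) auto
  have Zb: "Z \<in> sets borel" using Z(1) by (auto dest: null_setsD2)
  show "\<exists>Z\<in>sets borel. hausdorff1_outer Z = 0 \<and> (\<forall>A\<in>sets borel. A \<inter> Z = {} \<longrightarrow>
      emeasure \<mu> A = emeasure (density hausdorff1 (\<lambda>x. ennreal (\<rho> x))) A)"
  proof (intro bexI[OF _ Zb] conjI ballI impI)
    show "hausdorff1_outer Z = 0"
      using Z(1) Zb emeasure_hausdorff1[OF Zb] by (auto dest: null_setsD1)
    fix A :: "'a set" assume A: "A \<in> sets borel" "A \<inter> Z = {}"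
    have "emeasure \<sigma> A \<le> emeasure \<sigma> (- Z)" using A Zb \<sigma> by (intro emeasure_mono) auto
    then show "emeasure \<mu> A = emeasure (density hausdorff1 (\<lambda>x. ennreal (\<rho> x))) A"
      using eq[OF A(1)] Z(2) by simp
  qed
qed

lemma exhaust_decseq:
  assumes \<mu>: "finite_measure \<mu>" and A: "\<And>n. A n \<in> sets \<mu>" "decseq A" "measure \<mu> (\<Inter>n. A n) = 0" and e: "0 < e"
  shows "\<exists>n. measure \<mu> (A n) < e"
proof -
  interpret finite_measure \<mu> by fact
  have "(\<lambda>n. measure \<mu> (A n)) \<longlonglongrightarrow> 0"
    using finite_Lim_measure_decseq[of A] A by auto
  from order_tendstoD(2)[OF this e] show ?thesis
    by (auto simp: eventually_sequentially)
qed

lemma finitely_many_sets_carry_almost_all: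
  fixes T :: "nat \<Rightarrow> 'a::metric_space set"
  assumes \<mu>: "sets \<mu> = sets borel" "finite_measure \<mu>" and T: "\<And>k. T k \<in> sets borel"
    and AE: "AE x in \<mu>. x \<in> (\<Union>k. T k)" and e: "0 < e"
  shows "\<exists>n. measure \<mu> (- (\<Union>k<n. T k)) < e"
proof (rule exhaust_decseq[OF \<mu>(2) _ _ _ e])
  show "- (\<Union>k<n. T k) \<in> sets \<mu>" for n
    unfolding \<mu>(1) using T by (intro borel_comp sets.finite_UN) auto
  show "decseq (\<lambda>n. - (\<Union>k<n. T k))"
    unfolding decseq_def by (intro allI impI Compl_anti_mono UN_mono) (simp_all add: lessThan_subset_iff)
  have "(\<Union>k. T k) \<in> sets borel" using T by (intro sets.countable_UN) auto
  then have "- (\<Union>k. T k) \<in> sets \<mu>" unfolding \<mu>(1) by (rule borel_comp)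
  moreover have "AE x in \<mu>. x \<notin> - (\<Union>k. T k)" using AE by simp
  ultimately have "emeasure \<mu> (- (\<Union>k. T k)) = 0" using AE_iff_null_sets null_setsD1 by blast
  moreover have "(\<Inter>n. - (\<Union>k<n. T k)) = - (\<Union>k. T k)" by auto
  ultimately show "measure \<mu> (\<Inter>n. - (\<Union>k<n. T k)) = 0" by (simp add: measure_def)
qed

lemma finitely_many_levels_carry_almost_all:
  fixes g :: "'a::metric_space \<Rightarrow> real"
  assumes \<mu>: "sets \<mu> = sets borel" "finite_measure \<mu>" and g[measurable]: "g \<in> borel_measurable borel"
    and q: "1 < q" and e: "0 < e"
  shows "\<exists>m::nat. measure \<mu> {x. 0 < g x \<and> \<not> (q powr (- real m) \<le> g x \<and> g x < q powr real m)} < e"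
proof -
  define E where "E m = {x. 0 < g x \<and> \<not> (q powr (- real m) \<le> g x \<and> g x < q powr real m)}" for m :: nat
  have "\<exists>m. measure \<mu> (E m) < e"
  proof (rule exhaust_decseq[OF \<mu>(2) _ _ _ e])
    show "E m \<in> sets \<mu>" for m unfolding \<mu>(1) E_def by measurable
    show "decseq E"
      unfolding decseq_def
    proof (intro allI impI subsetI)
      fix j k :: nat and x assume jk: "j \<le> k" and x: "x \<in> E k"
      have "q powr (- real k) \<le> q powr (- real j)" "q powr real j \<le> q powr real k"
        using jk q by (auto intro!: powr_mono)
      then show "x \<in> E j" using x by (auto simp: E_def)
    qed
    have "\<exists>m. x \<notin> E m" for x
    proof (cases "0 < g x")
      case True
      obtain m :: nat where m: "\<bar>log q (g x)\<bar> < m" using reals_Archimedean2 by blast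
      have "g x = q powr log q (g x)" using True q by simp
      moreover have "q powr (- real m) \<le> q powr log q (g x)" "q powr log q (g x) < q powr real m"
        using m q by (auto intro!: powr_mono powr_less_mono)
      ultimately have "x \<notin> E m" by (simp add: E_def)
      then show ?thesis by blast
    qed (simp add: E_def)
    then have "(\<Inter>m. E m) = {}" by blast
    then show "measure \<mu> (\<Inter>m. E m) = 0" by (simp only: measure_empty)
  qed
  then show ?thesis by (simp only: E_def)
qed

lemma nn_integral_le_where_density_le:
  fixes f :: "'a::metric_space \<Rightarrow> ennreal"
  assumes \<mu>: "sets \<mu> = sets borel" and \<rho>[measurable]: "\<rho> \<in> borel_measurable borel" and K[measurable]: "K
    \<in> sets borel"
    and ac: "\<And>A. A \<in> sets borel \<Longrightarrow> A \<subseteq> K \<Longrightarrow> emeasure \<mu> A = emeasure (density hausdorff1 (\<lambda>x. ennreal (\<rho> x))) A"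
    and le: "\<And>x. x \<in> K \<Longrightarrow> \<rho> x \<le> c" and f[measurable]: "f \<in> borel_measurable borel"
  shows "(\<integral>\<^sup>+x. f x * indicator K x \<partial>\<mu>) \<le> ennreal c * (\<integral>\<^sup>+x. f x * indicator K x \<partial>hausdorff1)"
proof -
  let ?D = "density hausdorff1 (\<lambda>x. ennreal (\<rho> x) * indicator K x)"
  have eq: "density \<mu> (indicator K) = ?D"
  proof (rule measure_eqI)
    show "sets (density \<mu> (indicator K)) = sets ?D" using \<mu> by simp
    fix S assume "S \<in> sets (density \<mu> (indicator K))"
    then have S[measurable]: "S \<in> sets borel" using \<mu> by simp
    have "emeasure (density \<mu> (indicator K)) S = emeasure \<mu> (K \<inter> S)"
      using \<mu> by (simp add: emeasure_density flip: indicator_inter_arith)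
    also have "\<dots> = emeasure (density hausdorff1 (\<lambda>x. ennreal (\<rho> x))) (K \<inter> S)" by (intro ac) auto
    also have "\<dots> = emeasure ?D S" by (simp add: emeasure_density indicator_inter_arith mult.assoc)
    finally show "emeasure (density \<mu> (indicator K)) S = emeasure ?D S" .
  qed
  have f\<mu>: "f \<in> borel_measurable \<mu>" using f unfolding measurable_cong_sets[OF \<mu> refl] .
  have "(\<integral>\<^sup>+x. f x * indicator K x \<partial>\<mu>) = (\<integral>\<^sup>+x. f x \<partial>density \<mu> (indicator K))"
    using \<mu> f\<mu> by (subst nn_integral_density) (auto simp: mult.commute)
  also have "\<dots> = (\<integral>\<^sup>+x. ennreal (\<rho> x) * indicator K x * f x \<partial>hausdorff1)"
    unfolding eq by (rule nn_integral_density) auto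
  also have "\<dots> \<le> (\<integral>\<^sup>+x. ennreal c * (f x * indicator K x) \<partial>hausdorff1)"
  proof (rule nn_integral_mono)
    fix x
    show "ennreal (\<rho> x) * indicator K x * f x \<le> ennreal c * (f x * indicator K x)"
      using le[of x] by (cases "x \<in> K") (auto intro!: mult_right_mono ennreal_leI)
  qed
  also have "\<dots> = ennreal c * (\<integral>\<^sup>+x. f x * indicator K x \<partial>hausdorff1)"
    by (rule nn_integral_cmult) simp
  finally show ?thesis .
qed

text \<open>
  The arcs are cut out of the sets \<open>P (k, c)\<close>: \<open>k\<close> says in which of the countably many Lipschitz
  images a point lies first, and \<open>c\<close> is \<open>None\<close> on the null set \<open>Z\<close> of the singular component and
  otherwise the exponent \<open>l\<close> with \<open>g\<close> in the interval from \<open>q powr l\<close> to \<open>q powr (l + 1)\<close>, where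
  \<open>q = 1 + e\<close>. Finitely many of these sets carry almost all of \<open>\<mu>\<close>, and each is almost exhausted by
  an injective Lipschitz arc. The sum of \<open>y j * h j\<close> over the arcs is at most \<open>i\<close> because the arcs
  are disjoint and \<open>g \<ge> y j\<close> on them.
\<close>

theorem rectifiable_nets:
  fixes \<mu> :: "'a::polish_space measure" and \<rho> :: "'a \<Rightarrow> real"
  assumes p: "1 \<le> p" and \<mu>: "sets \<mu> = sets borel" "finite_measure \<mu>"
    and rect: "countably_1_rectifiable \<mu>" and ac: "ac_density hausdorff1 \<mu> \<rho>"
    and i: "(\<integral>\<^sup>+x. ennreal (\<rho> x powr (1 / (1 + p))) \<partial>hausdorff1) = ennreal i" "0 \<le> i"
    and e: "0 < e" and \<kappa>: "0 < \<kappa>"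
  obtains K where "K \<in> sets borel" "emeasure \<mu> (- K) < ennreal \<kappa>"
    "nets p \<mu> K (i + e) ((1 + e) powr (p + 1) * zador_power p * (i + e) + e)"
proof -
  interpret finite_measure \<mu> by fact
  note \<rho>[measurable] = ac_densityD(1)[OF \<mu>(1) ac]
  note \<rho>0 = ac_densityD(2)[OF \<mu>(1) ac]
  obtain Z where Z[measurable]: "Z \<in> sets borel" and Z0: "hausdorff1_outer Z = 0"
    and \<mu>\<rho>: "\<And>A. A \<in> sets borel \<Longrightarrow> A \<inter> Z = {} \<Longrightarrow> emeasure \<mu> A = emeasure (density hausdorff1 (\<lambda>x. ennreal
      (\<rho> x))) A"
    using ac_densityD(4)[OF \<mu>(1) ac] by auto
  define g where "g x = \<rho> x powr (1 / (1 + p))" for x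
  have g[measurable]: "g \<in> borel_measurable borel" unfolding g_def by measurable
  have g0: "0 \<le> g x" for x by (simp add: g_def)
  have g\<rho>: "g x powr (p + 1) = \<rho> x" for x
    using p \<rho>0[of x] by (simp add: g_def powr_powr add.commute)
  obtain A :: "nat \<Rightarrow> real set" and F :: "nat \<Rightarrow> real \<Rightarrow> 'a" and L where A: "\<And>k. compact (A k)"
    "\<And>k. (L k)-lipschitz_on (A k) (F k)"
    "AE x in \<mu>. x \<in> (\<Union>k. F k ` A k)"
    by (rule rectifiable_compact_images[OF rect]) blast
  define T where "T k = F k ` A k" for k
  have contF: "continuous_on (A k) (F k)" for k by (rule lipschitz_on_continuous_on[OF A(2)])
  have "compact (T k)" for k unfolding T_def by (intro compact_continuous_image contF A)
  then have Tb[measurable]: "T k \<in> sets borel" for k by (simp add: compact_imp_closed)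
  define q where "q = 1 + e"
  have q: "1 < q" using e by (simp add: q_def)
  have \<kappa>4: "0 < \<kappa> / 4" using \<kappa> by simp
  define C1 where "C1 n = - (\<Union>k<n. T k)" for n
  have "AE x in \<mu>. x \<in> (\<Union>k. T k)" using A(3) by (simp only: T_def)
  from finitely_many_sets_carry_almost_all[OF \<mu> Tb this \<kappa>4, folded C1_def]
  obtain n where n: "measure \<mu> (C1 n) < \<kappa> / 4" ..
  define C2 where "C2 m = {x. 0 < g x \<and> \<not> (q powr (- real m) \<le> g x \<and> g x < q powr real m)}" for m
  from finitely_many_levels_carry_almost_all[OF \<mu> g q \<kappa>4, folded C2_def]
  obtain m where m: "measure \<mu> (C2 m) < \<kappa> / 4" ..
  define C3 where "C3 = {x. g x = 0} - Z"
  have null: "measure \<mu> C3 = 0"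
  proof -
    have s: "C3 \<in> sets borel" unfolding C3_def by measurable
    have z: "\<rho> x = 0" if "g x = 0" for x using g\<rho>[of x] that by simp
    have "emeasure \<mu> C3 = (\<integral>\<^sup>+x. ennreal (\<rho> x) * indicator C3 x \<partial>hausdorff1)"
      using s by (subst \<mu>\<rho>) (auto simp: emeasure_density C3_def)
    also have "\<dots> = (\<integral>\<^sup>+x. 0 \<partial>(hausdorff1 :: 'a measure))"
      using z by (intro nn_integral_cong) (auto simp: indicator_def C3_def)
    finally show ?thesis by (simp add: measure_def)
  qed
  define J where "J = {..<n} \<times> insert None (Some ` {- int m..<int m})"
  \<comment> \<open>The index \<open>(n, None)\<close> only makes the family nonempty when \<open>n = 0\<close>.\<close>
  define J' where "J' = insert (n, None) J"
  define R where "R c = (case c of None \<Rightarrow> Z | Some l \<Rightarrow> {x. q powr real_of_int l \<le> g x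
    \<and> g x < q powr (real_of_int l + 1)} - Z)"
    for c :: "int option"
  define P where "P j = disjointed T (fst j) \<inter> R (snd j)" for j
  have J': "finite J'" "J' \<noteq> {}" by (auto simp: J'_def J_def)
  define N where "N = real (card J')"
  have N: "0 < N" using J' by (simp add: N_def card_gt_0_iff)
  have Rb: "R c \<in> sets borel" for c
  proof (cases c)
    case (Some l)
    have "{x. q powr real_of_int l \<le> g x \<and> g x < q powr (real_of_int l + 1)} - Z \<in> sets borel" by measurable
    then show ?thesis using Some by (simp add: R_def)
  qed (simp add: R_def)
  have "range T \<subseteq> sets borel" using Tb by (intro image_subsetI)
  from sets.range_disjointed_sets[OF this] have "disjointed T k \<in> sets borel" for k by blast
  then have Pb: "P j \<in> sets borel" for j using Rb by (auto simp: P_def)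
  have PT: "P j \<subseteq> F (fst j) ` A (fst j)" for j
    using disjointed_subset[of T "fst j"] by (auto simp: P_def T_def)
  have Rdisj: "R c \<inter> R d = {}" if "c \<noteq> d" for c d
  proof -
    have lt: "k \<le> l" if "q powr real_of_int k < q powr (real_of_int l + 1)" for k l
      using that q by simp
    show ?thesis
    proof (rule ccontr)
      assume "R c \<inter> R d \<noteq> {}"
      then obtain x where x: "x \<in> R c" "x \<in> R d" by auto
      show False
      proof (cases c; cases d)
        fix k l assume cd: "c = Some k" "d = Some l"
        then have "k \<le> l" "l \<le> k" using x by (auto intro!: lt simp: R_def intro: order_le_less_trans)
        then show False using cd that by simp
      qed (use x that in \<open>auto simp: R_def\<close>)
    qed
  qed
  have Pdisj: "P j \<inter> P k = {}" if "j \<noteq> k" for j k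
  proof (cases "fst j = fst k")
    case True
    then have "snd j \<noteq> snd k" using that by (metis prod.expand)
    then show ?thesis using Rdisj by (auto simp: P_def)
  next
    case False
    then show ?thesis using disjoint_family_disjointed[of T] by (auto simp: P_def disjoint_family_on_def)
  qed
  have "\<forall>j. \<exists>B. compact B \<and> B \<subseteq> A (fst j) \<and> inj_on (F (fst j)) B \<and> F (fst j) ` B \<subseteq> P j
      \<and> measure \<mu> (P j - F (fst j) ` B) < \<kappa> / (4 * N)"
  proof
    fix j :: "nat \<times> int option"
    have "0 < \<kappa> / (4 * N)" using \<kappa> N by simp
    from injective_compact_piece[OF A(1) contF Pb PT \<mu> this]
    show "\<exists>B. compact B \<and> B \<subseteq> A (fst j) \<and> inj_on (F (fst j)) B \<and> F (fst j) ` B \<subseteq> P j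
      \<and> measure \<mu> (P j - F (fst j) ` B) < \<kappa> / (4 * N)" by metis
  qed
  from choice[OF this] obtain B where "\<forall>j. compact (B j) \<and> B j \<subseteq> A (fst j) \<and> inj_on (F (fst j)) (B j)
      \<and> F (fst j) ` B j \<subseteq> P j \<and> measure \<mu> (P j - F (fst j) ` B j) < \<kappa> / (4 * N)" ..
  then have B: "\<And>j. compact (B j)" "\<And>j. B j \<subseteq> A (fst j)" "\<And>j. inj_on (F (fst j)) (B j)"
    "\<And>j. F (fst j) ` B j \<subseteq> P j" "\<And>j. measure \<mu> (P j - F (fst j) ` B j) < \<kappa> / (4 * N)" by blast+
  define K where "K j = F (fst j) ` B j" for j
  have Klip: "(L (fst j))-lipschitz_on (B j) (F (fst j))" for j using A(2) B(2) by (rule lipschitz_on_subset)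
  have "compact (K j)" for j unfolding K_def by (intro compact_continuous_image
    lipschitz_on_continuous_on[OF Klip] B)
  then have Kb[measurable]: "K j \<in> sets borel" for j by (simp add: compact_imp_closed)
  have KP: "K j \<subseteq> P j" for j using B(4) by (simp add: K_def)
  define U where "U = (\<Union>j\<in>J'. K j)"
  have Ub[measurable]: "U \<in> sets borel" unfolding U_def using J' by (intro sets.finite_UN) auto
  define C4 where "C4 = (\<Union>j\<in>J'. P j - K j)"
  have C12: "C1 n \<in> sets \<mu>" "C2 m \<in> sets \<mu>" "C3 \<in> sets \<mu>"
    unfolding \<mu>(1) C1_def C2_def C3_def by measurable
  have PK: "P j - K j \<in> sets \<mu>" for j unfolding \<mu>(1) by (intro sets.Diff Pb Kb)
  have C4: "C4 \<in> sets \<mu>" unfolding C4_def by (intro sets.finite_UN J' PK)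
  have cover: "- U \<subseteq> C1 n \<union> C2 m \<union> C3 \<union> C4"
  proof
    fix x assume x: "x \<in> - U"
    show "x \<in> C1 n \<union> C2 m \<union> C3 \<union> C4"
    proof (rule ccontr)
      assume no: "x \<notin> C1 n \<union> C2 m \<union> C3 \<union> C4"
      then have "x \<in> (\<Union>k<n. T k)" by (simp add: C1_def)
      then have "x \<in> (\<Union>k\<in>{0..<n}. disjointed T k)"
        using finite_UN_disjointed_eq[of T n] by (simp add: atLeast0LessThan)
      then obtain k where k: "k < n" "x \<in> disjointed T k" by auto
      have "\<exists>c\<in>insert None (Some ` {- int m..<int m}). x \<in> R c"
      proof (cases "x \<in> Z")
        case True then show ?thesis by (simp add: R_def)
      next
        case False
        then have "g x \<noteq> 0" using no by (simp add: C3_def)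
        then have gx: "0 < g x" using g0[of x] by simp
        then have b: "q powr (- real m) \<le> g x" "g x < q powr real m" using no by (auto simp: C2_def)
        define l where "l = \<lfloor>log q (g x)\<rfloor>"
        have "- real m \<le> log q (g x)" "log q (g x) < real m"
          using b gx q by (auto simp: le_log_iff log_less_iff)
        then have "l \<in> {- int m..<int m}" by (auto simp: l_def le_floor_iff floor_less_iff)
        moreover have "q powr real_of_int l \<le> g x" "g x < q powr (real_of_int l + 1)"
          using gx q by (auto simp: l_def le_log_iff[symmetric] log_less_iff[symmetric])
        ultimately show ?thesis using False by (intro bexI[of _ "Some l"]) (auto simp: R_def)
      qed
      then obtain c where c: "c \<in> insert None (Some ` {- int m..<int m})" "x \<in> R c" by blast
      have "(k, c) \<in> J'" using k(1) c(1) unfolding J'_def J_def by blast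
      moreover have "x \<in> P (k, c)" using k c by (simp add: P_def)
      moreover have "x \<notin> K (k, c)" using x \<open>(k, c) \<in> J'\<close> unfolding U_def by blast
      ultimately show False using no unfolding C4_def by blast
    qed
  qed
  have "measure \<mu> (- U) \<le> measure \<mu> (C1 n \<union> C2 m \<union> C3 \<union> C4)"
    using C12 C4 by (intro finite_measure_mono cover sets.Un)
  also have "\<dots> \<le> measure \<mu> (C1 n \<union> C2 m \<union> C3) + measure \<mu> C4"
    using C12 C4 by (intro measure_Un_le sets.Un)
  also have "measure \<mu> (C1 n \<union> C2 m \<union> C3) \<le> measure \<mu> (C1 n \<union> C2 m) + measure \<mu> C3"
    using C12 C4 by (intro measure_Un_le sets.Un)
  also have "measure \<mu> (C1 n \<union> C2 m) \<le> measure \<mu> (C1 n) + measure \<mu> (C2 m)"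
    using C12 C4 by (intro measure_Un_le)
  also have "measure \<mu> C4 \<le> (\<Sum>j\<in>J'. measure \<mu> (P j - K j))"
    unfolding C4_def using J'(1) PK by (intro finite_measure_subadditive_finite image_subsetI)
  also have "\<dots> \<le> (\<Sum>j\<in>J'. \<kappa> / (4 * N))"
    using B(5) by (intro sum_mono) (simp add: K_def less_imp_le)
  also have "\<dots> = \<kappa> / 4" using N by (simp add: N_def)
  finally have "measure \<mu> (- U) < \<kappa>"
    using n m null \<kappa> by linarith
  then have rest: "emeasure \<mu> (- U) < ennreal \<kappa>"
    by (simp add: emeasure_eq_measure ennreal_less_iff)
  \<comment> \<open>On the null set \<open>Z\<close> the weight is \<open>0\<close>, so that both kinds of pieces obey the same bound.\<close>
  define y where "y j = (case snd j of None \<Rightarrow> 0 | Some l \<Rightarrow> q powr real_of_int l)" for j :: "nat \<times> int option"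
  have y0: "0 \<le> y j" for j by (auto simp: y_def split: option.split)
  have yg: "y j \<le> g x" if "x \<in> K j" for x j
    using KP[of j] that g0[of x] by (auto simp: y_def P_def R_def split: option.splits)
  define h where "h j = enn2real (hausdorff1_outer (K j))" for j
  have sum_le: "(\<Sum>j\<in>J'. ennreal (y j) * hausdorff1_outer (K j)) \<le> ennreal i"
  proof -
    have "(\<Sum>j\<in>J'. ennreal (y j) * hausdorff1_outer (K j))
        = (\<Sum>j\<in>J'. (\<integral>\<^sup>+x. ennreal (y j) * indicator (K j) x \<partial>hausdorff1))"
      by (intro sum.cong refl) (simp add: nn_integral_cmult_indicator emeasure_hausdorff1)
    also have "\<dots> = (\<integral>\<^sup>+x. (\<Sum>j\<in>J'. ennreal (y j) * indicator (K j) x) \<partial>hausdorff1)"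
      by (intro nn_integral_sum[symmetric]) auto
    also have "\<dots> \<le> (\<integral>\<^sup>+x. ennreal (g x) \<partial>hausdorff1)"
    proof (rule nn_integral_mono)
      fix x
      show "(\<Sum>j\<in>J'. ennreal (y j) * indicator (K j) x) \<le> ennreal (g x)"
      proof (cases "\<exists>j\<in>J'. x \<in> K j")
        case True
        then obtain j where j: "j \<in> J'" "x \<in> K j" by auto
        have "(\<Sum>k\<in>J'. ennreal (y k) * indicator (K k) x) = (\<Sum>k\<in>{j}. ennreal (y k) * indicator (K k) x)"
        proof (rule sum.mono_neutral_right)
          show "\<forall>k\<in>J' - {j}. ennreal (y k) * indicator (K k) x = 0"
          proof
            fix k assume "k \<in> J' - {j}"
            then have "x \<notin> K k" using Pdisj[of k j] KP j by blast
            then show "ennreal (y k) * indicator (K k) x = 0" by simp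
          qed
        qed (use j J' in auto)
        also have "\<dots> \<le> ennreal (g x)" using j yg by (simp add: ennreal_leI)
        finally show ?thesis .
      next
        case False
        then have "(\<Sum>j\<in>J'. ennreal (y j) * indicator (K j) x) = 0" by (intro sum.neutral) auto
        then show ?thesis by simp
      qed
    qed
    also have "\<dots> = ennreal i" using i by (simp add: g_def)
    finally show ?thesis .
  qed
  have Hfin: "hausdorff1_outer (K j) = ennreal (h j)" if j: "j \<in> J'" for j
  proof (cases "snd j")
    case None
    have "hausdorff1_outer (K j) \<le> hausdorff1_outer Z"
      using KP[of j] None by (intro hausdorff1_outer_mono) (auto simp: P_def R_def)
    then show ?thesis using Z0 by (simp add: h_def)
  next
    case (Some l)
    have "ennreal (y j) * hausdorff1_outer (K j) \<le> (\<Sum>j\<in>J'. ennreal (y j) * hausdorff1_outer (K j))"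
      using j J' by (intro member_le_sum) auto
    also note sum_le
    finally have "ennreal (y j) * hausdorff1_outer (K j) < top" by (simp add: order_le_less_trans)
    moreover have "0 < y j" using Some q by (simp add: y_def)
    ultimately show ?thesis by (auto simp: h_def ennreal_mult_less_top)
  qed
  have h0: "0 \<le> h j" for j by (simp add: h_def)
  have sum_i: "(\<Sum>j\<in>J'. y j * h j) \<le> i"
  proof -
    have "ennreal (\<Sum>j\<in>J'. y j * h j) = (\<Sum>j\<in>J'. ennreal (y j) * hausdorff1_outer (K j))"
      using y0 h0 Hfin by (subst sum_ennreal[symmetric]) (auto simp: ennreal_mult)
    then have "ennreal (\<Sum>j\<in>J'. y j * h j) \<le> ennreal i" using sum_le by (simp only:)
    then show ?thesis using i(2) by (subst (asm) ennreal_le_iff)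
  qed
  define \<zeta> where "\<zeta> = e / N"
  have \<zeta>: "0 < \<zeta>" "real (card J') * \<zeta> = e" using e N by (auto simp: \<zeta>_def N_def)
  define Y where "Y = q powr (p + 1)"
  have Y0: "0 \<le> Y" by (simp add: Y_def)
  have z: "0 < zador_power p" using zador_power_pos p by simp
  have piece: "nets p \<mu> (K j) (y j * h j + \<zeta>) (Y * zador_power p * (y j * h j + \<zeta>) + \<zeta>)" if j: "j \<in> J'" for j
  proof (cases "snd j")
    case None
    have "hausdorff1_outer (K j) \<le> hausdorff1_outer Z"
      using KP[of j] None by (intro hausdorff1_outer_mono) (auto simp: P_def R_def)
    then have "hausdorff1_outer (K j) = 0" using Z0 by simp
    then have "nets p \<mu> (K j) \<zeta> \<zeta>"
      unfolding K_def by (intro nets_null[OF B(1) Klip B(3) _ p \<zeta>(1) \<mu>])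
    then show ?thesis
      by (rule nets_mono) (use y0 h0 Y0 z \<zeta> in \<open>auto intro!: mult_nonneg_nonneg add_nonneg_nonneg\<close>)
  next
    case (Some l)
    have yq: "y j = q powr real_of_int l" using Some by (simp add: y_def)
    then have yp: "0 < y j" using q by simp
    have KR: "x \<notin> Z" "g x \<le> q * y j" if "x \<in> K j" for x
    proof -
      have "x \<in> R (Some l)" using that KP[of j] Some by (auto simp: P_def)
      then show "x \<notin> Z" "g x \<le> q * y j" using q by (auto simp: R_def yq powr_add mult.commute)
    qed
    have \<rho>Y: "\<rho> x \<le> Y * y j powr (p + 1)" if "x \<in> K j" for x
    proof -
      have "g x powr (p + 1) \<le> (q * y j) powr (p + 1)"
        using KR[OF that] g0 p by (intro powr_mono2) auto
      also have "\<dots> = Y * y j powr (p + 1)" using q yp by (simp add: powr_mult Y_def)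
      finally show ?thesis by (simp add: g\<rho>)
    qed
    have "nets p \<mu> (K j) (y j * h j + \<zeta>) (Y * zador_power p * (y j * h j + \<zeta>))"
      unfolding K_def
    proof (rule nets_positive_density[OF B(1) Klip B(3) _ h0 p \<zeta>(1) yp Y0])
      show "hausdorff1_outer (F (fst j) ` B j) = ennreal (h j)" using Hfin[OF j] by (simp add: K_def)
      fix f :: "'a \<Rightarrow> ennreal" assume f: "f \<in> borel_measurable borel"
      show "(\<integral>\<^sup>+x. f x * indicator (F (fst j) ` B j) x \<partial>\<mu>)
          \<le> ennreal (Y * y j powr (p + 1)) * (\<integral>\<^sup>+x. f x * indicator (F (fst j) ` B j) x \<partial>hausdorff1)"
        unfolding K_def[symmetric]
        using KR \<rho>Y by (intro nn_integral_le_where_density_le[OF \<mu>(1) \<rho> Kb _ _ f] \<mu>\<rho>) auto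
    qed
    then show ?thesis by (rule nets_mono) (use \<zeta> in auto)
  qed
  have "nets p \<mu> U (\<Sum>j\<in>J'. y j * h j + \<zeta>) (\<Sum>j\<in>J'. Y * zador_power p * (y j * h j + \<zeta>) + \<zeta>)"
    unfolding U_def
  proof (rule nets_UN[OF J' \<mu>(1) Kb piece])
    show "0 \<le> Y * zador_power p * (y j * h j + \<zeta>) + \<zeta>" for j
      using y0[of j] h0[of j] Y0 z \<zeta> by (intro add_nonneg_nonneg mult_nonneg_nonneg) auto
  qed (use p in auto)
  moreover have "(\<Sum>j\<in>J'. y j * h j + \<zeta>) \<le> i + e"
    using sum_i \<zeta>(2) by (simp add: sum.distrib)
  moreover have "(\<Sum>j\<in>J'. Y * zador_power p * (y j * h j + \<zeta>) + \<zeta>) \<le> Y * zador_power p * (i + e) + e"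
  proof -
    have "(\<Sum>j\<in>J'. Y * zador_power p * (y j * h j + \<zeta>) + \<zeta>)
        = Y * zador_power p * (\<Sum>j\<in>J'. y j * h j + \<zeta>) + e"
      using \<zeta>(2) by (subst sum.distrib) (simp add: sum_distrib_left)
    also have "\<dots> \<le> Y * zador_power p * (i + e) + e"
      using sum_i \<zeta>(2) Y0 z by (intro add_right_mono mult_left_mono) (auto simp: sum.distrib)
    finally show ?thesis .
  qed
  ultimately have "nets p \<mu> U (i + e) (Y * zador_power p * (i + e) + e)" by (rule nets_mono)
  then show ?thesis using that[OF Ub rest] by (simp add: Y_def q_def)
qed

section \<open>The upper quantization coefficient and Zador's constant\<close>

text \<open>
  The definition of quantizability in \<open>\<epsilon>\<close>-\<open>\<delta>\<close> form, for restrictions of the measure.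
\<close>

lemma quantizable_small:
  fixes \<mu> :: "'a::metric_space measure"
  assumes \<mu>: "sets \<mu> = sets borel" and q: "quantizable p 1 \<mu>" and e: "0 < e"
  obtains \<kappa> where "0 < \<kappa>" "\<And>D. D \<in> sets borel \<Longrightarrow> emeasure \<mu> D < ennreal \<kappa> \<Longrightarrow>
    upper_quant_coeff p 1 (density \<mu> (indicator D)) < ennreal e"
proof (rule ccontr)
  assume "\<not> thesis"
  then have "\<forall>k::nat. \<exists>D. D \<in> sets borel \<and> emeasure \<mu> D < ennreal (1 / real (Suc k)) \<and>
    \<not> upper_quant_coeff p 1 (density \<mu> (indicator D)) < ennreal e"
    using that[of "1 / real (Suc k)" for k] by auto
  from choice[OF this] obtain D where D: "\<And>k::nat. D k \<in> sets borel"
    "\<And>k. emeasure \<mu> (D k) < ennreal (1 / real (Suc k))"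
    "\<And>k. \<not> upper_quant_coeff p 1 (density \<mu> (indicator (D k))) < ennreal e" by blast
  define M where "M k = density \<mu> (indicator (D k))" for k
  have M: "emeasure (M k) A = emeasure \<mu> (D k \<inter> A)" if "A \<in> sets borel" for k A
    using that D(1)[of k] \<mu> by (simp add: M_def emeasure_density flip: indicator_inter_arith)
  have "M k \<le> \<mu>" for k
  proof (subst le_measure)
    show "sets (M k) = sets \<mu>" by (simp add: M_def)
    show "\<forall>A\<in>sets (M k). emeasure (M k) A \<le> emeasure \<mu> A"
    proof
      fix A assume "A \<in> sets (M k)"
      then have A: "A \<in> sets borel" using \<mu> by (simp add: M_def)
      show "emeasure (M k) A \<le> emeasure \<mu> A"
        unfolding M[OF A] using A \<mu> by (intro emeasure_mono) auto
    qed
  qed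
  moreover have "(\<lambda>k. emeasure (M k) UNIV) \<longlonglongrightarrow> 0"
  proof (rule tendsto_sandwich[of "\<lambda>_. 0" _ _ "\<lambda>k. ennreal (1 / real (Suc k))"])
    show "\<forall>\<^sub>F k in sequentially. emeasure (M k) UNIV \<le> ennreal (1 / real (Suc k))"
      using D(2) by (auto simp: M less_imp_le)
    have "(\<lambda>k. 1 / real (Suc k)) \<longlonglongrightarrow> 0" by real_asymp
    then have "(\<lambda>k. ennreal (1 / real (Suc k))) \<longlonglongrightarrow> ennreal 0" by (rule tendsto_ennrealI)
    then show "(\<lambda>k. ennreal (1 / real (Suc k))) \<longlonglongrightarrow> 0" by simp
  qed auto
  moreover have "sets (M k) = sets borel" for k using \<mu> by (simp add: M_def)
  ultimately have "(\<lambda>k. upper_quant_coeff p 1 (M k)) \<longlonglongrightarrow> 0"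
    using q unfolding quantizable_def by blast
  then have "\<forall>\<^sub>F k in sequentially. upper_quant_coeff p 1 (M k) < ennreal e"
    using e by (intro order_tendstoD(2)) auto
  then show False using D(3) by (auto simp: M_def eventually_sequentially)
qed

lemma opt_quant_err_attained_below:
  assumes N: "0 < N" and p: "0 < p" and c: "0 \<le> c" and lt: "ennreal (real N) * opt_quant_err N p \<mu> <
    ennreal c"
  obtains S where "finite S" "S \<noteq> {}" "card S \<le> N"
    "ennreal (real N powr p) * moment p \<mu> S \<le> ennreal (c powr p)"
proof (rule ccontr)
  assume no: "\<not> thesis"
  have "ennreal c \<le> ennreal (real N) * opt_quant_err N p \<mu>"
  proof (rule le_scaled_opt_quant_err[OF N])
    fix S :: "'a set" assume S: "finite S" "S \<noteq> {}" "card S \<le> N"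
    have "\<not> ennreal (real N) * quant_err p \<mu> S \<le> ennreal c"
      using no that[OF S] scaled_quant_err_le_iff[OF p c, of "real N" \<mu> S] N by auto
    then show "ennreal c \<le> ennreal (real N) * quant_err p \<mu> S" by simp
  qed
  then show False using lt by simp
qed

lemma opt_quant_err_le:
  assumes S: "finite S" "S \<noteq> {}" "card S \<le> N" and N: "0 < N" and p: "0 < p" and c: "0 \<le> c"
    and le: "ennreal (real N powr p) * moment p \<mu> S \<le> ennreal c"
  shows "ennreal (real N) * opt_quant_err N p \<mu> \<le> ennreal (c powr (1 / p))"
proof -
  have "opt_quant_err N p \<mu> \<le> quant_err p \<mu> S"
    unfolding opt_quant_err_def using S by (intro INF_lower) auto
  then have "ennreal (real N) * opt_quant_err N p \<mu> \<le> ennreal (real N) * quant_err p \<mu> S"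
    by (intro mult_left_mono) auto
  also have "\<dots> \<le> ennreal (c powr (1 / p))"
    using le N p c by (subst scaled_quant_err_le_iff) (auto simp: powr_powr)
  finally show ?thesis .
qed

text \<open>
  Of \<open>N\<close> points, \<open>(1 - e) * N\<close> are used for the nets on \<open>K\<close>, of mesh \<open>(i + e) / ((1 - e) * N)\<close>, and
  \<open>e * N\<close> for the complement. The first part contributes \<open>\<phi> e\<close>, which tends to \<open>z * i powr (p + 1)\<close>
  as \<open>e\<close> tends to \<open>0\<close>; the second one is made smaller than any given slack by the choice of \<open>\<epsilon>\<close>
  after \<open>e\<close>.
\<close>

lemma upper_quant_coeff_le_nets_limit:
  fixes \<mu> :: "'a::polish_space measure"
  assumes p: "1 \<le> p" and \<mu>: "sets \<mu> = sets borel" and z: "0 \<le> z" and i: "0 \<le> i"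
    and nets: "\<And>e \<epsilon>. 0 < e \<Longrightarrow> 0 < \<epsilon> \<Longrightarrow> \<exists>K\<in>sets borel. nets p \<mu> K (i + e) ((1 + e) powr (p + 1) * z * (i
      + e) + e)
      \<and> upper_quant_coeff p 1 (density \<mu> (indicator (- K))) < ennreal \<epsilon>"
  shows "upper_quant_coeff p 1 \<mu> \<le> ennreal (z powr (1 / p) * i powr ((p + 1) / p))"
proof -
  have approx: "upper_quant_coeff p 1 \<mu> \<le> ennreal (c powr (1 / p))" if c: "z * i powr (p + 1) < c" for c
  proof -
    define b where "b e = (1 + e) powr (p + 1) * z * (i + e) + e" for e
    define \<phi> where "\<phi> e = b e * ((i + e) powr p / (1 - e) powr p)" for e
    have ge: "\<forall>\<^sub>F e in at_right 0. 0 \<le> i + e"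
      using i by (auto simp: eventually_at_right_field intro!: exI[of _ 1])
    have "((\<lambda>e. (i + e) powr p) \<longlongrightarrow> (i + 0) powr p) (at_right 0)"
      using p ge by (intro tendsto_powr' tendsto_intros) auto
    moreover have "((\<lambda>e. (1 - e) powr p) \<longlongrightarrow> (1 - 0) powr p) (at_right 0)"
      by (intro tendsto_intros) auto
    moreover have "(b \<longlongrightarrow> (1 + 0) powr (p + 1) * z * (i + 0) + 0) (at_right 0)"
      unfolding b_def by (intro tendsto_intros) auto
    ultimately have "(\<phi> \<longlongrightarrow> ((1 + 0) powr (p + 1) * z * (i + 0) + 0) * ((i
      + 0) powr p / (1 - 0) powr p)) (at_right 0)"
      unfolding \<phi>_def by (intro tendsto_mult tendsto_divide) auto
    also have "((1 + 0) powr (p + 1) * z * (i + 0) + 0) * ((i + 0) powr p / (1 - 0) powr p)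
      = z * i powr (p + 1)"
      using i by (simp add: powr_mult_base add.commute)
    finally have "\<forall>\<^sub>F e in at_right 0. \<phi> e < c" using c by (rule order_tendstoD(2))
    moreover have "\<forall>\<^sub>F e in at_right 0. 0 < e \<and> e < (1::real)"
      by (auto simp: eventually_at_right_field intro!: exI[of _ 1])
    ultimately have "\<forall>\<^sub>F e in at_right 0. \<phi> e < c \<and> 0 < e \<and> e < 1" by eventually_elim auto
    then obtain e where e: "\<phi> e < c" "0 < e" "e < 1"
      using eventually_happens'[OF trivial_limit_at_right_real] by blast
    have b0: "0 \<le> b e" using z i e by (simp add: b_def)
    have \<phi>0: "0 \<le> \<phi> e" using b0 by (simp add: \<phi>_def)
    \<comment> \<open>At least \<open>e * N / 2\<close> points are left for the complement of \<open>K\<close> after rounding, which costs the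
      factor \<open>(2 / e) powr p\<close>.\<close>
    define \<epsilon> where "\<epsilon> = (c - \<phi> e) powr (1 / p) * (e / 2)"
    have \<epsilon>: "0 < \<epsilon>" "(2 / e) powr p * \<epsilon> powr p = c - \<phi> e"
      using e p by (auto simp: \<epsilon>_def powr_mult powr_powr powr_divide)
    obtain K where K: "K \<in> sets borel" "nets p \<mu> K (i + e) (b e)"
      "upper_quant_coeff p 1 (density \<mu> (indicator (- K))) < ennreal \<epsilon>"
      using nets[OF e(2) \<epsilon>(1)] unfolding b_def by blast
    define \<mu>' where "\<mu>' = density \<mu> (indicator (- K))"
    have "\<forall>\<^sub>F M in sequentially. ennreal (real M powr (1 / 1)) * opt_quant_err M p \<mu>' < ennreal \<epsilon>"
      using K(3) unfolding upper_quant_coeff_def \<mu>'_def by (rule Limsup_lessD)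
    moreover have fl: "filterlim (\<lambda>N. e * real N) at_top sequentially" using e by real_asymp
    have "filterlim (\<lambda>N. nat \<lfloor>e * real N\<rfloor>) at_top sequentially"
      by (rule filterlim_compose[OF filterlim_nat_sequentially filterlim_compose[OF
        filterlim_floor_sequentially fl]])
    ultimately have ev1: "\<forall>\<^sub>F N in sequentially. ennreal (real (nat \<lfloor>e * real N\<rfloor>) powr (1 / 1)) *
      opt_quant_err (nat \<lfloor>e * real N\<rfloor>) p \<mu>' < ennreal \<epsilon>"
      by (rule eventually_compose_filterlim)
    have ie: "0 < i + e" using i e by simp
    have "filterlim (\<lambda>N. (i + e) / ((1 - e) * real N)) (at_right 0) sequentially"
      using ie e by real_asymp
    from eventually_compose_filterlim[OF K(2)[unfolded nets_def] this]
    have ev2: "\<forall>\<^sub>F N in sequentially. exists_net p \<mu> K (i + e) (b e) ((i + e) / ((1 - e) * real N))" .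
    have ev3: "\<forall>\<^sub>F N in sequentially. 2 \<le> e * real N" using fl by (simp add: filterlim_at_top)
    from ev1 ev2 ev3 eventually_gt_at_top[of 0]
    have "\<forall>\<^sub>F N in sequentially. ennreal (real N powr (1 / 1)) * opt_quant_err N p \<mu>
      \<le> ennreal (c powr (1 / p))"
    proof eventually_elim
      fix N :: nat
      assume a1: "ennreal (real (nat \<lfloor>e * real N\<rfloor>) powr (1 / 1)) * opt_quant_err (nat \<lfloor>e * real N\<rfloor>) p
        \<mu>' < ennreal \<epsilon>"
        and a2: "exists_net p \<mu> K (i + e) (b e) ((i + e) / ((1 - e) * real N))"
        and a3: "2 \<le> e * real N" and N: "0 < N"
      define M where "M = nat \<lfloor>e * real N\<rfloor>"
      have "real M = real_of_int \<lfloor>e * real N\<rfloor>" using a3 by (simp add: M_def)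
      then have M: "real M \<le> e * real N" "e * real N \<le> 2 * real M"
        using a3 floor_correct[of "e * real N"] by linarith+
      have M0: "0 < M" using M a3 by linarith
      obtain S2 where S2: "finite S2" "S2 \<noteq> {}" "card S2 \<le> M"
        "ennreal (real M powr p) * moment p \<mu>' S2 \<le> ennreal (\<epsilon> powr p)"
      proof (rule opt_quant_err_attained_below[OF M0])
        show "ennreal (real M) * opt_quant_err M p \<mu>' < ennreal \<epsilon>"
          using a1 unfolding M_def[symmetric] div_by_1 powr_one[OF of_nat_0_le_iff] .
      qed (use p \<epsilon> in auto)
      obtain S1 where S1: "finite S1" "S1 \<noteq> {}" "real (card S1) \<le> (i + e) / ((i + e) / ((1 - e) * real N))"
        "moment_on p \<mu> K S1 \<le> ennreal (b e * ((i + e) / ((1 - e) * real N)) powr p)"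
        using a2 by blast
      define S where "S = S1 \<union> S2"
      have S: "finite S" "S \<noteq> {}" using S1 S2 by (auto simp: S_def)
      have "real (card S) \<le> real (card S1) + real (card S2)"
        unfolding S_def using card_Un_le[of S1 S2] by linarith
      also have "\<dots> \<le> (1 - e) * real N + e * real N"
        using S1(3) S2(3) M(1) ie e N by (intro add_mono) auto
      also have "\<dots> = real N" by (simp add: left_diff_distrib)
      finally have cS: "card S \<le> N" by simp
      have inf_le: "infdist x S \<le> infdist x S1" "infdist x S \<le> infdist x S2" for x
        unfolding S_def using S1 S2 by (auto intro!: infdist_mono)
      have Kb: "K \<in> sets \<mu>" "- K \<in> sets \<mu>" using K(1) \<mu> by auto
      have m: "(\<lambda>x. ennreal (infdist x S powr p)) \<in> borel_measurable \<mu>" for S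
        unfolding measurable_cong_sets[OF \<mu> refl] by measurable
      have nn: "0 \<le> b e * ((i + e) / ((1 - e) * real N)) powr p" using b0 by simp
      have "moment p \<mu> S \<le>
          (\<integral>\<^sup>+x. ennreal (infdist x S1 powr p) * indicator K x
            + ennreal (infdist x S2 powr p) * indicator (- K) x \<partial>\<mu>)"
      proof (rule nn_integral_mono)
        fix x
        have "ennreal (infdist x S powr p) \<le> ennreal (infdist x S1 powr p)"
          "ennreal (infdist x S powr p) \<le> ennreal (infdist x S2 powr p)"
          using inf_le[of x] p by (auto intro!: ennreal_leI powr_mono2 infdist_nonneg)
        then show "ennreal (infdist x S powr p) \<le> ennreal (infdist x S1 powr p) * indicator K x
          + ennreal (infdist x S2 powr p) * indicator (- K) x"
          by (cases "x \<in> K") auto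
      qed
      also have "\<dots> = moment_on p \<mu> K S1
          + moment_on p \<mu> (- K) S2"
        using m Kb by (intro nn_integral_add) auto
      also have "moment_on p \<mu> (- K) S2 = moment p \<mu>' S2"
        unfolding \<mu>'_def using m Kb by (subst nn_integral_density) (auto simp: mult.commute)
      finally have J: "moment p \<mu> S \<le> moment_on p \<mu> K S1
          + moment p \<mu>' S2" .
      have "ennreal (real N powr p) * moment p \<mu> S \<le>
          ennreal (real N powr p) * (moment_on p \<mu> K S1
          + moment p \<mu>' S2)"
        by (intro mult_left_mono J) auto
      also have "\<dots> = ennreal (real N powr p) * moment_on p \<mu> K S1
          + ennreal (real N powr p) * moment p \<mu>' S2"
        by (rule distrib_left)
      also have "\<dots> \<le> ennreal (\<phi> e) + ennreal (c - \<phi> e)"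
      proof (rule add_mono)
        have "ennreal (real N powr p) * moment_on p \<mu> K S1
            \<le> ennreal (real N powr p) * ennreal (b e * ((i + e) / ((1 - e) * real N)) powr p)"
          by (intro mult_left_mono S1) auto
        also have "\<dots> = ennreal (real N powr p * (b e * ((i + e) / ((1 - e) * real N)) powr p))"
          using nn by (simp add: ennreal_mult)
        also have "real N powr p * (b e * ((i + e) / ((1 - e) * real N)) powr p) = \<phi> e"
          using N e ie by (simp add: \<phi>_def powr_divide powr_mult)
        finally show "ennreal (real N powr p) * moment_on p \<mu> K S1 \<le> ennreal (\<phi> e)" .
        have "real N \<le> 2 / e * real M" using M(2) e by (simp add: field_simps)
        then have "real N powr p \<le> (2 / e * real M) powr p" using p by (intro powr_mono2) auto
        then have "ennreal (real N powr p) * moment p \<mu>' S2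
            \<le> ennreal ((2 / e * real M) powr p) * moment p \<mu>' S2"
          by (intro mult_right_mono ennreal_leI) auto
        also have "ennreal ((2 / e * real M) powr p) = ennreal ((2 / e) powr p) * ennreal (real M powr p)"
          unfolding powr_mult by (simp add: ennreal_mult)
        also have "\<dots> * moment p \<mu>' S2
            = ennreal ((2 / e) powr p) * (ennreal (real M powr p) * moment p \<mu>' S2)"
          by (rule mult.assoc)
        also have "\<dots> \<le> ennreal ((2 / e) powr p) * ennreal (\<epsilon> powr p)"
          by (intro mult_left_mono S2) auto
        also have "\<dots> = ennreal (c - \<phi> e)" using \<epsilon>(2) by (simp flip: ennreal_mult)
        finally show "ennreal (real N powr p) * moment p \<mu>' S2 \<le> ennreal (c - \<phi> e)" .
      qed
      also have "\<dots> = ennreal c" using e \<phi>0 by (simp flip: ennreal_plus)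
      finally have "ennreal (real N powr p) * moment p \<mu> S \<le> ennreal c" .
      then have "ennreal (real N) * opt_quant_err N p \<mu> \<le> ennreal (c powr (1 / p))"
        using p e \<phi>0 by (intro opt_quant_err_le[OF S cS N]) auto
      then show "ennreal (real N powr (1 / 1)) * opt_quant_err N p \<mu> \<le> ennreal (c powr (1 / p))" by simp
    qed
    then show ?thesis unfolding upper_quant_coeff_def by (rule Limsup_bounded)
  qed
  define q where "q = z * i powr (p + 1)"
  have q0: "0 \<le> q" using z by (simp add: q_def)
  have "((\<lambda>c. c powr (1 / p)) \<longlongrightarrow> q powr (1 / p)) (at_right q)"
    using p q0 by (intro tendsto_powr' tendsto_intros) (auto simp: eventually_at_right_field intro!:
      exI[of _ "q + 1"])
  then have "((\<lambda>c. ennreal (c powr (1 / p))) \<longlongrightarrow> ennreal (q powr (1 / p))) (at_right q)"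
    by (rule tendsto_ennrealI)
  moreover have "\<forall>\<^sub>F c in at_right q. upper_quant_coeff p 1 \<mu> \<le> ennreal (c powr (1 / p))"
    unfolding eventually_at_right_field using approx by (intro exI[of _ "q + 1"]) (auto simp: q_def)
  ultimately have "upper_quant_coeff p 1 \<mu> \<le> ennreal (q powr (1 / p))"
    by (rule tendsto_lowerbound) simp
  also have "q powr (1 / p) = z powr (1 / p) * i powr ((p + 1) / p)"
    using z i p by (simp add: q_def powr_mult powr_powr)
  finally show ?thesis .
qed

lemma lower_le_upper_quant_coeff: "lower_quant_coeff p s \<mu> \<le> upper_quant_coeff p s \<mu>"
  unfolding lower_quant_coeff_def upper_quant_coeff_def by (rule Liminf_le_Limsup) simp

lemma scaled_opt_quant_err_tendsto:
  assumes "lower_quant_coeff p 1 \<mu> = Q" "upper_quant_coeff p 1 \<mu> = Q"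
  shows "(\<lambda>N. ennreal (real N) * opt_quant_err N p \<mu>) \<longlonglongrightarrow> Q"
  using assms lim_imp_Liminf unfolding lower_quant_coeff_def upper_quant_coeff_def
  by (intro Liminf_eq_Limsup) auto

lemma upper_quant_coeff_null:
  assumes "emeasure \<mu> (space \<mu>) = 0" and p: "0 < p"
  shows "upper_quant_coeff p 1 (\<mu> :: 'a::metric_space measure) = 0"
proof -
  have AE0: "AE x in \<mu>. P x" for P
    using assms(1) by (intro AE_I[of _ _ "space \<mu>"]) auto
  have "quant_err p \<mu> S = 0" for S
  proof -
    have "moment p \<mu> S = (\<integral>\<^sup>+x. 0 \<partial>\<mu>)"
      by (rule nn_integral_cong_AE[OF AE0])
    then show ?thesis using p by (simp add: quant_err_def epowr_def)
  qed
  then have *: "opt_quant_err N p \<mu> = 0" if "1 \<le> N" for N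
  proof -
    have "opt_quant_err N p \<mu> \<le> quant_err p \<mu> {undefined}"
      unfolding opt_quant_err_def using that by (intro INF_lower) auto
    then show ?thesis using \<open>\<And>S. quant_err p \<mu> S = 0\<close> by simp
  qed
  have "upper_quant_coeff p 1 \<mu> \<le> 0"
    unfolding upper_quant_coeff_def
    by (rule Limsup_bounded) (use * in \<open>auto simp: eventually_sequentially intro!: exI[of _ 1]\<close>)
  then show ?thesis by simp
qed

text \<open>
  The lower bound and the nets for Lebesgue measure on the unit interval, where there is no
  remainder to be neglected.
\<close>

theorem zador_const_eq:
  assumes p: "1 \<le> p"
  shows "zador_const p = ennreal (zador_power p powr (1 / p))"
proof -
  define \<mu> where "\<mu> = density lborel (indicator {0..1::real})"
  have \<mu>: "sets \<mu> = sets borel" by (simp add: \<mu>_def)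
  have fin: "finite_measure \<mu>" by (intro finite_measureI) (simp add: \<mu>_def emeasure_density)
  have z: "0 < zador_power p" using zador_power_pos p by simp
  define \<rho> where "\<rho> = (indicator {0..1} :: real \<Rightarrow> real)"
  have "(\<integral>\<^sup>+x. ennreal (\<rho> x powr (1 / (1 + p))) \<partial>(hausdorff1 :: real measure))
    = (\<integral>\<^sup>+x. indicator {0..1::real} x \<partial>lborel)"
    unfolding hausdorff1_eq_lborel by (intro nn_integral_cong) (auto simp: \<rho>_def indicator_def)
  also have "\<dots> = 1" by simp
  finally have I: "(\<integral>\<^sup>+x. ennreal (\<rho> x powr (1 / (1 + p))) \<partial>(hausdorff1 :: real measure)) = 1" .
  have "density hausdorff1 (\<lambda>x. ennreal (\<rho> x)) = \<mu>"
    unfolding \<mu>_def hausdorff1_eq_lborel \<rho>_def by (intro density_cong) (auto simp: indicator_def)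
  then have "ennreal (zador_power p powr (1 / p)) * epowr 1 ((p + 1) / p) \<le> lower_quant_coeff p 1 \<mu>"
    using lower_quant_coeff_ge[OF p \<mu> fin, of \<rho>] I by (auto simp: \<rho>_def)
  then have lower: "ennreal (zador_power p powr (1 / p)) \<le> lower_quant_coeff p 1 \<mu>"
    by (simp add: epowr_def)
  have "upper_quant_coeff p 1 \<mu> \<le> ennreal (zador_power p powr (1 / p) * 1 powr ((p + 1) / p))"
  proof (rule upper_quant_coeff_le_nets_limit[OF p \<mu>])
    fix e \<epsilon> :: real assume e: "0 < e" and \<epsilon>: "0 < \<epsilon>"
    have "emeasure (density \<mu> (indicator (- UNIV))) (space (density \<mu> (indicator (- UNIV)))) = 0"
      by (simp add: emeasure_density)
    then have "upper_quant_coeff p 1 (density \<mu> (indicator (- UNIV))) = 0"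
      using p by (intro upper_quant_coeff_null) auto
    moreover have "nets p \<mu> UNIV (1 + e) ((1 + e) powr (p + 1) * zador_power p * (1 + e) + e)"
    proof -
      have m: "measure lborel {0..1::real} = 1" by simp
      have "nets p \<mu> UNIV (1 + e) ((1 + e) * zador_power p)"
        unfolding nets_def
        using compact_real_net[OF compact_Icc p e, of 0 1, unfolded m] 
      proof (rule eventually_mono, elim exE conjE)
        fix \<delta> W assume W: "finite W" "W \<subseteq> {0..1::real}" "real (card W) \<le> (1 + e) / \<delta>"
          "\<forall>v\<in>{0..1}. \<exists>w\<in>W. dist v w \<le> \<delta>"
          "moment_on p lborel {0..1} W \<le> ennreal ((1 + e) * zador_power p * \<delta> powr p)"
        have "W \<noteq> {}" using W(4) by force
        moreover have "moment_on p \<mu> UNIV W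
            = moment_on p lborel {0..1} W"
          unfolding \<mu>_def by (subst nn_integral_density) (auto simp: mult.commute)
        ultimately show "exists_net p \<mu> UNIV (1 + e) ((1 + e) * zador_power p) \<delta>"
          using W by (intro exI[of _ W]) simp
      qed
      moreover have "(1 + e) * zador_power p \<le> (1 + e) powr (p + 1) * zador_power p * (1 + e) + e"
      proof -
        have "1 \<le> (1 + e) powr (p + 1)" using e p by (intro ge_one_powr_ge_zero) auto
        then have "1 * ((1 + e) * zador_power p) \<le> (1 + e) powr (p + 1) * ((1 + e) * zador_power p)"
          using e z by (intro mult_right_mono) auto
        then show ?thesis using e by (simp add: mult_ac)
      qed
      ultimately show ?thesis by (rule nets_mono[OF _ order_refl])
    qed
    ultimately show "\<exists>K\<in>sets borel. nets p \<mu> K (1 + e) ((1 + e) powr (p + 1) * zador_power p * (1 + e) + e)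
      \<and> upper_quant_coeff p 1 (density \<mu> (indicator (- K))) < ennreal \<epsilon>"
      using \<epsilon> by (intro bexI[of _ UNIV]) auto
  qed (use z in auto)
  then have "upper_quant_coeff p 1 \<mu> \<le> ennreal (zador_power p powr (1 / p))" by simp
  then have "(\<lambda>N. ennreal (real N) * opt_quant_err N p \<mu>) \<longlonglongrightarrow> ennreal (zador_power p powr (1 / p))"
    using lower lower_le_upper_quant_coeff[of p 1 \<mu>]
    by (intro scaled_opt_quant_err_tendsto antisym) (auto intro: order_trans)
  then show ?thesis unfolding zador_const_def \<mu>_def by (rule limI)
qed

section \<open>The quantization coefficient of a rectifiable measure\<close>

theorem theorem1p8:
  fixes \<mu> :: "'a::polish_space measure" and p :: real and \<rho> :: "'a \<Rightarrow> real"
  assumes "1 \<le> p"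
    and "sets \<mu> = sets borel" and "finite_measure \<mu>"
    and "countably_1_rectifiable \<mu>"
    and "finite_moment p \<mu>"
    and "ac_density hausdorff1 \<mu> \<rho>"
  shows
    "let I = (\<integral>\<^sup>+x. ennreal (\<rho> x powr (1 / (1 + p))) \<partial>hausdorff1);
         Q = zador_const p * epowr I ((p + 1) / p)
     in Q \<le> lower_quant_coeff p 1 \<mu> \<and>
        (quantizable p 1 \<mu> \<longrightarrow>
           lower_quant_coeff p 1 \<mu> = Q \<and> upper_quant_coeff p 1 \<mu> = Q \<and>
           (\<lambda>N. ennreal (real N) * opt_quant_err N p \<mu>) \<longlonglongrightarrow> Q \<and>
           (0 < Q \<and> Q < top \<longrightarrow>
              (\<forall>S. asymptotically_optimal p \<mu> S \<longrightarrow>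
                 weakly_converges (\<lambda>N. empirical_measure N (S N))
                   (density hausdorff1 (\<lambda>x. ennreal (\<rho> x powr (1 / (1 + p))) / I)))))"
proof -
  note p = assms(1) and \<mu> = assms(2,3)
  have p0: "0 < p" using p by simp
  note ac = ac_densityD(1-3)[OF assms(2,6)]
  define z where "z = zador_power p"
  have z: "0 < z" using zador_power_pos[OF p0] by (simp add: z_def)
  define I where "I = (\<integral>\<^sup>+x. ennreal (\<rho> x powr (1 / (1 + p))) \<partial>hausdorff1)"
  define Q where "Q = zador_const p * epowr I ((p + 1) / p)"
  have Qz: "Q = ennreal (z powr (1 / p)) * epowr I ((p + 1) / p)"
    by (simp add: Q_def zador_const_eq[OF p] z_def)
  have lower: "Q \<le> lower_quant_coeff p 1 \<mu>"
    unfolding Qz I_def z_def by (rule lower_quant_coeff_ge[OF p \<mu> ac])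
  have Qi: "Q = ennreal (z powr (1 / p) * i powr ((p + 1) / p))" if "I = ennreal i" "0 \<le> i" for i
    using that by (simp add: Qz epowr_def ennreal_mult)
  have upper: "upper_quant_coeff p 1 \<mu> \<le> Q" if q: "quantizable p 1 \<mu>"
  proof (cases I rule: ennreal_cases)
    case (real i)
    have "upper_quant_coeff p 1 \<mu> \<le> ennreal (z powr (1 / p) * i powr ((p + 1) / p))"
    proof (rule upper_quant_coeff_le_nets_limit[OF p \<mu>(1)])
      fix e \<epsilon> :: real assume e: "0 < e" and \<epsilon>: "0 < \<epsilon>"
      obtain \<kappa> where \<kappa>: "0 < \<kappa>" "\<And>D. D \<in> sets borel \<Longrightarrow> emeasure \<mu> D < ennreal \<kappa> \<Longrightarrow>
          upper_quant_coeff p 1 (density \<mu> (indicator D)) < ennreal \<epsilon>"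
        using quantizable_small[OF \<mu>(1) q \<epsilon>] by blast
      obtain K where K: "K \<in> sets borel" "emeasure \<mu> (- K) < ennreal \<kappa>"
        "nets p \<mu> K (i + e) ((1 + e) powr (p + 1) * z * (i + e) + e)"
        using rectifiable_nets[OF p \<mu> assms(4,6) real(2)[unfolded I_def] real(1) e \<kappa>(1)] unfolding z_def
          by blast
      then show "\<exists>K\<in>sets borel. nets p \<mu> K (i + e) ((1 + e) powr (p + 1) * z * (i + e) + e)
          \<and> upper_quant_coeff p 1 (density \<mu> (indicator (- K))) < ennreal \<epsilon>"
        using \<kappa>(2)[of "- K"] by auto
    qed (use z real in auto)
    then show ?thesis using Qi real by simp
  next
    case top
    then show ?thesis using z by (simp add: Qz epowr_def ennreal_mult_top)
  qed
  have eq: "lower_quant_coeff p 1 \<mu> = Q \<and> upper_quant_coeff p 1 \<mu> = Q" if "quantizable p 1 \<mu>"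
    using lower upper[OF that] lower_le_upper_quant_coeff[of p 1 \<mu>] by (auto intro: antisym order_trans)
  have weak: "weakly_converges (\<lambda>N. empirical_measure N (S N)) (density hausdorff1 (\<lambda>x. ennreal (\<rho> x powr
    (1 / (1 + p))) / I))"
    if q: "quantizable p 1 \<mu>" and Q: "0 < Q" "Q < top" and opt: "asymptotically_optimal p \<mu> S" for S
  proof -
    have "I \<noteq> top" using Q z by (auto simp: Qz epowr_def ennreal_mult_top)
    then obtain i where i: "I = ennreal i" "0 \<le> i" by (cases I rule: ennreal_cases) auto
    have "i \<noteq> 0" using Q(1) Qi[OF i] by auto
    then have i0: "0 < i" using i by simp
    have S: "S N \<noteq> {} \<and> finite (S N) \<and> card (S N) \<le> N" if "1 \<le> N" for N
      using opt that by (auto simp: asymptotically_optimal_def)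
    have "(\<lambda>N. ennreal (real N) * quant_err p \<mu> (S N)) \<longlonglongrightarrow> Q"
      using opt eq[OF q] by (simp add: asymptotically_optimal_def)
    have near: "\<forall>\<^sub>F N in sequentially. ennreal (real N powr p) * moment p \<mu> (S N)
        \<le> ennreal (zador_power p * i powr (p + 1) + e)" if e: "0 < e" for e
    proof -
      define r where "r = z * i powr (p + 1)"
      have r0: "0 < r" using z i0 by (simp add: r_def)
      have "Q = ennreal (r powr (1 / p))"
        using Qi[OF i] z i p by (simp add: r_def powr_mult powr_powr)
      moreover have "r powr (1 / p) < (r + e) powr (1 / p)"
        using e r0 p by (intro powr_less_mono2) auto
      ultimately have "Q < ennreal ((r + e) powr (1 / p))" by (simp add: ennreal_less_iff)
      from order_tendstoD(2)[OF \<open>_ \<longlonglongrightarrow> Q\<close> this] eventually_gt_at_top[of 0]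
      show ?thesis
      proof eventually_elim
        case (elim N)
        then have "ennreal (real N) * quant_err p \<mu> (S N) \<le> ennreal ((r + e) powr (1 / p))" by simp
        then have "ennreal (real N powr p) * moment p \<mu> (S N) \<le> ennreal (((r + e) powr (1 / p)) powr p)"
          using elim(2) p by (subst (asm) scaled_quant_err_le_iff) auto
        then show ?case using r0 e p by (simp add: powr_powr r_def z_def)
      qed
    qed
    show ?thesis
      unfolding i(1)
      by (rule near_optimal_weakly_converges[OF p \<mu> ac i(1)[unfolded I_def] i0 S near])
  qed
  have "Q \<le> lower_quant_coeff p 1 \<mu> \<and>
        (quantizable p 1 \<mu> \<longrightarrow>
           lower_quant_coeff p 1 \<mu> = Q \<and> upper_quant_coeff p 1 \<mu> = Q \<and>
           (\<lambda>N. ennreal (real N) * opt_quant_err N p \<mu>) \<longlonglongrightarrow> Q \<and>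
           (0 < Q \<and> Q < top \<longrightarrow>
              (\<forall>S. asymptotically_optimal p \<mu> S \<longrightarrow>
                 weakly_converges (\<lambda>N. empirical_measure N (S N))
                   (density hausdorff1 (\<lambda>x. ennreal (\<rho> x powr (1 / (1 + p))) / I)))))"
    using lower eq weak scaled_opt_quant_err_tendsto[of p \<mu> Q] by blast
  then show ?thesis unfolding Let_def Q_def I_def .
qed

end
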